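(* Fix $\epsilon \in (0,1]$ and a constant $c>0$. There is a randomized algorithm which, given a graph $G$ with $n$ nodes and $m$ edges in the incident-list model, runs in time $O(\min\{m, n\log n\})$ and outputs, for every vertex $v$, a value $\hat c(v)$ that is a $(1+\epsilon)$-factor approximation of the core number $c(v)$ of $v$, i.e. $c(v)/(1+\epsilon) \le \hat c(v) \le (1+\epsilon)\, c(v)$, with high probability.
   Context: $G=(V,E)$ is a simple undirected graph with $n=|V|$ and $m=|E|$. Incident-list model: each vertex has an arbitrarily ordered list of its neighbors, and the algorithm accesses the graph only through degree queries (return $\deg(v)$ for any $v$) and neighbor queries (return the $i$-th entry of $v$'s list), each answered in constant time. A $k$-core of $G$ is a maximal connected induced subgraph in which every vertex has degree at least $k$; the core number $c(v)$ of $v$ is the largest $k$ such that $v$ belongs to a $k$-core. "With high probability" means with probability at least $1-O(1)/n^{c}$.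
   Formalization: The time bound O(min{m, n log n}) fails for graphs with m = o(n) (e.g. no edges, yet n outputs); it is proved literally when n ≤ 2m, and as O(min{max{m,n}, n log n}) for all graphs with n ≥ 2 nodes. *)

theory Defs
  imports "HOL-Probability.Probability"
begin

section \<open>Simple graphs and core numbers\<close>

definition simple_graph :: "'a set \<Rightarrow> 'a set set \<Rightarrow> bool" where
  "simple_graph V E \<longleftrightarrow> finite V \<and> (\<forall>e\<in>E. e \<subseteq> V \<and> card e = 2)"

definition neighbors :: "'a set set \<Rightarrow> 'a \<Rightarrow> 'a set" where
  "neighbors E v = {u. {u, v} \<in> E}"

definition degree :: "'a set set \<Rightarrow> 'a \<Rightarrow> nat" where
  "degree E v = card (neighbors E v)"

definition induced_edges :: "'a set set \<Rightarrow> 'a set \<Rightarrow> 'a set set" where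
  "induced_edges E S = {e \<in> E. e \<subseteq> S}"

definition connected_graph :: "'a set \<Rightarrow> 'a set set \<Rightarrow> bool" where
  "connected_graph V E \<longleftrightarrow> V \<noteq> {} \<and> (\<forall>u\<in>V. \<forall>v\<in>V. (u, v) \<in> {(x, y). {x, y} \<in> E}\<^sup>*)"

definition connected_min_degree :: "'a set \<Rightarrow> 'a set set \<Rightarrow> nat \<Rightarrow> 'a set \<Rightarrow> bool" where
  "connected_min_degree V E k S \<longleftrightarrow>
     S \<subseteq> V \<and> connected_graph S (induced_edges E S) \<and>
     (\<forall>v\<in>S. degree (induced_edges E S) v \<ge> k)"

text \<open>An induced subgraph is identified with its vertex set.\<close>

definition is_k_core :: "'a set \<Rightarrow> 'a set set \<Rightarrow> nat \<Rightarrow> 'a set \<Rightarrow> bool" where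
  "is_k_core V E k S \<longleftrightarrow>
     connected_min_degree V E k S \<and>
     (\<forall>S'. connected_min_degree V E k S' \<and> S \<subseteq> S' \<longrightarrow> S' = S)"

text \<open>For a vertex \<open>v\<close> of a finite graph the set below is finite, and it contains \<open>0\<close>
  because the connected component of \<open>v\<close> is a \<open>0\<close>-core.\<close>

definition core_number :: "'a set \<Rightarrow> 'a set set \<Rightarrow> 'a \<Rightarrow> nat" where
  "core_number V E v = Max {k. \<exists>S. is_k_core V E k S \<and> v \<in> S}"


section \<open>Incident lists\<close>

text \<open>The vertices are \<open>0, \<dots>, n - 1\<close>; \<open>adj v\<close> lists the neighbors of \<open>v\<close> in arbitrary order.\<close>

definition incident_lists :: "nat \<Rightarrow> nat set set \<Rightarrow> (nat \<Rightarrow> nat list) \<Rightarrow> bool" where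
  "incident_lists n E adj \<longleftrightarrow>
     simple_graph {..<n} E \<and> (\<forall>v<n. distinct (adj v) \<and> set (adj v) = neighbors E v)"

text \<open>Queries outside the graph return \<open>0\<close>. Positions in a list are counted from \<open>0\<close>.\<close>

definition degree_query :: "nat \<Rightarrow> (nat \<Rightarrow> nat list) \<Rightarrow> nat \<Rightarrow> nat" where
  "degree_query n adj v = (if v < n then length (adj v) else 0)"

definition neighbor_query :: "nat \<Rightarrow> (nat \<Rightarrow> nat list) \<Rightarrow> nat \<Rightarrow> nat \<Rightarrow> nat" where
  "neighbor_query n adj v i = (if v < n \<and> i < length (adj v) then adj v ! i else 0)"


section \<open>Randomized word RAM\<close>

text \<open>
  Algorithms are programs over finitely many scalar variables and arrays, all of whose
  contents are machine words, i.e. numbers below \<open>2 ^ w\<close>. A single step evaluates the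
  expressions of one elementary command; these have a size fixed by the program, so that
  charging one unit for them changes the running time by a constant factor only.
\<close>

datatype exp =
    Const nat
  | Var nat
  | Read nat exp
  | Add exp exp
  | Sub exp exp
  | Mul exp exp
  | Div exp exp
  | Less exp exp
  | Equal exp exp

datatype com =
    Skip
  | Assign nat exp
  | Write nat exp exp
  | Degree nat exp
  | Neighbor nat exp exp
  | Random nat exp
  | Seq com com
  | If exp com com
  | While exp com

record store =
  var :: "nat \<Rightarrow> nat"
  arr :: "nat \<Rightarrow> nat \<Rightarrow> nat"

text \<open>Addition and multiplication wrap around, subtraction is truncated at \<open>0\<close>,
  and division by \<open>0\<close> yields \<open>0\<close>.\<close>

primrec eval_exp :: "nat \<Rightarrow> exp \<Rightarrow> store \<Rightarrow> nat" where
  "eval_exp w (Const k) s = k mod 2 ^ w"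
| "eval_exp w (Var x) s = var s x"
| "eval_exp w (Read a e) s = arr s a (eval_exp w e s)"
| "eval_exp w (Add e f) s = (eval_exp w e s + eval_exp w f s) mod 2 ^ w"
| "eval_exp w (Sub e f) s = eval_exp w e s - eval_exp w f s"
| "eval_exp w (Mul e f) s = (eval_exp w e s * eval_exp w f s) mod 2 ^ w"
| "eval_exp w (Div e f) s = eval_exp w e s div eval_exp w f s"
| "eval_exp w (Less e f) s = of_bool (eval_exp w e s < eval_exp w f s) mod 2 ^ w"
| "eval_exp w (Equal e f) s = of_bool (eval_exp w e s = eval_exp w f s) mod 2 ^ w"

definition set_var :: "nat \<Rightarrow> nat \<Rightarrow> store \<Rightarrow> store" where
  "set_var x k s = s\<lparr>var := (var s)(x := k)\<rparr>"

definition set_arr :: "nat \<Rightarrow> nat \<Rightarrow> nat \<Rightarrow> store \<Rightarrow> store" where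
  "set_arr a i k s = s\<lparr>arr := (arr s)(a := (arr s a)(i := k))\<rparr>"

text \<open>
  One step, taking unit time. \<open>Random x e\<close> draws uniformly from \<open>{0, \<dots>, k - 1}\<close>, where
  \<open>k\<close> is the value of \<open>e\<close> (and yields \<open>0\<close> if \<open>k = 0\<close>). Conditions hold if they are nonzero.
  The halted program \<open>Skip\<close> stays put.
\<close>

primrec step :: "nat \<Rightarrow> nat \<Rightarrow> (nat \<Rightarrow> nat list) \<Rightarrow> com \<Rightarrow> store \<Rightarrow> (com \<times> store) pmf" where
  "step w n adj Skip s = return_pmf (Skip, s)"
| "step w n adj (Assign x e) s = return_pmf (Skip, set_var x (eval_exp w e s) s)"
| "step w n adj (Write a e f) s =
     return_pmf (Skip, set_arr a (eval_exp w e s) (eval_exp w f s) s)"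
| "step w n adj (Degree x e) s =
     return_pmf (Skip, set_var x (degree_query n adj (eval_exp w e s)) s)"
| "step w n adj (Neighbor x e f) s =
     return_pmf (Skip, set_var x (neighbor_query n adj (eval_exp w e s) (eval_exp w f s)) s)"
| "step w n adj (Random x e) s =
     map_pmf (\<lambda>k. (Skip, set_var x k s)) (pmf_of_set {..<max 1 (eval_exp w e s)})"
| "step w n adj (Seq c d) s =
     (if c = Skip then return_pmf (d, s)
      else map_pmf (\<lambda>(c', s'). (Seq c' d, s')) (step w n adj c s))"
| "step w n adj (If e c d) s = return_pmf (if eval_exp w e s \<noteq> 0 then c else d, s)"
| "step w n adj (While e c) s =
     return_pmf (if eval_exp w e s \<noteq> 0 then Seq c (While e c) else Skip, s)"

primrec steps ::
    "nat \<Rightarrow> nat \<Rightarrow> (nat \<Rightarrow> nat list) \<Rightarrow> nat \<Rightarrow> com \<times> store \<Rightarrow> (com \<times> store) pmf" where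
  "steps w n adj 0 cfg = return_pmf cfg"
| "steps w n adj (Suc t) cfg =
     bind_pmf (steps w n adj t cfg) (\<lambda>(c, s). step w n adj c s)"

text \<open>Words have \<open>\<Theta>(log n)\<close> bits; for \<open>\<kappa> \<ge> 1\<close> every number up to \<open>n\<close> fits into a word.\<close>

definition word_size :: "nat \<Rightarrow> nat \<Rightarrow> nat" where
  "word_size \<kappa> n = \<kappa> * nat \<lceil>log 2 (real n + 1)\<rceil>"

text \<open>Initially variable \<open>0\<close> holds the number of vertices, and everything else is \<open>0\<close>.\<close>

definition initial_store :: "nat \<Rightarrow> store" where
  "initial_store n = \<lparr>var = (\<lambda>_. 0)(0 := n), arr = (\<lambda>_ _. 0)\<rparr>"

text \<open>The distribution of the configuration reached within \<open>t\<close> time units.\<close>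

definition run :: "nat \<Rightarrow> com \<Rightarrow> nat \<Rightarrow> (nat \<Rightarrow> nat list) \<Rightarrow> real \<Rightarrow> (com \<times> store) pmf" where
  "run \<kappa> P n adj t = steps (word_size \<kappa> n) n adj (nat \<lfloor>t\<rfloor>) (P, initial_store n)"

text \<open>All random choices are covered, so this is a worst-case running time.\<close>

definition halts_within ::
    "nat \<Rightarrow> com \<Rightarrow> nat \<Rightarrow> (nat \<Rightarrow> nat list) \<Rightarrow> real \<Rightarrow> bool" where
  "halts_within \<kappa> P n adj t \<longleftrightarrow> (\<forall>(c, s) \<in> set_pmf (run \<kappa> P n adj t). c = Skip)"

text \<open>The value output for \<open>v\<close> is a fraction, with numerator and denominator in the
  \<open>v\<close>-th cells of arrays \<open>0\<close> and \<open>1\<close>.\<close>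

definition output_value :: "store \<Rightarrow> nat \<Rightarrow> real" where
  "output_value s v = real (arr s 0 v) / real (arr s 1 v)"

definition approximates_core_numbers :: "real \<Rightarrow> nat \<Rightarrow> nat set set \<Rightarrow> store \<Rightarrow> bool" where
  "approximates_core_numbers \<epsilon> n E s \<longleftrightarrow>
     (\<forall>v<n. arr s 1 v \<noteq> 0 \<and>
        real (core_number {..<n} E v) / (1 + \<epsilon>) \<le> output_value s v \<and>
        output_value s v \<le> (1 + \<epsilon>) * real (core_number {..<n} E v))"

end

theory Submission
  imports Defs
begin

text \<open>
  If the degree sum is at most \<open>n log n\<close>, the graph is read completely and the vertices of degree
  less than \<open>k\<close> are removed for \<open>k = 1, 2, \<dots>\<close>; a vertex takes part in at most \<open>deg v + 1\<close> rounds.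

  Otherwise the thresholds decrease geometrically from \<open>n\<close>, and a vertex that survives the peeling
  at threshold \<open>k\<close> is assigned the estimate \<open>k\<close> and stays forever. At threshold \<open>k\<close> every unassigned
  vertex draws \<open>deg v \<cdot> s / k\<close> neighbors, \<open>s = \<Theta>(log n)\<close>, and is peeled when fewer than \<open>s\<close> of them
  survive. Correctness needs a Chernoff bound for only two fixed sets per vertex, the vertices of
  large core number and the vertices that follow in a degeneracy order. Unassigned vertices have
  core number \<open>O(k)\<close>, and the degrees of the vertices with \<open>c(v) < x\<close> sum to at most twice their core
  numbers; hence the sample sizes form a geometric series for each vertex, and their total is
  \<open>O(n log n)\<close>. An explicit budget makes this a worst-case bound.
\<close>

section \<open>A program logic with fuel\<close>

text \<open>The set that survives a peeling depends on all samples, so no tail bound applies to it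
  directly, and a union bound over all sets is out of reach. This forces the comparison with sets
  that are fixed before any draw. The level \<open>K\<close> of the code is \<open>D + 1\<close>
  times the threshold k above. A vertex makes about \<open>deg v * S * (D + 1) / K\<close> draws, so
  \<open>S\<close> hits stand for \<open>K / (D + 1)\<close> neighbors, which is the estimate that
  is output. If \<open>K \<le> D * core v\<close>, the first set receives at least
  \<open>S * (1 + 1 / D)\<close> expected hits; if
  \<open>D * (D + 1) * core v < (D - 1) * K\<close>, the second receives, up to rounding, at most
  \<open>S * (1 - 1 / D)\<close>. With \<open>D\<close> of order 1/\<epsilon> these gaps cost a
  factor 1 + \<epsilon>, and \<open>S\<close> of order \<open>D * D * (c + 3)\<close> times log n
  makes one vertex fail at one level with probability at most n to the power -(c + 3). As time is
  bounded in every run, it never relies on good samples: fuel is charged to the samples actually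
  drawn, and only the claim that the budget never bites depends on luck.\<close>

primrec written_vars :: "com \<Rightarrow> nat set" where
  "written_vars Skip = {}"
| "written_vars (Assign x e) = {x}"
| "written_vars (Write a e f) = {}"
| "written_vars (Degree x e) = {x}"
| "written_vars (Neighbor x e f) = {x}"
| "written_vars (Random x e) = {x}"
| "written_vars (Seq c d) = written_vars c \<union> written_vars d"
| "written_vars (If e c d) = written_vars c \<union> written_vars d"
| "written_vars (While e c) = written_vars c"

primrec written_arrs :: "com \<Rightarrow> nat set" where
  "written_arrs Skip = {}"
| "written_arrs (Assign x e) = {}"
| "written_arrs (Write a e f) = {a}"
| "written_arrs (Degree x e) = {}"
| "written_arrs (Neighbor x e f) = {}"
| "written_arrs (Random x e) = {}"
| "written_arrs (Seq c d) = written_arrs c \<union> written_arrs d"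
| "written_arrs (If e c d) = written_arrs c \<union> written_arrs d"
| "written_arrs (While e c) = written_arrs c"

text \<open>The frame condition of \<open>c\<close>. The rules \<open>sure_mono\<close>,
  \<open>sure_While\<close>, \<open>mean_mono\<close> and \<open>mean_While\<close> supply it, so
  that invariants need not mention the variables and arrays that \<open>c\<close> leaves
  alone.\<close>

definition agree :: "com \<Rightarrow> store \<Rightarrow> store \<Rightarrow> bool" where
  "agree c s s' \<longleftrightarrow> (\<forall>x. x \<notin> written_vars c \<longrightarrow> var s' x = var s x) \<and>
     (\<forall>a. a \<notin> written_arrs c \<longrightarrow> arr s' a = arr s a)"

lemma agree_refl [simp]: "agree c s s"
  by (simp add: agree_def)

lemma agree_trans: "agree c s s' \<Longrightarrow> agree c s' s'' \<Longrightarrow> agree c s s''"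
  by (simp add: agree_def)

lemma agree_var: "agree c s s' \<Longrightarrow> x \<notin> written_vars c \<Longrightarrow> var s' x = var s x"
  by (simp add: agree_def)

lemma agree_arr: "agree c s s' \<Longrightarrow> a \<notin> written_arrs c \<Longrightarrow> arr s' a = arr s a"
  by (simp add: agree_def)

lemma var_set_var [simp]: "var (set_var x k s) = (var s)(x := k)"
  and arr_set_var [simp]: "arr (set_var x k s) = arr s"
  and var_set_arr [simp]: "var (set_arr a i k s) = var s"
  and arr_set_arr [simp]: "arr (set_arr a i k s) = (arr s)(a := (arr s a)(i := k))"
  by (simp_all add: set_var_def set_arr_def)

lemma step_written:
  assumes "x \<in> set_pmf (step w n adj c s)"
  shows "written_vars (fst x) \<subseteq> written_vars c \<and> written_arrs (fst x) \<subseteq> written_arrs c \<and> agree c s (snd x)"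
  using assms
proof (induction c arbitrary: x)
  case (Seq c d)
  show ?case
  proof (cases "c = Skip")
    case True
    then show ?thesis using Seq.prems by simp
  next
    case False
    then obtain y where y: "y \<in> set_pmf (step w n adj c s)" "x = (Seq (fst y) d, snd y)"
      using Seq.prems by (auto simp: case_prod_beta)
    show ?thesis using Seq.IH(1)[OF y(1)] y(2) by (auto simp: agree_def)
  qed
qed (auto simp: agree_def split: if_splits)

lemma agree_mono:
  assumes "agree c s s'" "written_vars c \<subseteq> written_vars d" "written_arrs c \<subseteq> written_arrs d"
  shows "agree d s s'"
  using assms unfolding agree_def by blast

locale ram =
  fixes w n :: nat and adj :: "nat \<Rightarrow> nat list"
begin

text \<open>
  \<open>t\<close> is the fuel. Postconditions see the remaining fuel, so that they can express amortized
  running times; \<open>mean\<close> is \<open>\<top>\<close> if some run does not halt in time.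
\<close>

primrec sure :: "nat \<Rightarrow> com \<Rightarrow> store \<Rightarrow> (nat \<Rightarrow> store \<Rightarrow> bool) \<Rightarrow> bool" where
  "sure 0 c s Q = (c = Skip \<and> Q 0 s)"
| "sure (Suc t) c s Q =
     (if c = Skip then Q (Suc t) s
      else \<forall>x \<in> set_pmf (step w n adj c s). sure t (fst x) (snd x) Q)"

primrec mean :: "nat \<Rightarrow> com \<Rightarrow> store \<Rightarrow> (nat \<Rightarrow> store \<Rightarrow> ennreal) \<Rightarrow> ennreal" where
  "mean 0 c s f = (if c = Skip then f 0 s else \<top>)"
| "mean (Suc t) c s f =
     (if c = Skip then f (Suc t) s
      else \<integral>\<^sup>+x. mean t (fst x) (snd x) f \<partial>measure_pmf (step w n adj c s))"

lemma sure_mono: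
  assumes "sure t c s Q" "\<And>r s'. r \<le> t \<Longrightarrow> agree c s s' \<Longrightarrow> Q r s' \<Longrightarrow> Q' r s'"
  shows "sure t c s Q'"
  using assms
proof (induction t arbitrary: c s)
  case (Suc t)
  show ?case
  proof (cases "c = Skip")
    case False
    show ?thesis
    proof (simp add: False, intro ballI)
      fix x assume x: "x \<in> set_pmf (step w n adj c s)"
      note wr = step_written[OF x]
      show "sure t (fst x) (snd x) Q'"
      proof (rule Suc.IH)
        show "sure t (fst x) (snd x) Q" using Suc.prems(1) False x by auto
        fix r s' assume "r \<le> t" "agree (fst x) (snd x) s'" "Q r s'"
        moreover have "agree c s s'"
          using agree_mono[OF \<open>agree (fst x) (snd x) s'\<close>, of c] wr agree_trans by blast
        ultimately show "Q' r s'" using Suc.prems(2) by simp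
      qed
    qed
  qed (use Suc.prems in auto)
qed auto

lemma sure_conseq:
  assumes "sure t c s Q" "\<And>r s'. Q r s' \<Longrightarrow> Q' r s'"
  shows "sure t c s Q'"
  using sure_mono[OF assms(1)] assms(2) by blast

lemma sure_Skip [simp]: "sure t Skip s Q = Q t s"
  by (cases t) auto

lemma sure_Assign [simp]:
  "sure t (Assign x e) s Q = (0 < t \<and> Q (t - 1) (set_var x (eval_exp w e s) s))"
  by (cases t) auto

lemma sure_Write [simp]:
  "sure t (Write a e f) s Q = (0 < t \<and> Q (t - 1) (set_arr a (eval_exp w e s) (eval_exp w f s) s))"
  by (cases t) auto

lemma sure_Degree [simp]:
  "sure t (Degree x e) s Q = (0 < t \<and> Q (t - 1) (set_var x (degree_query n adj (eval_exp w e s)) s))"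
  by (cases t) auto

lemma sure_Neighbor [simp]:
  "sure t (Neighbor x e f) s Q =
    (0 < t \<and> Q (t - 1) (set_var x (neighbor_query n adj (eval_exp w e s) (eval_exp w f s)) s))"
  by (cases t) auto

lemma sure_If [simp]:
  "sure t (If e c d) s Q =
    (0 < t \<and> (if eval_exp w e s \<noteq> 0 then sure (t - 1) c s Q else sure (t - 1) d s Q))"
  by (cases t) auto

text \<open>The \<open>r - 1\<close> pays for the step from \<open>Seq Skip d\<close> to
  \<open>d\<close>. Hence k unit commands in sequence cost 2k - 1 units, for instance 13 for the
  seven commands of \<open>insert_node\<close>; most constants below arise in this way.\<close>

lemma sure_Seq [simp]:
  "sure t (Seq c d) s Q = sure t c s (\<lambda>r s'. 0 < r \<and> sure (r - 1) d s' Q)"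
  by (induction t arbitrary: c s) (auto simp: case_prod_beta)

text \<open>Every step consumes fuel, so the fuel is itself the variant: an invariant on store and
  remaining fuel proves termination and running time at once.\<close>

lemma sure_While:
  assumes "I t s"
    and "\<And>t s'. I t s' \<Longrightarrow> agree c s s' \<Longrightarrow> 0 < t \<and>
      (if eval_exp w e s' \<noteq> 0 then sure (t - 1) c s' (\<lambda>r s''. 0 < r \<and> I (r - 1) s'') else Q (t - 1) s')"
  shows "sure t (While e c) s Q"
proof -
  have "sure t (While e c) s' Q" if "I t s'" "agree c s s'" for t s'
    using that
  proof (induction t arbitrary: s' rule: less_induct)
    case (less t)
    note st = assms(2)[OF less.prems]
    then obtain t' where t: "t = Suc t'" by (cases t) auto
    show ?case
    proof (cases "eval_exp w e s' \<noteq> 0")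
      case True
      have "sure t' c s' (\<lambda>r s''. 0 < r \<and> sure (r - 1) (While e c) s'' Q)"
      proof (rule sure_mono)
        show "sure t' c s' (\<lambda>r s''. 0 < r \<and> I (r - 1) s'')" using st True t by simp
        fix r s'' assume r: "r \<le> t'" "agree c s' s''" "0 < r \<and> I (r - 1) s''"
        show "0 < r \<and> sure (r - 1) (While e c) s'' Q"
          using less.IH[of "r - 1" s''] r t agree_trans[OF less.prems(2)] by auto
      qed
      then show ?thesis using t True by simp
    next
      case False
      then show ?thesis using st t by simp
    qed
  qed
  then show ?thesis using assms(1) by simp
qed

lemma mean_mono:
  assumes "\<And>r s'. r \<le> t \<Longrightarrow> agree c s s' \<Longrightarrow> f r s' \<le> g r s'"
  shows "mean t c s f \<le> mean t c s g"
  using assms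
proof (induction t arbitrary: c s)
  case (Suc t)
  show ?case
  proof (cases "c = Skip")
    case False
    have "mean t (fst x) (snd x) f \<le> mean t (fst x) (snd x) g"
      if x: "x \<in> set_pmf (step w n adj c s)" for x
    proof (rule Suc.IH)
      note wr = step_written[OF x]
      fix r s' assume "r \<le> t" "agree (fst x) (snd x) s'"
      moreover have "agree c s s'"
        using agree_mono[OF \<open>agree (fst x) (snd x) s'\<close>, of c] wr agree_trans by blast
      ultimately show "f r s' \<le> g r s'" using Suc.prems by simp
    qed
    then show ?thesis using False
      by (auto intro!: nn_integral_mono_AE simp: AE_measure_pmf_iff)
  qed (use Suc.prems in auto)
qed auto

lemma mean_Skip [simp]: "mean t Skip s f = f t s"
  by (cases t) auto

lemma mean_Seq:
  "mean t (Seq c d) s f = mean t c s (\<lambda>r s'. if r = 0 then \<top> else mean (r - 1) d s' f)"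
  by (induction t arbitrary: c s) (auto simp: case_prod_beta)

lemma mean_Assign:
  assumes "0 < t"
  shows "mean t (Assign x e) s f = f (t - 1) (set_var x (eval_exp w e s) s)"
  using assms by (cases t) auto

lemma mean_Random:
  assumes "0 < t"
  shows "mean t (Random x e) s f =
    (\<integral>\<^sup>+k. f (t - 1) (set_var x k s) \<partial>measure_pmf (pmf_of_set {..<max 1 (eval_exp w e s)}))"
  using assms by (cases t) auto

text \<open>Brings specifications that hold in all runs into bounds on expectations; the
  deterministic parts of the program are handled this way.\<close>

lemma mean_le_sure:
  assumes "sure t c s Q" "\<And>r s'. Q r s' \<Longrightarrow> f r s' \<le> b"
  shows "mean t c s f \<le> b"
  using assms(1)
proof (induction t arbitrary: c s)
  case (Suc t)
  show ?case
  proof (cases "c = Skip")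
    case False
    have "(\<integral>\<^sup>+x. mean t (fst x) (snd x) f \<partial>measure_pmf (step w n adj c s))
        \<le> (\<integral>\<^sup>+x. b \<partial>measure_pmf (step w n adj c s))"
      using Suc False by (auto intro!: nn_integral_mono_AE simp: AE_measure_pmf_iff simp del: nn_integral_const)
    also have "\<dots> = b" by simp
    finally show ?thesis using False by simp
  qed (use Suc.prems assms in auto)
qed (use assms in auto)

text \<open>A run without fuel contributes \<top>, and every configuration in the support has
  positive probability. So a finite expectation already certifies the worst-case running
  time.\<close>

lemma sure_if_mean_finite:
  assumes "mean t c s f < \<top>"
  shows "sure t c s (\<lambda>r s'. f r s' < \<top>)"
  using assms
proof (induction t arbitrary: c s)
  case (Suc t)
  show ?case
  proof (cases "c = Skip")
    case False
    have "AE x in measure_pmf (step w n adj c s). mean t (fst x) (snd x) f \<noteq> \<infinity>"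
      using Suc.prems False by (intro nn_integral_PInf_AE) (auto simp: top.not_eq_extremum)
    then show ?thesis using Suc.IH False by (auto simp: AE_measure_pmf_iff top.not_eq_extremum)
  qed (use Suc.prems in auto)
qed (auto split: if_splits)

text \<open>Allows the exact branch, which draws nothing at random, to reuse the probabilistic
  analysis of sampling.\<close>

lemma sure_if_mean_zero:
  assumes "mean t c s f = 0"
  shows "sure t c s (\<lambda>r s'. f r s' = 0)"
  using assms
proof (induction t arbitrary: c s)
  case (Suc t)
  show ?case
  proof (cases "c = Skip")
    case False
    have "AE x in measure_pmf (step w n adj c s). mean t (fst x) (snd x) f = 0"
      using Suc.prems False by (subst nn_integral_0_iff_AE[symmetric]) auto
    then show ?thesis using Suc.IH False by (auto simp: AE_measure_pmf_iff)
  qed (use Suc.prems in auto)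
qed (auto split: if_splits)

lemma mean_add_const:
  "mean t c s (\<lambda>r s'. k + f r s') \<le> k + mean t c s f"
proof (induction t arbitrary: c s)
  case (Suc t)
  show ?case
  proof (cases "c = Skip")
    case False
    have "(\<integral>\<^sup>+x. mean t (fst x) (snd x) (\<lambda>r s'. k + f r s') \<partial>measure_pmf (step w n adj c s))
        \<le> (\<integral>\<^sup>+x. k + mean t (fst x) (snd x) f \<partial>measure_pmf (step w n adj c s))"
      using Suc by (auto intro!: nn_integral_mono)
    also have "\<dots> = k + (\<integral>\<^sup>+x. mean t (fst x) (snd x) f \<partial>measure_pmf (step w n adj c s))"
      by (subst nn_integral_add) (auto simp: measure_pmf.emeasure_space_1)
    finally show ?thesis using False by simp
  qed simp
qed simp

text \<open>\<open>V\<close> acts as a nonnegative supermartingale of the loop. Invariants are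
  encoded by letting \<open>V\<close> be \<top> where they fail, which is why the premise may assume
  \<open>V t s' < \<top>\<close>.\<close>

lemma mean_While:
  assumes "\<And>t s'. V t s' < \<top> \<Longrightarrow> agree c s s' \<Longrightarrow> 0 < t \<and>
      (if eval_exp w e s' \<noteq> 0 then mean (t - 1) c s' (\<lambda>r s''. if r = 0 then \<top> else V (r - 1) s'') \<le> V t s'
       else f (t - 1) s' \<le> V t s')"
  shows "mean t (While e c) s f \<le> V t s"
proof -
  have "mean t (While e c) s' f \<le> V t s'" if "agree c s s'" for t s'
    using that
  proof (induction t arbitrary: s' rule: less_induct)
    case (less t)
    show ?case
    proof (cases "V t s' < \<top>")
      case V: True
      note st = assms[OF V less.prems]
      then obtain t' where t: "t = Suc t'" by (cases t) auto
      show ?thesis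
      proof (cases "eval_exp w e s' \<noteq> 0")
        case True
        have "mean t' c s' (\<lambda>r s''. if r = 0 then \<top> else mean (r - 1) (While e c) s'' f)
            \<le> mean t' c s' (\<lambda>r s''. if r = 0 then \<top> else V (r - 1) s'')"
          using less.IH t agree_trans[OF less.prems(1)] by (intro mean_mono) auto
        also have "\<dots> \<le> V t s'" using st True t by simp
        finally show ?thesis using t True by (simp add: mean_Seq)
      next
        case False
        then show ?thesis using st t by simp
      qed
    next
      case False
      then have "V t s' = \<top>" using top.not_eq_extremum by blast
      then show ?thesis by simp
    qed
  qed
  then show ?thesis by simp
qed

section \<open>From the transformers to the distribution of runs\<close>

lemma steps_Skip: "steps w n adj t (Skip, s) = return_pmf (Skip, s)"
  by (induction t) (auto simp: bind_return_pmf)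

text \<open>\<open>steps\<close> adds the new step at the end, whereas \<open>sure\<close> and
  \<open>mean\<close> consume the first one; this reconciles the two recursions.\<close>

lemma steps_Suc_front:
  "steps w n adj (Suc t) (c, s) = bind_pmf (step w n adj c s) (steps w n adj t)"
proof (induction t)
  case 0
  show ?case by (simp add: bind_return_pmf bind_return_pmf')
next
  case (Suc t)
  have "steps w n adj (Suc (Suc t)) (c, s)
      = bind_pmf (steps w n adj (Suc t) (c, s)) (\<lambda>(c, s). step w n adj c s)" by simp
  also have "\<dots> = bind_pmf (step w n adj c s) (steps w n adj (Suc t))"
    by (subst Suc) (simp add: bind_assoc_pmf flip: steps.simps(2))
  finally show ?case .
qed

lemma mean_steps:
  "mean t c s (\<lambda>_. f) = (\<integral>\<^sup>+x. (if fst x = Skip then f (snd x) else \<top>) \<partial>measure_pmf (steps w n adj t (c, s)))"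
proof (induction t arbitrary: c s)
  case (Suc t)
  show ?case
  proof (cases "c = Skip")
    case True
    then show ?thesis by (simp add: steps_Skip del: steps.simps)
  next
    case False
    then show ?thesis
      by (simp add: steps_Suc_front Suc nn_integral_bind_pmf del: steps.simps)
  qed
qed simp

lemma sure_steps:
  assumes "sure t c s Q" "x \<in> set_pmf (steps w n adj t (c, s))"
  shows "fst x = Skip"
  using assms
proof (induction t arbitrary: c s)
  case (Suc t)
  show ?case
  proof (cases "c = Skip")
    case True
    then show ?thesis using Suc.prems by (simp add: steps_Skip del: steps.simps)
  next
    case False
    then obtain y where y: "y \<in> set_pmf (step w n adj c s)" "x \<in> set_pmf (steps w n adj t (fst y, snd y))"
      using Suc.prems(2) unfolding steps_Suc_front by auto
    then show ?thesis using Suc False by auto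
  qed
qed simp

text \<open>Markov's inequality for the indicator of failure. Runs that do not halt have the value
  \<top>, so they are counted among the failures.\<close>

lemma prob_steps_le:
  assumes "mean t c s (\<lambda>_ s'. if R s' then 0 else 1) \<le> ennreal p" "0 \<le> p"
  shows "measure_pmf.prob (steps w n adj t (c, s)) {(c', s'). c' = Skip \<and> R s'} \<ge> 1 - p"
proof -
  let ?M = "measure_pmf (steps w n adj t (c, s))"
  let ?A = "{(c', s'). c' = Skip \<and> R s'}"
  have "emeasure ?M (- ?A) = (\<integral>\<^sup>+x. indicator (- ?A) x \<partial>?M)" by simp
  also have "\<dots> \<le> (\<integral>\<^sup>+x. (if fst x = Skip then (if R (snd x) then 0 else 1) else \<top>) \<partial>?M)"
    by (intro nn_integral_mono) (auto simp: indicator_def)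
  also have "\<dots> \<le> ennreal p" using assms(1) by (simp add: mean_steps)
  finally have "measure_pmf.prob (steps w n adj t (c, s)) (- ?A) \<le> p"
    using assms(2) by (simp add: measure_pmf.emeasure_eq_measure)
  moreover have "measure_pmf.prob (steps w n adj t (c, s)) (- ?A) = 1 - measure_pmf.prob (steps w n adj t (c, s)) ?A"
    using measure_pmf.prob_compl[of ?A "steps w n adj t (c, s)"] by (simp add: Compl_eq_Diff_UNIV)
  ultimately show ?thesis by simp
qed

end

section \<open>Core numbers and degeneracy orders\<close>

locale graph =
  fixes V :: "'a set" and E :: "'a set set"
  assumes simple: "simple_graph V E"
begin

abbreviation core :: "'a \<Rightarrow> nat" where
  "core \<equiv> core_number V E"

lemma finite_V: "finite V"
  using simple by (simp add: simple_graph_def)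

lemma neighbors_subset: "neighbors E v \<subseteq> V"
  using simple by (auto simp: simple_graph_def neighbors_def)

lemma finite_neighbors [simp]: "finite (neighbors E v)"
  using neighbors_subset finite_V finite_subset by blast

lemma neighbors_sym: "u \<in> neighbors E v \<longleftrightarrow> v \<in> neighbors E u"
  by (simp add: neighbors_def insert_commute)

lemma neighbors_irrefl: "v \<notin> neighbors E v"
  using simple by (auto simp: simple_graph_def neighbors_def)

lemma degree_induced_edges:
  assumes "v \<in> S"
  shows "degree (induced_edges E S) v = card (neighbors E v \<inter> S)"
proof -
  have "neighbors (induced_edges E S) v = neighbors E v \<inter> S"
    using assms by (auto simp: neighbors_def induced_edges_def)
  then show ?thesis by (simp add: degree_def)
qed

text \<open>The component of \<open>v\<close> in the graph induced by \<open>S\<close> works: it is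
  closed under neighbors within \<open>S\<close>, so no degree drops.\<close>

lemma connected_min_degree_component:
  assumes S: "S \<subseteq> V" "\<And>u. u \<in> S \<Longrightarrow> k \<le> card (neighbors E u \<inter> S)" and v: "v \<in> S"
  shows "\<exists>T. connected_min_degree V E k T \<and> v \<in> T"
proof -
  define R where "R = {(x, y). {x, y} \<in> induced_edges E S}"
  define T where "T = {u. (v, u) \<in> R\<^sup>*}"
  have R: "(x, y) \<in> R \<longleftrightarrow> y \<in> neighbors E x \<and> x \<in> S \<and> y \<in> S" for x y
    by (auto simp: R_def induced_edges_def neighbors_def insert_commute)
  have symR: "sym R" by (auto simp: sym_def R neighbors_sym)
  have vT: "v \<in> T" by (simp add: T_def)
  have TS: "T \<subseteq> S"
  proof
    fix u assume "u \<in> T"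
    then have "(v, u) \<in> R\<^sup>*" by (simp add: T_def)
    then show "u \<in> S" by (induction rule: rtrancl_induct) (auto simp: v R)
  qed
  have closed: "y \<in> T" if "x \<in> T" "(x, y) \<in> R" for x y
    using that by (auto simp: T_def)
  have nb: "neighbors E u \<inter> T = neighbors E u \<inter> S" if "u \<in> T" for u
    using that TS closed R by blast
  have RT: "(v, u) \<in> {(x, y). {x, y} \<in> induced_edges E T}\<^sup>*" if "u \<in> T" for u
  proof -
    have "(v, u) \<in> R\<^sup>*" using that by (simp add: T_def)
    then show ?thesis
    proof (induction rule: rtrancl_induct)
      case (step y z)
      have yz: "y \<in> T" "z \<in> T" using step(1,2) closed by (auto simp: T_def)
      then have "(y, z) \<in> {(x, y). {x, y} \<in> induced_edges E T}"
        using step(2) by (auto simp: R induced_edges_def neighbors_def insert_commute)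
      then show ?case using step(3) by (rule rtrancl_into_rtrancl[rotated])
    qed simp
  qed
  have sy: "sym {(x, y). {x, y} \<in> induced_edges E T}"
    by (auto simp: sym_def insert_commute)
  have "connected_graph T (induced_edges E T)"
    unfolding connected_graph_def
  proof (intro conjI ballI)
    show "T \<noteq> {}" using vT by blast
    fix x y assume "x \<in> T" "y \<in> T"
    then show "(x, y) \<in> {(x, y). {x, y} \<in> induced_edges E T}\<^sup>*"
      using RT[of x] RT[of y] sym_rtrancl[OF sy] by (meson rtrancl_trans symD)
  qed
  then have "connected_min_degree V E k T"
    using TS S nb by (auto simp: connected_min_degree_def degree_induced_edges)
  then show ?thesis using vT by blast
qed

lemma finite_core_levels: "finite {k. \<exists>S. is_k_core V E k S \<and> v \<in> S}"
proof (rule finite_subset)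
  show "{k. \<exists>S. is_k_core V E k S \<and> v \<in> S} \<subseteq> {..card V}"
  proof
    fix k assume "k \<in> {k. \<exists>S. is_k_core V E k S \<and> v \<in> S}"
    then obtain S where "is_k_core V E k S" "v \<in> S" by blast
    then have "k \<le> card (neighbors E v \<inter> S)"
      by (auto simp: is_k_core_def connected_min_degree_def degree_induced_edges)
    also have "\<dots> \<le> card V"
      using neighbors_subset finite_V by (intro card_mono) auto
    finally show "k \<in> {..card V}" by simp
  qed
qed simp

lemma ex_k_core:
  assumes "connected_min_degree V E k T"
  shows "\<exists>M. is_k_core V E k M \<and> T \<subseteq> M"
proof -
  let ?F = "{T'. connected_min_degree V E k T' \<and> T \<subseteq> T'}"
  have "finite ?F"
    by (rule finite_subset[of _ "Pow V"]) (auto simp: connected_min_degree_def finite_V)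
  then obtain M where M: "M \<in> ?F" "\<And>T'. T' \<in> ?F \<Longrightarrow> M \<subseteq> T' \<Longrightarrow> T' = M"
    using finite_has_maximal[of ?F] assms by (metis (mono_tags, lifting) empty_iff mem_Collect_eq order_refl)
  then have "is_k_core V E k M" unfolding is_k_core_def by blast
  then show ?thesis using M(1) by blast
qed

text \<open>Together with \<open>core_number_dense\<close> this is all that the rest of the proof
  uses of core numbers; connectivity and maximality do not occur again.\<close>

lemma core_number_ge:
  assumes S: "S \<subseteq> V" "\<And>u. u \<in> S \<Longrightarrow> k \<le> card (neighbors E u \<inter> S)" and v: "v \<in> S"
  shows "k \<le> core v"
proof -
  obtain T where T: "connected_min_degree V E k T" "v \<in> T"
    using connected_min_degree_component[OF assms] by blast
  then obtain M where "is_k_core V E k M" "v \<in> M" using ex_k_core by blast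
  then show ?thesis
    unfolding core_number_def by (intro Max_ge finite_core_levels) blast
qed

text \<open>Take a core of level \<open>core v\<close> around \<open>v\<close>. By
  \<open>core_number_ge\<close> all its vertices have core number at least \<open>core v\<close>, so
  the neighbors of \<open>v\<close> inside it can be counted.\<close>

lemma core_number_dense:
  assumes v: "v \<in> V" and k: "k \<le> core v"
  shows "k \<le> card (neighbors E v \<inter> {u \<in> V. k \<le> core u})"
proof -
  obtain T where T: "connected_min_degree V E 0 T" "v \<in> T"
    using connected_min_degree_component[of V 0 v] v by auto
  then have "{k. \<exists>S. is_k_core V E k S \<and> v \<in> S} \<noteq> {}" using ex_k_core[OF T(1)] by blast
  then have "core v \<in> {k. \<exists>S. is_k_core V E k S \<and> v \<in> S}"
    unfolding core_number_def using Max_in finite_core_levels by blast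
  then obtain S where S: "is_k_core V E (core v) S" "v \<in> S" by blast
  have SV: "S \<subseteq> V" and deg: "\<And>u. u \<in> S \<Longrightarrow> core v \<le> card (neighbors E u \<inter> S)"
    using S(1) by (auto simp: is_k_core_def connected_min_degree_def degree_induced_edges)
  have "S \<subseteq> {u \<in> V. k \<le> core u}"
    using core_number_ge[OF SV deg] SV k by fastforce
  then have "card (neighbors E v \<inter> S) \<le> card (neighbors E v \<inter> {u \<in> V. k \<le> core u})"
    by (intro card_mono) auto
  then show ?thesis using deg[OF S(2)] k by linarith
qed

lemma core_number_le_degree: "v \<in> V \<Longrightarrow> core v \<le> card (neighbors E v)"
  using core_number_dense[of v "core v"] card_mono[of "neighbors E v"] finite_neighbors
  by (meson Int_lower1 order_trans order_refl)

lemma degree_less: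
  assumes "v \<in> V"
  shows "card (neighbors E v) < card V"
  using assms neighbors_subset neighbors_irrefl finite_V by (intro psubset_card_mono) blast+

section \<open>Degeneracy orders\<close>

text \<open>Repeated removal of a vertex with few neighbors in the rest. The second hypothesis, that
  \<open>X\<close> is closed upwards in the core numbers, keeps the sets of
  \<open>core_number_dense\<close> inside \<open>X\<close> during the induction.\<close>

lemma ex_degeneracy_order:
  assumes "X \<subseteq> V" "\<And>u v. u \<in> V - X \<Longrightarrow> v \<in> X \<Longrightarrow> core u \<le> core v"
  shows "\<exists>rank :: 'a \<Rightarrow> nat. inj_on rank X \<and> (\<forall>u\<in>X. \<forall>v\<in>X. core u < core v \<longrightarrow> rank u < rank v) \<and>
    (\<forall>v\<in>X. card (neighbors E v \<inter> {w \<in> X. rank v < rank w}) \<le> core v)"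
  using assms
proof (induction "card X" arbitrary: X)
  case 0
  then have "X = {}" using finite_V finite_subset by (metis card_0_eq)
  then show ?case by simp
next
  case (Suc m)
  have finX: "finite X" using Suc.prems(1) finite_V finite_subset by blast
  have "X \<noteq> {}" using Suc.hyps(2) by auto
  define k where "k = Min (core ` X)"
  have kle: "k \<le> core u" if "u \<in> X" for u using that finX by (simp add: k_def)
  have "k \<in> core ` X" using finX \<open>X \<noteq> {}\<close> unfolding k_def by (intro Min_in) auto
  then obtain v0 where v0: "v0 \<in> X" "core v0 = k" by auto
  \<comment> \<open>Otherwise \<open>X\<close> itself would give \<open>v0\<close> the core number
    \<open>Suc k\<close>.\<close>
  have "\<exists>v\<in>X. card (neighbors E v \<inter> X) \<le> k"
  proof (rule ccontr)
    assume "\<not> ?thesis"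
    then have "Suc k \<le> core v0"
      using Suc.prems(1) v0(1) by (intro core_number_ge[of X]) (auto simp: not_le)
    then show False using v0 by simp
  qed
  then obtain v where v: "v \<in> X" "card (neighbors E v \<inter> X) \<le> k" by blast
  \<comment> \<open>A larger core number would give \<open>v\<close> at least \<open>Suc k\<close>
    neighbors of core number \<open>Suc k\<close> or more, and all of these lie in
    \<open>X\<close>.\<close>
  have ck: "core v = k"
  proof (rule ccontr)
    assume "core v \<noteq> k"
    then have "Suc k \<le> core v" using kle v by fastforce
    then have "Suc k \<le> card (neighbors E v \<inter> {u \<in> V. Suc k \<le> core u})"
      using v Suc.prems(1) by (intro core_number_dense) auto
    also have "{u \<in> V. Suc k \<le> core u} \<subseteq> X"
      using Suc.prems(2)[OF _ v0(1)] v0(2) by fastforce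
    then have "card (neighbors E v \<inter> {u \<in> V. Suc k \<le> core u}) \<le> card (neighbors E v \<inter> X)"
      by (intro card_mono) auto
    finally show False using v by simp
  qed
  have "\<exists>rank :: 'a \<Rightarrow> nat. inj_on rank (X - {v}) \<and>
      (\<forall>u\<in>X - {v}. \<forall>w\<in>X - {v}. core u < core w \<longrightarrow> rank u < rank w) \<and>
      (\<forall>u\<in>X - {v}. card (neighbors E u \<inter> {w \<in> X - {v}. rank u < rank w}) \<le> core u)"
  proof (rule Suc.hyps(1))
    show "m = card (X - {v})" using Suc.hyps(2) v finX by simp
    show "X - {v} \<subseteq> V" using Suc.prems by blast
    fix a b assume "a \<in> V - (X - {v})" "b \<in> X - {v}"
    then show "core a \<le> core b" using Suc.prems(2) kle ck by (cases "a = v") auto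
  qed
  then obtain rank :: "'a \<Rightarrow> nat" where rank: "inj_on rank (X - {v})"
      "\<And>u w. u \<in> X - {v} \<Longrightarrow> w \<in> X - {v} \<Longrightarrow> core u < core w \<Longrightarrow> rank u < rank w"
      "\<And>u. u \<in> X - {v} \<Longrightarrow> card (neighbors E u \<inter> {w \<in> X - {v}. rank u < rank w}) \<le> core u"
    by blast
  \<comment> \<open>The removed vertex comes first: its later neighbors are its at most
    \<open>k\<close> neighbors in \<open>X\<close>, and its core number is the least one.\<close>
  define r where "r u = (if u = v then 0 else Suc (rank u))" for u
  have "inj_on r X" using rank(1) by (auto simp: inj_on_def r_def)
  moreover have "r a < r b" if "a \<in> X" "b \<in> X" "core a < core b" for a b
  proof -
    have "b \<noteq> v" using that kle[of a] ck by auto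
    then show ?thesis using rank(2)[of a b] that by (auto simp: r_def)
  qed
  moreover have "card (neighbors E a \<inter> {b \<in> X. r a < r b}) \<le> core a" if "a \<in> X" for a
  proof (cases "a = v")
    case True
    have "card (neighbors E a \<inter> {b \<in> X. r a < r b}) \<le> card (neighbors E v \<inter> X)"
      unfolding True by (intro card_mono) auto
    then show ?thesis using v ck True by simp
  next
    case False
    then have "{b \<in> X. r a < r b} = {b \<in> X - {v}. rank a < rank b}" by (auto simp: r_def)
    then show ?thesis using rank(3)[of a] that False by simp
  qed
  ultimately show ?case by blast
qed

text \<open>One order is fixed for the whole graph, so that the sets of later vertices do not depend
  on the samples.\<close>

definition rank :: "'a \<Rightarrow> nat" where
  "rank = (SOME r. (\<forall>u\<in>V. \<forall>v\<in>V. core u < core v \<longrightarrow> r u < r v) \<and>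
     (\<forall>v\<in>V. card (neighbors E v \<inter> {w. r v < r w}) \<le> core v) \<and> inj_on r V)"

lemma rank_props:
  "(\<forall>u\<in>V. \<forall>v\<in>V. core u < core v \<longrightarrow> rank u < rank v) \<and>
   (\<forall>v\<in>V. card (neighbors E v \<inter> {w. rank v < rank w}) \<le> core v) \<and> inj_on rank V"
proof -
  obtain r :: "'a \<Rightarrow> nat" where r: "inj_on r V \<and> (\<forall>u\<in>V. \<forall>v\<in>V. core u < core v \<longrightarrow> r u < r v) \<and>
      (\<forall>v\<in>V. card (neighbors E v \<inter> {w \<in> V. r v < r w}) \<le> core v)"
    using ex_degeneracy_order[OF subset_refl] by blast
  moreover have "neighbors E v \<inter> {w \<in> V. r v < r w} = neighbors E v \<inter> {w. r v < r w}" for v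
    using neighbors_subset by blast
  ultimately have "(\<forall>u\<in>V. \<forall>v\<in>V. core u < core v \<longrightarrow> r u < r v) \<and>
     (\<forall>v\<in>V. card (neighbors E v \<inter> {w. r v < r w}) \<le> core v) \<and> inj_on r V" by simp
  then have "\<exists>r :: 'a \<Rightarrow> nat. (\<forall>u\<in>V. \<forall>v\<in>V. core u < core v \<longrightarrow> r u < r v) \<and>
     (\<forall>v\<in>V. card (neighbors E v \<inter> {w. r v < r w}) \<le> core v) \<and> inj_on r V" by (rule exI[of _ r])
  then show ?thesis unfolding rank_def by (rule someI_ex)
qed

lemma rank_mono: "u \<in> V \<Longrightarrow> v \<in> V \<Longrightarrow> core u < core v \<Longrightarrow> rank u < rank v"
  and card_later: "v \<in> V \<Longrightarrow> card (neighbors E v \<inter> {w. rank v < rank w}) \<le> core v"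
  and inj_rank: "inj_on rank V"
  using rank_props by blast+

text \<open>Each edge is charged to its end that comes first in a degeneracy order.\<close>

lemma sum_degree_le_sum_core:
  shows "(\<Sum>v | v \<in> V \<and> core v < x. card (neighbors E v)) \<le> 2 * (\<Sum>v | v \<in> V \<and> core v < x. core v)"
proof -
  note inj = inj_rank and mono = rank_mono and later = card_later
  let ?U = "{v \<in> V. core v < x}"
  have finU: "finite ?U" using finite_V by simp
  have split: "card (neighbors E v) = card (neighbors E v \<inter> {w. rank v < rank w})
      + card (neighbors E v \<inter> {w. rank w < rank v})" if "v \<in> V" for v
  proof -
    have "neighbors E v = neighbors E v \<inter> {w. rank v < rank w} \<union> neighbors E v \<inter> {w. rank w < rank v}"
      using inj that neighbors_subset[of v] neighbors_irrefl[of v] by (auto simp: inj_on_def) (metis nat_neq_iff subsetD)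
    moreover have "card (neighbors E v \<inter> {w. rank v < rank w} \<union> neighbors E v \<inter> {w. rank w < rank v}) =
        card (neighbors E v \<inter> {w. rank v < rank w}) + card (neighbors E v \<inter> {w. rank w < rank v})"
      by (rule card_Un_disjoint) auto
    ultimately show ?thesis by (simp only:)
  qed
  have "(\<Sum>v\<in>?U. card (neighbors E v \<inter> {w. rank w < rank v}))
      = card (SIGMA v:?U. neighbors E v \<inter> {w. rank w < rank v})"
    using finU by simp
  also have "\<dots> = card (prod.swap ` (SIGMA v:?U. neighbors E v \<inter> {w. rank w < rank v}))"
    by (rule card_image[symmetric]) (auto intro: inj_onI)
  \<comment> \<open>The earlier end of an edge has a core number that is not larger, so after the
    swap the first component again lies in \<open>?U\<close>.\<close>
  also have "\<dots> \<le> card (SIGMA w:?U. neighbors E w \<inter> {v. rank w < rank v})"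
  proof (rule card_mono)
    show "finite (SIGMA w:?U. neighbors E w \<inter> {v. rank w < rank v})"
      using finU by (intro finite_SigmaI) auto
    show "prod.swap ` (SIGMA v:?U. neighbors E v \<inter> {w. rank w < rank v})
        \<subseteq> (SIGMA w:?U. neighbors E w \<inter> {v. rank w < rank v})"
    proof
      fix p assume "p \<in> prod.swap ` (SIGMA v:?U. neighbors E v \<inter> {w. rank w < rank v})"
      then obtain v w where p: "p = prod.swap (v, w)" and v: "v \<in> V" "core v < x"
        and w: "w \<in> neighbors E v" "rank w < rank v" by blast
      have "w \<in> V" using w neighbors_subset by blast
      moreover have "core w \<le> core v"
        using mono[of v w] v w \<open>w \<in> V\<close> by (meson not_less order.asym)
      ultimately show "p \<in> (SIGMA w:?U. neighbors E w \<inter> {v. rank w < rank v})"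
        using p v w neighbors_sym by auto
    qed
  qed
  also have "\<dots> = (\<Sum>w\<in>?U. card (neighbors E w \<inter> {v. rank w < rank v}))"
    using finU by simp
  also have "\<dots> \<le> (\<Sum>w\<in>?U. core w)"
    using later by (intro sum_mono) auto
  finally have earlier: "(\<Sum>v\<in>?U. card (neighbors E v \<inter> {w. rank w < rank v})) \<le> (\<Sum>w\<in>?U. core w)" .
  have "(\<Sum>v\<in>?U. card (neighbors E v)) = (\<Sum>v\<in>?U. card (neighbors E v \<inter> {w. rank v < rank w}))
      + (\<Sum>v\<in>?U. card (neighbors E v \<inter> {w. rank w < rank v}))"
    by (simp add: split sum.distrib)
  also have "\<dots> \<le> 2 * (\<Sum>w\<in>?U. core w)"
    using earlier sum_mono[of ?U "\<lambda>v. card (neighbors E v \<inter> {w. rank v < rank w})" core] later by simp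
  finally show ?thesis .
qed

lemma sum_degree: "(\<Sum>v\<in>V. card (neighbors E v)) = 2 * card E"
proof -
  have finE: "finite E"
    using simple finite_V by (intro finite_subset[of E "Pow V"]) (auto simp: simple_graph_def)
  have "(\<Sum>v\<in>V. card (neighbors E v)) = (\<Sum>v\<in>V. card {e \<in> E. v \<in> e})"
  proof (rule sum.cong)
    fix v assume v: "v \<in> V"
    have "bij_betw (\<lambda>u. {u, v}) (neighbors E v) {e \<in> E. v \<in> e}"
    proof (rule bij_betwI')
      fix e assume "e \<in> {e \<in> E. v \<in> e}"
      then have e: "e \<in> E" "v \<in> e" "card e = 2" using simple by (auto simp: simple_graph_def)
      then obtain a b where "e = {a, b}" by (auto simp: card_2_iff)
      then show "\<exists>u\<in>neighbors E v. e = {u, v}" using e by (auto simp: neighbors_def insert_commute)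
    qed (auto simp: neighbors_def doubleton_eq_iff)
    then show "card (neighbors E v) = card {e \<in> E. v \<in> e}" by (rule bij_betw_same_card)
  qed simp
  also have "\<dots> = (\<Sum>e\<in>E. card {v \<in> V. v \<in> e})"
    using sum.swap_restrict[OF finite_V finE, of "\<lambda>_ _. 1 :: nat" "\<lambda>v e. v \<in> e"] by simp
  also have "\<dots> = (\<Sum>e\<in>E. 2)"
  proof (rule sum.cong)
    fix e assume "e \<in> E"
    then have "{v \<in> V. v \<in> e} = e" "card e = 2" using simple by (auto simp: simple_graph_def)
    then show "card {v \<in> V. v \<in> e} = 2" by simp
  qed simp
  finally show ?thesis by simp
qed

end

section \<open>Sampling the neighbors of the vertices\<close>

abbreviation (input) "vN \<equiv> 0 :: nat"
abbreviation (input) "vI \<equiv> 2 :: nat"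
abbreviation (input) "vV \<equiv> 3 :: nat"
abbreviation (input) "vDeg \<equiv> 4 :: nat"
abbreviation (input) "vCount \<equiv> 5 :: nat"
abbreviation (input) "vNode \<equiv> 6 :: nat"
abbreviation (input) "vBudget \<equiv> 7 :: nat"
abbreviation (input) "vLen \<equiv> 8 :: nat"
abbreviation (input) "vTop \<equiv> 9 :: nat"
abbreviation (input) "vCur \<equiv> 10 :: nat"
abbreviation (input) "vX \<equiv> 11 :: nat"
abbreviation (input) "vPos \<equiv> 12 :: nat"
abbreviation (input) "vDone \<equiv> 13 :: nat"
abbreviation (input) "vU \<equiv> 14 :: nat"
abbreviation (input) "vLevel \<equiv> 15 :: nat"
abbreviation (input) "vThr \<equiv> 16 :: nat"
abbreviation (input) "vNew \<equiv> 17 :: nat"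
abbreviation (input) "vLog \<equiv> 18 :: nat"
abbreviation (input) "vSum \<equiv> 19 :: nat"

abbreviation (input) "aNum \<equiv> 0 :: nat"
abbreviation (input) "aDen \<equiv> 1 :: nat"
abbreviation (input) "aList \<equiv> 2 :: nat"
abbreviation (input) "aCnt \<equiv> 3 :: nat"
abbreviation (input) "aDead \<equiv> 4 :: nat"
abbreviation (input) "aHead \<equiv> 5 :: nat"
abbreviation (input) "aNext \<equiv> 6 :: nat"
abbreviation (input) "aWho \<equiv> 7 :: nat"
abbreviation (input) "aTgt \<equiv> 8 :: nat"
abbreviation (input) "aStack \<equiv> 9 :: nat"

section \<open>Samples in linked lists\<close>

notation Seq (infixr ";;" 60)

abbreviation (input) incr :: "nat \<Rightarrow> com" where
  "incr x \<equiv> Assign x (Add (Var x) (Const 1))"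

text \<open>Node numbers are never reused; between levels only the heads are cleared. So
  \<open>vNode\<close> counts the samples of all levels and can be compared with the budget, and the
  nodes of the current level are those from some \<open>lo\<close> on.\<close>

definition insert_node :: com where
  "insert_node =
     Neighbor vU (Var vV) (Var vPos) ;;
     Write aNext (Var vNode) (Read aHead (Var vU)) ;;
     Write aHead (Var vU) (Var vNode) ;;
     Write aWho (Var vNode) (Var vV) ;;
     Write aTgt (Var vNode) (Var vU) ;;
     incr vNode ;;
     incr vDone"

definition sample_vertex :: "com \<Rightarrow> com" where
  "sample_vertex pick = While (Less (Var vDone) (Var vCount)) (pick ;; insert_node)"

text \<open>The program never reads \<open>aTgt\<close>; it only records the targets for the proof.
  The samples with a given target form a linked list; node \<open>0\<close> is the empty list, and
  links go from newer to older nodes.\<close>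

definition is_latest :: "(nat \<Rightarrow> nat) \<Rightarrow> nat \<Rightarrow> nat \<Rightarrow> nat \<Rightarrow> nat \<Rightarrow> bool" where
  "is_latest tgt lo b u q \<longleftrightarrow> (q = 0 \<or> lo \<le> q \<and> q < b \<and> tgt q = u) \<and>
     (\<forall>i. lo \<le> i \<longrightarrow> i < b \<longrightarrow> tgt i = u \<longrightarrow> i \<le> q)"

definition linked :: "nat \<Rightarrow> store \<Rightarrow> nat \<Rightarrow> bool" where
  "linked n s lo \<longleftrightarrow> (\<forall>u<n. is_latest (arr s aTgt) lo (var s vNode) u (arr s aHead u)) \<and>
     (\<forall>j. lo \<le> j \<longrightarrow> j < var s vNode \<longrightarrow>
        is_latest (arr s aTgt) lo j (arr s aTgt j) (arr s aNext j) \<and> arr s aTgt j < n)"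

definition hits :: "store \<Rightarrow> nat \<Rightarrow> nat \<Rightarrow> nat set \<Rightarrow> nat" where
  "hits s lo v X = card {j. lo \<le> j \<and> j < var s vNode \<and> arr s aWho j = v \<and> arr s aTgt j \<in> X}"

lemma is_latest_Suc:
  assumes "is_latest tgt lo b u q" "lo \<le> b"
  shows "is_latest (tgt(b := x)) lo (Suc b) u (if u = x then b else q)"
  using assms unfolding is_latest_def by (auto simp: less_Suc_eq)

lemma is_latest_upd:
  assumes "is_latest tgt lo b u q" "b \<le> j"
  shows "is_latest (tgt(j := x)) lo b u q"
  using assms unfolding is_latest_def by auto

lemma linked_set_var: "x \<noteq> vNode \<Longrightarrow> linked n (set_var x k s) lo = linked n s lo"
  by (simp add: linked_def)

context ram
begin

lemma sure_insert_node:
  assumes t: "13 \<le> t" and v: "var s vV < n" "var s vPos < length (adj (var s vV))"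
      "adj (var s vV) ! var s vPos < n"
    and lk: "linked n s lo" and lo: "lo \<le> var s vNode"
    and w: "0 < w" "Suc (var s vNode) < 2 ^ w" "Suc (var s vDone) < 2 ^ w"
  shows "sure t insert_node s (\<lambda>r s'. t \<le> r + 13 \<and> var s' vNode = Suc (var s vNode) \<and>
    var s' vDone = Suc (var s vDone) \<and> linked n s' lo \<and>
    arr s' aWho = (arr s aWho)(var s vNode := var s vV) \<and>
    arr s' aTgt = (arr s aTgt)(var s vNode := adj (var s vV) ! var s vPos))"
proof -
  have one: "1 mod 2 ^ w = (1::nat)" using w(1) by (simp add: mod_less)
  have "linked n s' lo" if
      "var s' vNode = Suc (var s vNode)" 
      "arr s' aTgt = (arr s aTgt)(var s vNode := adj (var s vV) ! var s vPos)"
      "arr s' aHead = (arr s aHead)(adj (var s vV) ! var s vPos := var s vNode)"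
      "arr s' aNext = (arr s aNext)(var s vNode := arr s aHead (adj (var s vV) ! var s vPos))" for s'
    unfolding linked_def
  proof (intro conjI allI impI)
    fix u assume u: "u < n"
    show "is_latest (arr s' aTgt) lo (var s' vNode) u (arr s' aHead u)"
      using is_latest_Suc[of "arr s aTgt" lo "var s vNode" u "arr s aHead u" "adj (var s vV) ! var s vPos"]
        lk lo u that unfolding linked_def by (auto split: if_splits)
  next
    fix j assume j: "lo \<le> j" "j < var s' vNode"
    show "is_latest (arr s' aTgt) lo j (arr s' aTgt j) (arr s' aNext j)"
      using j lk that v unfolding linked_def by (auto simp: less_Suc_eq intro: is_latest_upd)
    show "arr s' aTgt j < n"
      using j lk that v unfolding linked_def by (auto simp: less_Suc_eq)
  qed
  moreover obtain t' where "t = t' + 13" using t by (metis add.commute le_Suc_ex)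
  ultimately show ?thesis
    using v w one unfolding insert_node_def by (simp add: neighbor_query_def)
qed

text \<open>\<open>val i g\<close> stands for a bound on the conditional failure probability when
  the first \<open>i\<close> targets are given by \<open>g\<close>; the premise on it is the
  supermartingale property. The abstract \<open>\<rho>\<close> covers both uniform draws and reading
  the list in order.\<close>

lemma mean_sample_vertex:
  fixes val :: "nat \<Rightarrow> (nat \<Rightarrow> nat) \<Rightarrow> ennreal"
  assumes pick: "\<And>t s f. 0 < t \<Longrightarrow> mean t pick s f =
        (\<integral>\<^sup>+k. f (t - 1) (set_var vPos k s) \<partial>measure_pmf (\<rho> (var s vDone) (var s vDeg)))"
    and wv: "written_vars pick = {vPos}" "written_arrs pick = {}"
    and supp: "\<And>i. i < T \<Longrightarrow> set_pmf (\<rho> i d) \<subseteq> {..<d}"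
    and val: "\<And>i g. i < T \<Longrightarrow> (\<integral>\<^sup>+k. val (Suc i) (g(i := adj v ! k)) \<partial>measure_pmf (\<rho> i d)) \<le> val i g"
    and v: "v < n" "length (adj v) = d" "\<And>k. k < d \<Longrightarrow> adj v ! k < n"
    and s: "var s vV = v" "var s vDeg = d" "var s vCount = T" "var s vNode = J" "var s vDone = 0"
    and lk: "linked n s lo" and lo: "lo \<le> J"
    and w: "0 < w" "J + T < 2 ^ w"
    and t: "17 * T + 1 \<le> t"
  shows "mean t (sample_vertex pick) s (\<lambda>r s'.
      if t \<le> r + 17 * T + 1 \<and> var s' vNode = J + T \<and> linked n s' lo \<and>
        (\<forall>j<J. arr s' aWho j = arr s aWho j \<and> arr s' aTgt j = arr s aTgt j) \<and>
        (\<forall>j. J \<le> j \<longrightarrow> j < J + T \<longrightarrow> arr s' aWho j = v)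
      then val T (\<lambda>i. arr s' aTgt (J + i)) else \<top>) \<le> val 0 (\<lambda>i. arr s aTgt (J + i))"
proof -
  \<comment> \<open>17 units per draw: the loop test, the draw, 13 for \<open>insert_node\<close>,
    and two sequencing steps.\<close>
  define I where "I r s' \<longleftrightarrow> var s' vDone \<le> T \<and> t \<le> r + 17 * var s' vDone \<and> var s' vNode = J + var s' vDone \<and> linked n s' lo \<and>
        (\<forall>j<J. arr s' aWho j = arr s aWho j \<and> arr s' aTgt j = arr s aTgt j) \<and>
        (\<forall>j. J \<le> j \<longrightarrow> j < var s' vNode \<longrightarrow> arr s' aWho j = v)" for r s'
  define W where "W r s' = (if I r s' then val (var s' vDone) (\<lambda>i. arr s' aTgt (J + i)) else \<top>)" for r s'
  have "mean t (sample_vertex pick) s (\<lambda>r s'.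
      if t \<le> r + 17 * T + 1 \<and> var s' vNode = J + T \<and> linked n s' lo \<and>
        (\<forall>j<J. arr s' aWho j = arr s aWho j \<and> arr s' aTgt j = arr s aTgt j) \<and>
        (\<forall>j. J \<le> j \<longrightarrow> j < J + T \<longrightarrow> arr s' aWho j = v)
      then val T (\<lambda>i. arr s' aTgt (J + i)) else \<top>) \<le> W t s"
    unfolding sample_vertex_def
  proof (rule mean_While)
    fix r s' assume W: "W r s' < \<top>" and ag: "agree (pick ;; insert_node) s s'"
    have I: "I r s'" using W by (auto simp: W_def split: if_splits)
    have var: "var s' vV = v" "var s' vDeg = d" "var s' vCount = T"
      using agree_var[OF ag] s wv by (simp_all add: insert_node_def)
    define i where "i = var s' vDone"
    define g where "g = (\<lambda>i. arr s' aTgt (J + i))"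
    have Wi: "W r s' = val i g" using I by (simp add: W_def i_def g_def)
    have iT: "i \<le> T" and r: "t \<le> r + 17 * i" using I by (auto simp: I_def i_def)
    have cond: "eval_exp w (Less (Var vDone) (Var vCount)) s' \<noteq> 0 \<longleftrightarrow> i < T"
      using w(1) var by (simp add: i_def)
    show "0 < r \<and>
         (if eval_exp w (Less (Var vDone) (Var vCount)) s' \<noteq> 0
          then mean (r - 1) (pick ;; insert_node) s' (\<lambda>r s''. if r = 0 then \<top> else W (r - 1) s'') \<le> W r s'
          else (if t \<le> r - 1 + 17 * T + 1 \<and> var s' vNode = J + T \<and> linked n s' lo \<and>
                  (\<forall>j<J. arr s' aWho j = arr s aWho j \<and> arr s' aTgt j = arr s aTgt j) \<and>
                  (\<forall>j. J \<le> j \<longrightarrow> j < J + T \<longrightarrow> arr s' aWho j = v)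
                then val T (\<lambda>i. arr s' aTgt (J + i)) else \<top>) \<le> W r s')"
    proof (cases "i < T")
      case False
      then have "i = T" using iT by simp
      then show ?thesis using I t r cond unfolding Wi I_def g_def by (auto simp: i_def)
    next
      case True
      then have r17: "17 < r" using r t by (simp add: not_le)
      have "mean (r - 1) (pick ;; insert_node) s' (\<lambda>r s''. if r = 0 then \<top> else W (r - 1) s'')
        = (\<integral>\<^sup>+k. mean (r - 3) insert_node (set_var vPos k s') (\<lambda>r s''. if r = 0 then \<top> else W (r - 1) s'')
            \<partial>measure_pmf (\<rho> i d))"
        using r17 by (simp add: mean_Seq pick var flip: i_def) (auto intro!: nn_integral_cong simp: numeral_3_eq_3)
      also have "\<dots> \<le> (\<integral>\<^sup>+k. val (Suc i) (g(i := adj v ! k)) \<partial>measure_pmf (\<rho> i d))"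
      proof (intro nn_integral_mono_AE, simp add: AE_measure_pmf_iff, intro ballI)
        fix k assume "k \<in> set_pmf (\<rho> i d)"
        then have k: "k < d" using supp[OF True] by auto
        let ?s = "set_var vPos k s'"
        have lk': "linked n ?s lo" using I by (simp add: I_def linked_set_var)
        have "sure (r - 3) insert_node ?s (\<lambda>r' s''. r - 3 \<le> r' + 13 \<and> var s'' vNode = Suc (J + i) \<and>
          var s'' vDone = Suc i \<and> linked n s'' lo \<and>
          arr s'' aWho = (arr s' aWho)(J + i := v) \<and>
          arr s'' aTgt = (arr s' aTgt)(J + i := adj v ! k))"
          using sure_insert_node[OF _ _ _ _ lk', of "r - 3"] I var k v lo w True r17
          by (simp add: I_def i_def)
        then show "mean (r - 3) insert_node ?s (\<lambda>r s''. if r = 0 then \<top> else W (r - 1) s'')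
            \<le> val (Suc i) (g(i := adj v ! k))"
        proof (rule mean_le_sure)
          fix r' s'' assume Q: "r - 3 \<le> r' + 13 \<and> var s'' vNode = Suc (J + i) \<and>
          var s'' vDone = Suc i \<and> linked n s'' lo \<and>
          arr s'' aWho = (arr s' aWho)(J + i := v) \<and>
          arr s'' aTgt = (arr s' aTgt)(J + i := adj v ! k)"
          have "I (r' - 1) s''" using Q I True r17 r unfolding I_def
            by (auto simp: i_def less_Suc_eq)
          moreover have "(\<lambda>i. arr s'' aTgt (J + i)) = g(i := adj v ! k)"
            using Q by (auto simp: g_def)
          moreover have "r' \<noteq> 0" using Q r17 by auto
          ultimately show "(if r' = 0 then \<top> else W (r' - 1) s'') \<le> val (Suc i) (g(i := adj v ! k))"
            using Q by (simp add: W_def)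
        qed
      qed
      also have "\<dots> \<le> val i g" using val True by blast
      finally show ?thesis using cond True r17 Wi by simp
    qed
  qed
  also have "W t s = val 0 (\<lambda>i. arr s aTgt (J + i))"
    using s lk by (auto simp: W_def I_def)
  finally show ?thesis .
qed

end

text \<open>A vertex whose samples would exceed the budget gets none, which bounds the time of every run.\<close>

definition load_vertex :: "exp \<Rightarrow> com" where
  "load_vertex quota =
     Assign vV (Read aList (Var vI)) ;;
     Degree vDeg (Var vV) ;;
     Assign vCount quota ;;
     If (Less (Var vBudget) (Add (Var vNode) (Var vCount))) (Assign vCount (Const 0)) Skip ;;
     Write aCnt (Var vV) (Var vCount) ;;
     Assign vDone (Const 0)"

definition build_vertex :: "exp \<Rightarrow> com \<Rightarrow> com" where
  "build_vertex quota pick = load_vertex quota ;; sample_vertex pick ;; incr vI"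

definition clear_heads :: com where
  "clear_heads = Assign vI (Const 0) ;;
     While (Less (Var vI) (Var vN)) (Write aHead (Var vI) (Const 0) ;; incr vI) ;;
     Assign vI (Const 0)"

definition build :: "exp \<Rightarrow> com \<Rightarrow> com" where
  "build quota pick = clear_heads ;; While (Less (Var vI) (Var vLen)) (build_vertex quota pick)"

text \<open>Vertices are sampled one after the other, so the nodes of one vertex are
  consecutive.\<close>

lemma hits_segment:
  assumes "var s vNode = J + T" "lo \<le> J" "\<And>j. lo \<le> j \<Longrightarrow> j < J \<Longrightarrow> arr s aWho j \<noteq> v"
    "\<And>j. J \<le> j \<Longrightarrow> j < J + T \<Longrightarrow> arr s aWho j = v" "arr s aTgt = g"
  shows "hits s lo v X = card {i. i < T \<and> g (J + i) \<in> X}"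
proof -
  have "{j. lo \<le> j \<and> j < var s vNode \<and> arr s aWho j = v \<and> arr s aTgt j \<in> X}
      = (\<lambda>i. J + i) ` {i. i < T \<and> g (J + i) \<in> X}" (is "?A = ?B")
  proof (intro equalityI subsetI)
    fix j assume j: "j \<in> ?A"
    then have "J \<le> j" using assms(3)[of j] by (cases "j < J") auto
    then show "j \<in> ?B" using j assms(1,5) by (intro image_eqI[of _ _ "j - J"]) auto
  qed (use assms in auto)
  then show ?thesis by (simp add: hits_def card_image)
qed

locale incident_ram = ram w n adj for w n :: nat and adj :: "nat \<Rightarrow> nat list" +
  fixes E :: "nat set set"
  assumes incident: "incident_lists n E adj" and w_pos: "0 < w" and n_word: "2 * n < 2 ^ w"
begin

sublocale graph "{..<n}" E
  using incident by unfold_locales (simp add: incident_lists_def)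

definition deg :: "nat \<Rightarrow> nat" where
  "deg v = length (adj v)"

lemma set_adj: "v < n \<Longrightarrow> set (adj v) = neighbors E v"
  using incident by (simp add: incident_lists_def)

lemma distinct_adj: "v < n \<Longrightarrow> distinct (adj v)"
  using incident by (simp add: incident_lists_def)

lemma deg_eq: "v < n \<Longrightarrow> deg v = card (neighbors E v)"
  using set_adj distinct_adj distinct_card by (metis deg_def)

lemma deg_less: "v < n \<Longrightarrow> deg v < n"
  using degree_less[of v] by (simp add: deg_eq)

lemma adj_less: "v < n \<Longrightarrow> k < deg v \<Longrightarrow> adj v ! k < n"
  using set_adj[of v] neighbors_subset[of v] nth_mem[of k "adj v"] by (auto simp: deg_def)

lemma card_adj: "v < n \<Longrightarrow> card {k. k < deg v \<and> adj v ! k \<in> X} = card (neighbors E v \<inter> X)"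
proof -
  assume v: "v < n"
  have nb: "neighbors E v = (!) (adj v) ` {..<deg v}"
    using set_adj[OF v] by (auto simp: deg_def set_conv_nth)
  have "neighbors E v \<inter> X = (!) (adj v) ` {k. k < deg v \<and> adj v ! k \<in> X}"
    unfolding nb by auto
  moreover have "inj_on ((!) (adj v)) {k. k < deg v \<and> adj v ! k \<in> X}"
    using inj_on_nth[OF distinct_adj[OF v]] by (simp add: deg_def)
  ultimately show ?thesis by (simp add: card_image)
qed

lemma one_mod [simp]: "Suc 0 mod 2 ^ w = Suc 0"
  using w_pos by (simp add: mod_less)

end

text \<open>Markov's inequality in abstract form: \<open>val v\<close> is a nonnegative
  supermartingale that starts at no more than \<open>p\<close> and ends at no less than 1 if the hit
  counts of \<open>v\<close> are not \<open>good\<close>; hence that happens with probability at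
  most \<open>p\<close>. \<open>tc d\<close> is the number of draws at degree \<open>d\<close>, and
  \<open>word\<close> excludes overflow in the comparison with the budget.\<close>

locale sampler = incident_ram w n adj E for w n :: nat and adj :: "nat \<Rightarrow> nat list" and E :: "nat set set" +
  fixes pick :: com and quota :: exp and \<rho> :: "nat \<Rightarrow> nat \<Rightarrow> nat pmf" and tc :: "nat \<Rightarrow> nat"
    and good :: "nat \<Rightarrow> (nat set \<Rightarrow> nat) \<Rightarrow> bool" and val :: "nat \<Rightarrow> nat \<Rightarrow> (nat \<Rightarrow> nat) \<Rightarrow> ennreal"
    and p :: ennreal and K S B :: nat
  assumes pick: "\<And>t s f. 0 < t \<Longrightarrow> mean t pick s f =
        (\<integral>\<^sup>+k. f (t - 1) (set_var vPos k s) \<partial>measure_pmf (\<rho> (var s vDone) (var s vDeg)))"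
    and pick_vars: "written_vars pick = {vPos}" and pick_arrs: "written_arrs pick = {}"
    and pick_range: "\<And>v i. v < n \<Longrightarrow> i < tc (deg v) \<Longrightarrow> set_pmf (\<rho> i (deg v)) \<subseteq> {..<deg v}"
    and quota: "\<And>s. var s vLevel = K \<Longrightarrow> var s vThr = S \<Longrightarrow> var s vDeg < n \<Longrightarrow>
        eval_exp w quota s = tc (var s vDeg)"
    and val_step: "\<And>v i g. v < n \<Longrightarrow> i < tc (deg v) \<Longrightarrow>
        (\<integral>\<^sup>+k. val v (Suc i) (g(i := adj v ! k)) \<partial>measure_pmf (\<rho> i (deg v))) \<le> val v i g"
    and val_start: "\<And>v g. v < n \<Longrightarrow> val v 0 g \<le> p"
    and val_end: "\<And>v g. v < n \<Longrightarrow> \<not> good v (\<lambda>X. card {i. i < tc (deg v) \<and> g i \<in> X}) \<Longrightarrow>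
        1 \<le> val v (tc (deg v)) g"
    and word: "\<And>v. v < n \<Longrightarrow> B + tc (deg v) < 2 ^ w"
begin

lemma sure_load_vertex:
  assumes "12 \<le> t" "arr s aList (var s vI) = v" "v < n" "var s vLevel = K" "var s vThr = S"
    "var s vBudget = B" "var s vNode \<le> B"
  shows "sure t (load_vertex quota) s (\<lambda>r s'. t \<le> r + 12 \<and> var s' vV = v \<and> var s' vDeg = deg v \<and>
    var s' vCount = (if B < var s vNode + tc (deg v) then 0 else tc (deg v)) \<and> var s' vDone = 0 \<and>
    arr s' aCnt = (arr s aCnt)(v := var s' vCount))"
proof -
  obtain t' where "t = t' + 12" using assms(1) by (metis add.commute le_Suc_ex)
  moreover have "B + tc (deg v) < 2 ^ w" using word assms by blast
  then have "(var s vNode + tc (deg v)) mod 2 ^ w = var s vNode + tc (deg v)"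
    using assms by (intro mod_less) linarith
  moreover have "eval_exp w quota (set_var vDeg (deg v) (set_var vV v s)) = tc (deg v)"
    using quota[of "set_var vDeg (deg v) (set_var vV v s)"] assms deg_less by simp
  moreover have "degree_query n adj v = deg v" using assms by (simp add: degree_query_def deg_def)
  ultimately show ?thesis using assms w_pos unfolding load_vertex_def by simp
qed

text \<open>The flag \<open>nc\<close> asserts that the budget suffices; only then are bad samples counted.\<close>

lemma mean_build_vertex:
  fixes nc :: bool
  assumes t: "17 * (B - var s vNode) + 16 \<le> t"
    and s: "arr s aList (var s vI) = v" "v < n" "var s vLevel = K" "var s vThr = S"
    "var s vBudget = B" "var s vNode \<le> B" "Suc (var s vI) < 2 ^ w"
    and lk: "linked n s lo" and lo: "lo \<le> var s vNode"
    and fresh: "\<And>j. lo \<le> j \<Longrightarrow> j < var s vNode \<Longrightarrow> arr s aWho j \<noteq> v"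
    and nc: "nc \<Longrightarrow> var s vNode + tc (deg v) \<le> B"
  shows "mean t (build_vertex quota pick) s (\<lambda>r s'.
      if t + 17 * var s vNode \<le> r + 16 + 17 * var s' vNode \<and> var s' vI = Suc (var s vI) \<and> linked n s' lo \<and>
        var s vNode \<le> var s' vNode \<and> var s' vNode \<le> B \<and>
        (\<forall>j<var s vNode. arr s' aWho j = arr s aWho j \<and> arr s' aTgt j = arr s aTgt j) \<and>
        (\<forall>j. var s vNode \<le> j \<longrightarrow> j < var s' vNode \<longrightarrow> arr s' aWho j = v) \<and>
        arr s' aCnt = (arr s aCnt)(v := var s' vNode - var s vNode) \<and>
        (nc \<longrightarrow> var s' vNode = var s vNode + tc (deg v))
      then of_bool (nc \<and> \<not> good v (hits s' lo v)) else \<top>) \<le> p"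
    (is "mean t _ s ?f \<le> p")
proof -
  define T where "T = (if B < var s vNode + tc (deg v) then 0 else tc (deg v))"
  define J where "J = var s vNode"
  have JT: "J + T \<le> B" using s by (simp add: T_def J_def)
  have JJ: "var s vNode = J" by (simp add: J_def)
  have t12: "12 \<le> t" using t by simp
  define Q1 where "Q1 r s' \<longleftrightarrow> t \<le> r + 12 \<and> var s' vV = v \<and> var s' vDeg = deg v \<and>
    var s' vCount = T \<and> var s' vDone = 0 \<and> arr s' aCnt = (arr s aCnt)(v := T) \<and>
    agree (load_vertex quota) s s'" for r s'
  have "sure t (load_vertex quota) s Q1"
    using sure_load_vertex[OF t12 s(1-6)]
    by (rule sure_mono) (auto simp: Q1_def T_def)
  then have "mean t (load_vertex quota) s (\<lambda>r s'. if r = 0 then \<top> else mean (r - 1) (sample_vertex pick ;; incr vI) s' ?f) \<le> p"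
  proof (rule mean_le_sure)
    fix r s1 assume Q1: "Q1 r s1"
    have ag: "agree (load_vertex quota) s s1" and tr: "t \<le> r + 12" using Q1 by (simp_all add: Q1_def)
    have a1: "arr s1 aWho = arr s aWho" "arr s1 aTgt = arr s aTgt" "arr s1 aHead = arr s aHead"
      "arr s1 aNext = arr s aNext"
      using agree_arr[OF ag] by (simp_all add: load_vertex_def)
    have v1: "var s1 vNode = J" "var s1 vI = var s vI"
      using agree_var[OF ag] by (simp_all add: load_vertex_def J_def)
    have lk1: "linked n s1 lo" using lk a1 v1 by (simp add: linked_def J_def)
    define Q2 where "Q2 r' s2 \<longleftrightarrow> r - 1 \<le> r' + 17 * T + 1 \<and> var s2 vNode = J + T \<and> linked n s2 lo \<and>
        (\<forall>j<J. arr s2 aWho j = arr s1 aWho j \<and> arr s2 aTgt j = arr s1 aTgt j) \<and>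
        (\<forall>j. J \<le> j \<longrightarrow> j < J + T \<longrightarrow> arr s2 aWho j = v)" for r' s2
    have "17 * T \<le> 17 * (B - J)" using JT by simp
    then have r: "17 * T + 4 \<le> r" using t Q1 by (simp add: Q1_def J_def)
    \<comment> \<open>If the budget cancelled the draws, \<open>nc\<close> is false and there is no
      failure to account for, so the potential 0 suffices.\<close>
    define val' where "val' = (if T = 0 \<and> tc (deg v) \<noteq> 0 then \<lambda>_ _. 0 else val v)"
    have T: "T = 0 \<and> tc (deg v) \<noteq> 0 \<or> T = tc (deg v)" by (auto simp: T_def)
    have "mean (r - 1) (sample_vertex pick) s1
        (\<lambda>r' s2. if Q2 r' s2 then val' T (\<lambda>i. arr s2 aTgt (J + i)) else \<top>) \<le> val' 0 (\<lambda>i. arr s1 aTgt (J + i))"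
      unfolding Q2_def
    proof (rule mean_sample_vertex[OF pick pick_vars pick_arrs, where d = "deg v" and val = val' and T = T and v = v])
      show "set_pmf (\<rho> i (deg v)) \<subseteq> {..<deg v}" if "i < T" for i
        using that pick_range[of v i] s T by auto
      show "(\<integral>\<^sup>+ k. val' (Suc i) (g(i := adj v ! k)) \<partial>measure_pmf (\<rho> i (deg v))) \<le> val' i g" if "i < T" for i g
        using that val_step[of v i g] s T by (auto simp: val'_def)
      show "J + T < 2 ^ w" using JT word[OF s(2)] by linarith
    qed (use s Q1 lk1 r v1 lo adj_less in \<open>auto simp: Q1_def deg_def J_def w_pos\<close>)
    also have "\<dots> \<le> p" using val_start s by (auto simp: val'_def)
    finally have m: "mean (r - 1) (sample_vertex pick) s1
        (\<lambda>r' s2. if Q2 r' s2 then val' T (\<lambda>i. arr s2 aTgt (J + i)) else \<top>) \<le> p" .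
    have "mean (r - 1) (sample_vertex pick ;; incr vI) s1 ?f \<le> mean (r - 1) (sample_vertex pick) s1
        (\<lambda>r' s2. if Q2 r' s2 then val' T (\<lambda>i. arr s2 aTgt (J + i)) else \<top>)"
      unfolding mean_Seq
    proof (rule mean_mono)
      fix r' s2 assume ag2: "agree (sample_vertex pick) s1 s2"
      show "(if r' = 0 then \<top> else mean (r' - 1) (incr vI) s2 ?f)
          \<le> (if Q2 r' s2 then val' T (\<lambda>i. arr s2 aTgt (J + i)) else \<top>)"
      proof (cases "Q2 r' s2")
        case True
        then have rQ: "r - 1 \<le> r' + 17 * T + 1" unfolding Q2_def by blast
        then have r': "2 \<le> r'" using r by linarith
        have vI2: "var s2 vI = var s vI"
          using agree_var[OF ag2] v1 pick_vars by (simp add: sample_vertex_def insert_node_def)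
        have aCnt2: "arr s2 aCnt = (arr s aCnt)(v := T)"
          using agree_arr[OF ag2] pick_arrs Q1 by (simp add: sample_vertex_def insert_node_def Q1_def)
        have hits: "hits (set_var vI x s2) lo v X = card {i. i < T \<and> arr s2 aTgt (J + i) \<in> X}" for X x
        proof (rule hits_segment)
          show "var (set_var vI x s2) vNode = J + T" using True by (simp add: Q2_def)
          show "arr (set_var vI x s2) aWho j = v" if "J \<le> j" "j < J + T" for j
            using True that by (simp add: Q2_def)
          show "arr (set_var vI x s2) aWho j \<noteq> v" if "lo \<le> j" "j < J" for j
            using True that fresh[of j] a1 by (simp add: Q2_def J_def)
          show "lo \<le> J" using lo by (simp add: J_def)
        qed simp
        have "of_bool (nc \<and> \<not> good v (hits (set_var vI x s2) lo v)) \<le> val' T (\<lambda>i. arr s2 aTgt (J + i))" for x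
        proof (cases "nc \<and> \<not> good v (hits (set_var vI x s2) lo v)")
          case True
          then have T': "T = tc (deg v)" using nc by (simp add: T_def)
          then have "hits (set_var vI x s2) lo v = (\<lambda>X. card {i. i < tc (deg v) \<and> arr s2 aTgt (J + i) \<in> X})"
            using hits by auto
          then show ?thesis
            using True T' val_end[OF s(2), of "\<lambda>i. arr s2 aTgt (J + i)"] by (auto simp: val'_def)
        next
          case False
          then have "of_bool (nc \<and> \<not> good v (hits (set_var vI x s2) lo v)) = (0 :: ennreal)" by (simp only: of_bool_def if_False)
          then show ?thesis by (metis zero_le)
        qed
        moreover have "T = tc (deg v)" if nc using nc that by (simp add: T_def)
        moreover have "t + 17 * J \<le> r' - 2 + 16 + 17 * (J + T)"
          using rQ r r' tr by (simp add: algebra_simps)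
        moreover have "mean (r' - 1) (incr vI) s2 ?f = ?f (r' - 2) (set_var vI (Suc (var s vI)) s2)"
        proof -
          have r1: "0 < r' - 1" using r' by simp
          have ev: "eval_exp w (Add (Var vI) (Const 1)) s2 = Suc (var s vI)" using s(7) vI2 w_pos by simp
          show ?thesis unfolding mean_Assign[OF r1] ev diff_diff_left one_add_one ..
        qed
        ultimately show ?thesis using True r' aCnt2 JT a1 JJ
          by (simp add: Q2_def linked_set_var del: of_bool_eq_0_iff)
      qed simp
    qed
    also note m
    finally show "(if r = 0 then \<top> else mean (r - 1) (sample_vertex pick ;; incr vI) s1 ?f) \<le> p" using r by simp
  qed
  then show ?thesis unfolding build_vertex_def mean_Seq[of _ "load_vertex quota"] .
qed

end

section \<open>Building the sample lists of all vertices\<close>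

context incident_ram
begin

lemma sure_clear_heads:
  assumes "5 * n + 7 \<le> t" "var s vN = n"
  shows "sure t clear_heads s (\<lambda>r s'. t \<le> r + 5 * n + 6 \<and> var s' vI = 0 \<and> (\<forall>u<n. arr s' aHead u = 0))"
proof -
  have "sure (t - 2) (While (Less (Var vI) (Var vN)) (Write aHead (Var vI) (Const 0) ;; incr vI))
      (set_var vI 0 s) (\<lambda>r s'. t \<le> r + 5 * n + 3 \<and> (\<forall>u<n. arr s' aHead u = 0))"
  proof (rule sure_While[where I = "\<lambda>r s'. var s' vI \<le> n \<and> t \<le> r + 5 * var s' vI + 2 \<and>
      (\<forall>u<var s' vI. arr s' aHead u = 0)"])
    fix r s' assume I: "var s' vI \<le> n \<and> t \<le> r + 5 * var s' vI + 2 \<and> (\<forall>u<var s' vI. arr s' aHead u = 0)"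
      and ag: "agree (Write aHead (Var vI) (Const 0) ;; incr vI) (set_var vI 0 s) s'"
    have N: "var s' vN = n" using agree_var[OF ag] assms by simp
    have r: "4 < r" using I assms(1) by linarith
    then obtain r' where r': "r = r' + 5" by (metis Suc_le_eq add.commute eval_nat_numeral(3) le_Suc_ex)
    show "0 < r \<and> (if eval_exp w (Less (Var vI) (Var vN)) s' \<noteq> 0
          then sure (r - 1) (Write aHead (Var vI) (Const 0) ;; incr vI) s'
              (\<lambda>r s''. 0 < r \<and> var s'' vI \<le> n \<and> t \<le> r - 1 + 5 * var s'' vI + 2 \<and> (\<forall>u<var s'' vI. arr s'' aHead u = 0))
          else t \<le> r - 1 + 5 * n + 3 \<and> (\<forall>u<n. arr s' aHead u = 0))"
    proof (cases "var s' vI < n")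
      case True
      then have "Suc (var s' vI) mod 2 ^ w = Suc (var s' vI)" using n_word by (intro mod_less) linarith
      then show ?thesis using I N True r' w_pos by (auto simp: less_Suc_eq)
    next
      case False
      then show ?thesis using I N r' by simp
    qed
  qed (use assms in simp)
  then have "sure (t - 2) (While (Less (Var vI) (Var vN)) (Write aHead (Var vI) (Const 0) ;; incr vI))
      (set_var vI 0 s) (\<lambda>r s'. 0 < r \<and> 0 < r - 1 \<and> t \<le> r - 1 - 1 + 5 * n + 6 \<and> (\<forall>u<n. arr s' aHead u = 0))"
    by (rule sure_conseq) (use assms in auto)
  then show ?thesis using assms unfolding clear_heads_def sure_Seq sure_Assign
    by (simp add: numeral_2_eq_2)
qed

end

context sampler
begin

lemma of_bool_le_add:
  "(a \<Longrightarrow> b \<or> c) \<Longrightarrow> of_bool a \<le> of_bool b + (of_bool c :: ennreal)"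
  by (cases a; cases b; cases c) auto

lemma hits_other:
  assumes "var s vNode \<le> var s' vNode"
    and "\<And>j. j < var s vNode \<Longrightarrow> arr s' aWho j = arr s aWho j \<and> arr s' aTgt j = arr s aTgt j"
    and "\<And>j. var s vNode \<le> j \<Longrightarrow> j < var s' vNode \<Longrightarrow> arr s' aWho j \<noteq> u"
  shows "hits s' lo u X = hits s lo u X"
proof -
  have "lo \<le> j \<and> j < var s' vNode \<and> arr s' aWho j = u \<and> arr s' aTgt j \<in> X \<longleftrightarrow>
      lo \<le> j \<and> j < var s vNode \<and> arr s aWho j = u \<and> arr s aTgt j \<in> X" for j
    using assms(1) assms(2)[of j] assms(3)[of j] by (cases "j < var s vNode") auto
  then show ?thesis by (simp add: hits_def)
qed

text \<open>A union bound over the listed vertices. The time is charged to the nodes created, 17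
  units each, so it holds whether or not the budget cancels draws; 23 units per vertex remain, 5 for
  clearing its head and 18 for its turn in the loop.\<close>

lemma mean_build:
  fixes nc :: bool
  assumes t: "23 * n + 17 * (B - lo) + 9 \<le> t"
    and s: "var s vN = n" "var s vLen = m" "m \<le> n" "var s vLevel = K" "var s vThr = S" "var s vBudget = B"
      "var s vNode = lo" "lo \<le> B" "1 \<le> lo" "arr s aList = f"
    and f: "inj_on f {..<m}" "\<And>i. i < m \<Longrightarrow> f i < n"
    and nc: "nc \<Longrightarrow> lo + (\<Sum>i<m. tc (deg (f i))) \<le> B"
  shows "mean t (build quota pick) s (\<lambda>r s'.
      if t + 17 * lo \<le> r + 23 * n + 9 + 17 * var s' vNode \<and> linked n s' lo \<and>
        lo \<le> var s' vNode \<and> var s' vNode \<le> B \<and>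
        (\<forall>j. lo \<le> j \<longrightarrow> j < var s' vNode \<longrightarrow> arr s' aWho j \<in> f ` {..<m}) \<and>
        (\<forall>i<m. arr s' aCnt (f i) = hits s' lo (f i) UNIV) \<and>
        (nc \<longrightarrow> var s' vNode = lo + (\<Sum>i<m. tc (deg (f i))))
      then of_bool (nc \<and> \<not> (\<forall>i<m. good (f i) (hits s' lo (f i)))) else \<top>) \<le> of_nat m * p"
    (is "mean t _ s ?f \<le> _")
proof -
  let ?body = "build_vertex quota pick"
  have tn: "5 * n + 7 \<le> t" using t by simp
  have "mean t clear_heads s (\<lambda>r s'. if r = 0 then \<top> else
      mean (r - 1) (While (Less (Var vI) (Var vLen)) ?body) s' ?f) \<le> of_nat m * p"
  proof (rule mean_le_sure)
    show "sure t clear_heads s (\<lambda>r s'. (t \<le> r + 5 * n + 6 \<and> var s' vI = 0 \<and> (\<forall>u<n. arr s' aHead u = 0)) \<and>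
        agree clear_heads s s')"
      using sure_clear_heads[OF tn s(1)] by (rule sure_mono) auto
    fix t1 s1 assume Q1: "(t \<le> t1 + 5 * n + 6 \<and> var s1 vI = 0 \<and> (\<forall>u<n. arr s1 aHead u = 0)) \<and>
        agree clear_heads s s1"
    then have ag1: "agree clear_heads s s1" by simp
    have s1: "var s1 vLen = m" "var s1 vLevel = K" "var s1 vThr = S" "var s1 vBudget = B"
      "var s1 vNode = lo" "arr s1 aList = f"
      using agree_var[OF ag1] agree_arr[OF ag1] s by (simp_all add: clear_heads_def)
    have t1: "18 * n + 17 * (B - lo) + 3 \<le> t1" using Q1 t by linarith
    define I where "I r s' \<longleftrightarrow> var s' vI \<le> m \<and> t1 + 17 * lo \<le> r + 1 + 18 * var s' vI + 17 * var s' vNode \<and>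
        linked n s' lo \<and> lo \<le> var s' vNode \<and> var s' vNode \<le> B \<and>
        (\<forall>j. lo \<le> j \<longrightarrow> j < var s' vNode \<longrightarrow> arr s' aWho j \<in> f ` {..<var s' vI}) \<and>
        (\<forall>i<var s' vI. arr s' aCnt (f i) = hits s' lo (f i) UNIV) \<and>
        (nc \<longrightarrow> var s' vNode = lo + (\<Sum>i<var s' vI. tc (deg (f i))))" for r s'
    define ok where "ok s' \<longleftrightarrow> (\<forall>i<var s' vI. good (f i) (hits s' lo (f i)))" for s'
    \<comment> \<open>Each vertex still to come may fail with probability \<open>p\<close>; a
      failure that has already happened costs 1.\<close>
    define V where "V r s' = (if I r s' then of_nat (m - var s' vI) * p + of_bool (nc \<and> \<not> ok s') else \<top>)" for r s'
    have "mean (t1 - 1) (While (Less (Var vI) (Var vLen)) ?body) s1 ?f \<le> V (t1 - 1) s1"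
    proof (rule mean_While)
      fix r s' assume V: "V r s' < \<top>" and ag: "agree ?body s1 s'"
      have I: "I r s'" using V by (auto simp: V_def split: if_splits)
      have s': "var s' vLen = m" "var s' vLevel = K" "var s' vThr = S" "var s' vBudget = B" "arr s' aList = f"
        using agree_var[OF ag] agree_arr[OF ag] s1 pick_vars pick_arrs
        by (simp_all add: build_vertex_def load_vertex_def sample_vertex_def insert_node_def)
      define i where "i = var s' vI"
      define J where "J = var s' vNode"
      have im: "i \<le> m" and loJ: "lo \<le> J" "J \<le> B" using I by (auto simp: I_def i_def J_def)
      have r: "t1 + 17 * lo \<le> r + 1 + 18 * i + 17 * J" using I by (simp add: I_def i_def J_def)
      show "0 < r \<and> (if eval_exp w (Less (Var vI) (Var vLen)) s' \<noteq> 0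
          then mean (r - 1) ?body s' (\<lambda>r s''. if r = 0 then \<top> else V (r - 1) s'') \<le> V r s'
          else ?f (r - 1) s' \<le> V r s')"
      proof (cases "i < m")
        case False
        then have i: "i = m" using im by simp
        have "0 < r" using r loJ t1 im s(3) by linarith
        moreover have "t + 17 * lo \<le> r - 1 + 23 * n + 9 + 17 * J"
          using r Q1 im s(3) \<open>0 < r\<close> by linarith
        ultimately show ?thesis using I i s' unfolding V_def I_def ok_def
          by (auto simp: i_def J_def)
      next
        case True
        define v where "v = f i"
        have vn: "v < n" using f(2) True by (simp add: v_def)
        have rb: "17 * (B - J) + 18 \<le> r - 1" "0 < r"
          using r t1 loJ True s(3) by linarith+
        have Jtc: "J + tc (deg v) \<le> B" if nc
        proof -
          have "J + tc (deg v) = lo + (\<Sum>i'<Suc i. tc (deg (f i')))"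
            using I that by (simp add: I_def i_def J_def v_def)
          also have "\<dots> \<le> lo + (\<Sum>i<m. tc (deg (f i)))"
            using True by (intro add_left_mono sum_mono2) auto
          finally show ?thesis using nc that by simp
        qed
        have fresh: "arr s' aWho j \<noteq> v" if j: "lo \<le> j" "j < J" for j
        proof
          assume "arr s' aWho j = v"
          then obtain i' where "i' < i" "f i' = f i" using I j by (auto simp: I_def i_def J_def v_def)
          then show False using f(1) True by (auto simp: inj_on_def)
        qed
        define Q where "Q r' s'' \<longleftrightarrow> r - 1 + 17 * J \<le> r' + 16 + 17 * var s'' vNode \<and> var s'' vI = Suc i \<and> linked n s'' lo \<and>
            J \<le> var s'' vNode \<and> var s'' vNode \<le> B \<and>
            (\<forall>j<J. arr s'' aWho j = arr s' aWho j \<and> arr s'' aTgt j = arr s' aTgt j) \<and>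
            (\<forall>j. J \<le> j \<longrightarrow> j < var s'' vNode \<longrightarrow> arr s'' aWho j = v) \<and>
            arr s'' aCnt = (arr s' aCnt)(v := var s'' vNode - J) \<and>
            (nc \<longrightarrow> var s'' vNode = J + tc (deg v))" for r' s''
        have m: "mean (r - 1) ?body s' (\<lambda>r' s''. if Q r' s'' then of_bool (nc \<and> \<not> good v (hits s'' lo v)) else \<top>) \<le> p"
          unfolding Q_def J_def i_def
        proof (rule mean_build_vertex)
          show "Suc (var s' vI) < 2 ^ w" using True s(3) n_word by (simp add: i_def)
        qed (use rb s' vn I loJ fresh Jtc in \<open>auto simp: v_def i_def J_def I_def\<close>)
        let ?k = "of_nat (m - Suc i) * p + of_bool (nc \<and> \<not> ok s')"
        have "mean (r - 1) ?body s' (\<lambda>r s''. if r = 0 then \<top> else V (r - 1) s'') \<le>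
           mean (r - 1) ?body s' (\<lambda>r' s''. ?k +
             (if Q r' s'' then of_bool (nc \<and> \<not> good v (hits s'' lo v)) else \<top>))"
        proof (rule mean_mono)
          fix r' s'' assume "r' \<le> r - 1"
          show "(if r' = 0 then \<top> else V (r' - 1) s'') \<le> ?k +
             (if Q r' s'' then of_bool (nc \<and> \<not> good v (hits s'' lo v)) else \<top>)"
          proof (cases "Q r' s''")
            case True
            note Q = True[unfolded Q_def]
            have rQ: "r + 17 * J \<le> r' + 17 + 17 * var s'' vNode" using conjunct1[OF Q] rb by linarith
            then have r': "2 \<le> r'" using conjunct1[OF Q] Q rb loJ by linarith
            \<comment> \<open>The nodes of earlier vertices are untouched, and by injectivity of
              \<open>f\<close> every new node belongs to a different vertex.\<close>
            have old: "hits s'' lo (f i') X = hits s' lo (f i') X" if "i' < i" for i' X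
            proof (rule hits_other)
              fix j assume "var s' vNode \<le> j" "j < var s'' vNode"
              moreover have "f i' \<noteq> v" using f(1) that \<open>i < m\<close> by (auto simp: inj_on_def v_def)
              ultimately show "arr s'' aWho j \<noteq> f i'" using Q by (auto simp: J_def)
            qed (use Q in \<open>auto simp: J_def\<close>)
            have new: "hits s'' lo v UNIV = var s'' vNode - J"
            proof -
              have "lo \<le> j \<and> j < var s'' vNode \<and> arr s'' aWho j = v \<longleftrightarrow> j \<in> {J..<var s'' vNode}" for j
                using Q fresh[of j] loJ by (cases "j < J") auto
              then have "{j. lo \<le> j \<and> j < var s'' vNode \<and> arr s'' aWho j = v} = {J..<var s'' vNode}" by blast
              then show ?thesis by (simp add: hits_def)
            qed
            have "I (r' - 1) s''"
              unfolding I_def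
            proof (intro conjI allI impI)
              show "var s'' vI \<le> m" using Q \<open>i < m\<close> by simp
              show "t1 + 17 * lo \<le> r' - 1 + 1 + 18 * var s'' vI + 17 * var s'' vNode"
                using Q rQ r r' by simp
              show "linked n s'' lo" "lo \<le> var s'' vNode" "var s'' vNode \<le> B" using Q loJ by auto
              show "arr s'' aWho j \<in> f ` {..<var s'' vI}" if "lo \<le> j" "j < var s'' vNode" for j
              proof (cases "j < J")
                case True
                then have "arr s' aWho j \<in> f ` {..<i}" using I that by (simp add: I_def i_def J_def)
                then show ?thesis using Q True by (auto simp: lessThan_Suc)
              next
                case False
                then show ?thesis using Q that by (auto simp: v_def)
              qed
              show "arr s'' aCnt (f i') = hits s'' lo (f i') UNIV" if "i' < var s'' vI" for i'
              proof (cases "i' = i")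
                case True
                then show ?thesis using Q new by (simp add: v_def)
              next
                case False
                then have "i' < i" using that Q by simp
                moreover from this have "f i' \<noteq> v" using f(1) \<open>i < m\<close> by (auto simp: inj_on_def v_def)
                ultimately show ?thesis using Q old I by (simp add: I_def i_def)
              qed
              show "var s'' vNode = lo + (\<Sum>i'<var s'' vI. tc (deg (f i')))" if nc
                using Q I that by (simp add: I_def i_def J_def v_def)
            qed
            moreover have "nc \<and> \<not> ok s' \<or> nc \<and> \<not> good v (hits s'' lo v)" if bad: "nc \<and> \<not> ok s''"
            proof -
              obtain i' where i': "i' < Suc i" "\<not> good (f i') (hits s'' lo (f i'))"
                using bad Q by (auto simp: ok_def)
              have "hits s'' lo (f i') = hits s' lo (f i')" if "i' < i" using old[OF that] by blast
              then show ?thesis using i' bad by (cases "i' = i") (auto simp: ok_def v_def i_def less_Suc_eq)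
            qed
            then have "of_bool (nc \<and> \<not> ok s'') \<le>
                of_bool (nc \<and> \<not> ok s') + (of_bool (nc \<and> \<not> good v (hits s'' lo v)) :: ennreal)"
              by (rule of_bool_le_add)
            ultimately have "V (r' - 1) s'' \<le> ?k + of_bool (nc \<and> \<not> good v (hits s'' lo v))"
              using Q by (simp add: V_def add.assoc add_left_mono)
            then show ?thesis using r' True by simp
          next
            case False
            then show ?thesis by simp
          qed
        qed
        also have "\<dots> \<le> ?k + p" by (rule order_trans[OF mean_add_const add_left_mono[OF m]])
        also have "\<dots> = V r s'"
        proof -
          have "m - i = Suc (m - Suc i)" using True by simp
          then show ?thesis using I by (simp add: V_def i_def[symmetric] algebra_simps distrib_right)
        qed
        finally show ?thesis using True rb s' w_pos by (simp add: i_def)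
      qed
    qed
    also have "V (t1 - 1) s1 \<le> of_nat m * p"
    proof -
      have "linked n s1 lo" using Q1 s1 s(9) by (auto simp: linked_def is_latest_def)
      then show ?thesis using Q1 s1 t1 s(8) by (simp add: V_def I_def ok_def)
    qed
    finally show "(if t1 = 0 then \<top> else mean (t1 - 1) (While (Less (Var vI) (Var vLen)) ?body) s1 ?f) \<le> of_nat m * p"
      using t1 by simp
  qed
  then show ?thesis unfolding build_def mean_Seq[of _ clear_heads] .
qed

end

section \<open>Peeling\<close>

text \<open>Every decrement pushes the vertex without a test, so the stack may hold duplicates and
  dead vertices; these are discarded when popped. Each sample thus causes at most one push and can
  pay for it.\<close>

definition visit_node :: com where
  "visit_node =
     Assign vX (Read aWho (Var vCur)) ;;
     Write aCnt (Var vX) (Sub (Read aCnt (Var vX)) (Const 1)) ;;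
     Write aStack (Var vTop) (Var vX) ;;
     incr vTop ;;
     Assign vCur (Read aNext (Var vCur))"

definition kill_vertex :: com where
  "kill_vertex =
     Write aDead (Var vV) (Const 1) ;;
     Assign vCur (Read aHead (Var vV)) ;;
     While (Var vCur) visit_node"

definition pop_vertex :: com where
  "pop_vertex =
     Assign vTop (Sub (Var vTop) (Const 1)) ;;
     Assign vV (Read aStack (Var vTop)) ;;
     If (Equal (Read aDead (Var vV)) (Const 0))
       (If (Less (Read aCnt (Var vV)) (Var vThr)) kill_vertex Skip) Skip"

definition peel :: com where
  "peel =
     Assign vI (Const 0) ;;
     While (Less (Var vI) (Var vLen)) (Write aStack (Var vI) (Read aList (Var vI)) ;; incr vI) ;;
     Assign vTop (Var vLen) ;;
     While (Var vTop) pop_vertex"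

text \<open>Samples are selected by their targets alone, also when the vertex that drew them is
  dead: these are the samples that a later removal may still visit.\<close>

definition live :: "store \<Rightarrow> nat \<Rightarrow> nat set" where
  "live s lo = {j. lo \<le> j \<and> j < var s vNode \<and> arr s aDead (arr s aTgt j) = 0}"

lemma finite_live [simp]: "finite (live s lo)"
  by (rule finite_subset[of _ "{..<var s vNode}"]) (auto simp: live_def)

text \<open>The second part is what makes an empty stack mean that the peeling is complete.\<close>

definition stack_ok :: "store \<Rightarrow> nat set \<Rightarrow> bool" where
  "stack_ok s U \<longleftrightarrow> (\<forall>i<var s vTop. arr s aStack i \<in> U) \<and>
     (\<forall>x\<in>U. arr s aDead x = 0 \<longrightarrow> arr s aCnt x < var s vThr \<longrightarrow> (\<exists>i<var s vTop. arr s aStack i = x))"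

context incident_ram
begin

text \<open>Links lead to older nodes, so \<open>M q\<close> consists of the live samples and those
  with target \<open>v\<close> that are still to be traversed from \<open>q\<close> on. A sample
  carries 24 units: 11 for its visit and 13 for popping the entry that the visit pushes.\<close>

lemma sure_visit_nodes:
  fixes M :: "nat \<Rightarrow> nat set"
  assumes v: "arr s aDead v = 1" and cur: "is_latest (arr s aTgt) lo (var s vNode) v (var s vCur)"
    and lk: "linked n s lo" and lo: "1 \<le> lo"
    and who: "\<And>j. lo \<le> j \<Longrightarrow> j < var s vNode \<Longrightarrow> arr s aWho j \<in> U"
  defines "M \<equiv> \<lambda>q. live s lo \<union> {j. lo \<le> j \<and> j < var s vNode \<and> arr s aTgt j = v \<and> j \<le> q}"
  assumes cnt: "\<And>x. x \<in> U \<Longrightarrow> arr s aCnt x = card {j \<in> M (var s vCur). arr s aWho j = x}"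
    and stk: "stack_ok s U"
    and w: "var s vTop + card (M (var s vCur)) < 2 ^ w"
    and t: "11 * card (M (var s vCur)) + 1 \<le> t"
  shows "sure t (While (Var vCur) visit_node) s (\<lambda>r s'.
    t + 13 * var s' vTop + 24 * card (live s lo) \<le> r + 1 + 13 * var s vTop + 24 * card (M (var s vCur)) \<and>
    var s' vTop + card (live s lo) \<le> var s vTop + card (M (var s vCur)) \<and>
    (\<forall>x\<in>U. arr s' aCnt x = card {j \<in> live s lo. arr s aWho j = x}) \<and> stack_ok s' U)"
proof -
  have finM: "finite (M q)" for q
    unfolding M_def by (auto intro: finite_subset[of _ "{..<var s vNode}"])
  define I where "I r s' \<longleftrightarrow> (let q = var s' vCur in
    (q = 0 \<or> lo \<le> q \<and> q < var s vNode \<and> arr s aTgt q = v) \<and>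
    t + 13 * var s' vTop + 24 * card (M q) \<le> r + 13 * var s vTop + 24 * card (M (var s vCur)) \<and>
    var s' vTop + card (M q) \<le> var s vTop + card (M (var s vCur)) \<and>
    var s' vTop + card (M q) \<ge> var s vTop + card (M (var s vCur)) \<and>
    (\<forall>x\<in>U. arr s' aCnt x = card {j \<in> M q. arr s aWho j = x}) \<and> stack_ok s' U)" for r s'
  show ?thesis
  proof (rule sure_While[where I = I])
    show "I t s" using cur cnt stk by (auto simp: I_def is_latest_def Let_def)
    fix r s' assume I: "I r s'" and ag: "agree visit_node s s'"
    have s': "arr s' aWho = arr s aWho" "arr s' aTgt = arr s aTgt" "arr s' aNext = arr s aNext" "arr s' aDead = arr s aDead"
      "var s' vNode = var s vNode" "var s' vThr = var s vThr"
      using agree_var[OF ag] agree_arr[OF ag] by (simp_all add: visit_node_def)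
    define q where "q = var s' vCur"
    have q: "q = 0 \<or> lo \<le> q \<and> q < var s vNode \<and> arr s aTgt q = v"
      and pot: "t + 13 * var s' vTop + 24 * card (M q) \<le> r + 13 * var s vTop + 24 * card (M (var s vCur))"
      and top: "var s' vTop + card (M q) = var s vTop + card (M (var s vCur))"
      and cnt': "\<And>x. x \<in> U \<Longrightarrow> arr s' aCnt x = card {j \<in> M q. arr s aWho j = x}"
      and stk': "stack_ok s' U"
      using I by (auto simp: I_def q_def Let_def)
    have r: "11 * card (M q) + 1 \<le> r"
      using pot top t by linarith
    show "0 < r \<and> (if eval_exp w (Var vCur) s' \<noteq> 0
        then sure (r - 1) visit_node s' (\<lambda>r s''. 0 < r \<and> I (r - 1) s'')
        else t + 13 * var s' vTop + 24 * card (live s lo) \<le> r - 1 + 1 + 13 * var s vTop + 24 * card (M (var s vCur)) \<and>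
            var s' vTop + card (live s lo) \<le> var s vTop + card (M (var s vCur)) \<and>
            (\<forall>x\<in>U. arr s' aCnt x = card {j \<in> live s lo. arr s aWho j = x}) \<and> stack_ok s' U)"
    proof (cases "q = 0")
      case True
      then have "M q = live s lo" using lo by (auto simp: M_def)
      then show ?thesis using True r pot top cnt' stk' by (simp add: q_def[symmetric])
    next
      case False
      then have q1: "lo \<le> q" "q < var s vNode" "arr s aTgt q = v" using q by auto
      define q' where "q' = arr s aNext q"
      define x where "x = arr s aWho q"
      have x: "x \<in> U" using who q1 by (simp add: x_def)
      have lat: "is_latest (arr s aTgt) lo q v q'"
        using lk q1 unfolding linked_def q'_def by auto
      have qlive: "q \<notin> live s lo" using v q1 by (simp add: live_def)
      have qM: "q \<in> M q" using q1 by (simp add: M_def)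
      \<comment> \<open>\<open>q'\<close> is the latest node before \<open>q\<close> with target
        \<open>v\<close>, or 0 if there is none; moving on therefore removes exactly
        \<open>q\<close>.\<close>
      have Mq': "M q' = M q - {q}"
      proof -
        have "j \<le> q' \<longleftrightarrow> j \<le> q \<and> j \<noteq> q" if "lo \<le> j" "arr s aTgt j = v" for j
          using lat that q1 lo unfolding is_latest_def by (cases "j < q") auto
        then have "{j. lo \<le> j \<and> j < var s vNode \<and> arr s aTgt j = v \<and> j \<le> q'} =
            {j. lo \<le> j \<and> j < var s vNode \<and> arr s aTgt j = v \<and> j \<le> q} - {q}"
          by auto
        then show ?thesis using qlive by (auto simp: M_def)
      qed
      have cM: "card (M q) = Suc (card (M q'))"
        using card_Suc_Diff1[OF finM qM] Mq' by simp
      have q'ok: "q' = 0 \<or> lo \<le> q' \<and> q' < var s vNode \<and> arr s aTgt q' = v"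
        using lat q1 by (auto simp: is_latest_def)
      have cx: "card {j \<in> M q. arr s aWho j = y} - (if y = x then 1 else 0) = card {j \<in> M q'. arr s aWho j = y}" for y
      proof -
        have "{j \<in> M q'. arr s aWho j = y} = {j \<in> M q. arr s aWho j = y} - (if y = x then {q} else {})"
          by (auto simp: Mq' x_def)
        then show ?thesis using qM finM by (simp add: x_def)
      qed
      have "12 \<le> r" using r cM by simp
      then obtain r' where r': "r = r' + 12" by (metis add.commute le_Suc_ex)
      let ?s = "set_var vCur q' (set_var vTop (Suc (var s' vTop)) (set_arr aStack (var s' vTop) x
          (set_arr aCnt x (arr s' aCnt x - 1) (set_var vX x s'))))"
      have "Suc (var s' vTop) < 2 ^ w" using top w cM by linarith
      then have "sure (r - 1) visit_node s' (\<lambda>r s''. 0 < r \<and> I (r - 1) s'') = I (r' + 1) ?s"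
        using r' w_pos by (simp add: visit_node_def s' q_def[symmetric] x_def q'_def)
      moreover have "I (r' + 1) ?s"
      proof -
        have "stack_ok ?s U"
        proof -
          have "arr ?s aStack i \<in> U" if "i < var ?s vTop" for i
            using that stk' x by (cases "i = var s' vTop") (auto simp: stack_ok_def)
          moreover have "\<exists>i<var ?s vTop. arr ?s aStack i = y"
            if y: "y \<in> U" "arr ?s aDead y = 0" "arr ?s aCnt y < var ?s vThr" for y
          proof (cases "y = x")
            case True
            then show ?thesis by (intro exI[of _ "var s' vTop"]) simp
          next
            case False
            then have "arr s' aDead y = 0" "arr s' aCnt y < var s' vThr" using y by simp_all
            then obtain i where "i < var s' vTop" "arr s' aStack i = y"
              using stk' y(1) unfolding stack_ok_def by blast
            then show ?thesis by (intro exI[of _ i]) simp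
          qed
          ultimately show ?thesis by (simp add: stack_ok_def)
        qed
        moreover have "arr ?s aCnt y = card {j \<in> M q'. arr s aWho j = y}" if "y \<in> U" for y
          using cx[of y] cnt'[OF that] x cnt'[OF x] by (auto split: if_splits)
        ultimately show ?thesis
          using q'ok pot top cM r' by (simp add: I_def Let_def)
      qed
      ultimately show ?thesis using False r by (simp add: q_def[symmetric])
    qed
  qed
qed

text \<open>The outcome does not depend on the order of removals: the survivors meet the threshold
  among themselves, and by the last clause they contain every initially alive set \<open>Y\<close>
  that does so. Only vertices of \<open>U\<close> can be removed; those assigned at previous levels
  stay alive and keep counting as targets. A pop costs at most 13 units besides its visits.\<close>

lemma sure_pop_vertices:
  assumes lk: "linked n s lo" and lo: "1 \<le> lo"
    and who: "\<And>j. lo \<le> j \<Longrightarrow> j < var s vNode \<Longrightarrow> arr s aWho j \<in> U" and U: "U \<subseteq> {..<n}"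
    and cnt: "\<And>x. x \<in> U \<Longrightarrow> arr s aCnt x = card {j \<in> live s lo. arr s aWho j = x}"
    and stk: "stack_ok s U"
    and w: "var s vTop + card (live s lo) < 2 ^ w"
    and t: "13 * var s vTop + 24 * card (live s lo) + 1 \<le> t"
  shows "sure t (While (Var vTop) pop_vertex) s (\<lambda>r s'.
    t + 24 * card (live s' lo) \<le> r + 1 + 13 * var s vTop + 24 * card (live s lo) \<and>
    (\<forall>x\<in>U. arr s' aDead x = 0 \<longrightarrow> var s vThr \<le> card {j \<in> live s' lo. arr s aWho j = x}) \<and>
    (\<forall>x. arr s' aDead x = arr s aDead x \<or> x \<in> U \<and> arr s aDead x = 0 \<and> arr s' aDead x = 1) \<and>
    (\<forall>x\<in>U. arr s' aCnt x = card {j \<in> live s' lo. arr s aWho j = x}) \<and>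
    (\<forall>Y. (\<forall>x\<in>Y. arr s aDead x = 0) \<longrightarrow> (\<forall>x\<in>Y \<inter> U. var s vThr \<le> hits s lo x Y) \<longrightarrow>
      (\<forall>x\<in>Y. arr s' aDead x = 0)))"
proof -
  define I where "I r s' \<longleftrightarrow>
    t + 13 * var s' vTop + 24 * card (live s' lo) \<le> r + 13 * var s vTop + 24 * card (live s lo) \<and>
    var s' vTop + card (live s' lo) \<le> var s vTop + card (live s lo) \<and>
    stack_ok s' U \<and>
    (\<forall>x. arr s' aDead x = arr s aDead x \<or> x \<in> U \<and> arr s aDead x = 0 \<and> arr s' aDead x = 1) \<and>
    (\<forall>x\<in>U. arr s' aCnt x = card {j \<in> live s' lo. arr s aWho j = x}) \<and>
    (\<forall>Y. (\<forall>x\<in>Y. arr s aDead x = 0) \<longrightarrow> (\<forall>x\<in>Y \<inter> U. var s vThr \<le> hits s lo x Y) \<longrightarrow>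
      (\<forall>x\<in>Y. arr s' aDead x = 0))" for r s'
  show ?thesis
  proof (rule sure_While[where I = I])
    show "I t s" using stk cnt by (simp add: I_def)
    fix r s' assume I: "I r s'" and ag: "agree pop_vertex s s'"
    have s': "arr s' aWho = arr s aWho" "arr s' aTgt = arr s aTgt" "arr s' aNext = arr s aNext" "arr s' aHead = arr s aHead"
      "var s' vNode = var s vNode" "var s' vThr = var s vThr"
      using agree_var[OF ag] agree_arr[OF ag] by (simp_all add: pop_vertex_def kill_vertex_def visit_node_def)
    have pot: "t + 13 * var s' vTop + 24 * card (live s' lo) \<le> r + 13 * var s vTop + 24 * card (live s lo)"
      and top: "var s' vTop + card (live s' lo) \<le> var s vTop + card (live s lo)"
      and stk': "stack_ok s' U"
      and dead: "\<And>x. arr s' aDead x = arr s aDead x \<or> x \<in> U \<and> arr s aDead x = 0 \<and> arr s' aDead x = 1"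
      and cnt': "\<And>x. x \<in> U \<Longrightarrow> arr s' aCnt x = card {j \<in> live s' lo. arr s aWho j = x}"
      and surv: "\<And>Y x. (\<And>x. x \<in> Y \<Longrightarrow> arr s aDead x = 0) \<Longrightarrow>
          (\<And>x. x \<in> Y \<inter> U \<Longrightarrow> var s vThr \<le> hits s lo x Y) \<Longrightarrow> x \<in> Y \<Longrightarrow> arr s' aDead x = 0"
      using I unfolding I_def by blast+
    have lk': "linked n s' lo" using lk by (simp add: linked_def s')
    have r: "13 * var s' vTop + 24 * card (live s' lo) + 1 \<le> r" using pot t by linarith
    show "0 < r \<and> (if eval_exp w (Var vTop) s' \<noteq> 0
        then sure (r - 1) pop_vertex s' (\<lambda>r s''. 0 < r \<and> I (r - 1) s'')
        else t + 24 * card (live s' lo) \<le> r - 1 + 1 + 13 * var s vTop + 24 * card (live s lo) \<and>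
          (\<forall>x\<in>U. arr s' aDead x = 0 \<longrightarrow> var s vThr \<le> card {j \<in> live s' lo. arr s aWho j = x}) \<and>
          (\<forall>x. arr s' aDead x = arr s aDead x \<or> x \<in> U \<and> arr s aDead x = 0 \<and> arr s' aDead x = 1) \<and>
          (\<forall>x\<in>U. arr s' aCnt x = card {j \<in> live s' lo. arr s aWho j = x}) \<and>
          (\<forall>Y. (\<forall>x\<in>Y. arr s aDead x = 0) \<longrightarrow> (\<forall>x\<in>Y \<inter> U. var s vThr \<le> hits s lo x Y) \<longrightarrow>
            (\<forall>x\<in>Y. arr s' aDead x = 0)))"
    proof (cases "var s' vTop = 0")
      case True
      have "\<forall>x\<in>U. arr s' aDead x = 0 \<longrightarrow> var s vThr \<le> card {j \<in> live s' lo. arr s aWho j = x}"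
      proof (intro ballI impI)
        fix x assume "x \<in> U" "arr s' aDead x = 0"
        then have "\<not> arr s' aCnt x < var s' vThr" using stk' True by (auto simp: stack_ok_def)
        then show "var s vThr \<le> card {j \<in> live s' lo. arr s aWho j = x}"
          using cnt'[OF \<open>x \<in> U\<close>] s' by simp
      qed
      moreover have "0 < r" using r by simp
      ultimately show ?thesis using True pot I unfolding I_def by simp
    next
      case False
      define k where "k = var s' vTop - 1"
      define v where "v = arr s' aStack k"
      have k: "var s' vTop = Suc k" using False by (simp add: k_def)
      have vU: "v \<in> U" using stk' k by (simp add: stack_ok_def v_def)
      then have vn: "v < n" using U by auto
      have "14 \<le> r" using r k by simp
      then obtain r' where r': "r = r' + 14" by (metis add.commute le_Suc_ex)
      let ?s = "set_var vV v (set_var vTop k s')"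
      have live_eq: "live ?s lo = live s' lo" by (simp add: live_def)
      show ?thesis
      proof (cases "arr s' aDead v = 0 \<and> arr s' aCnt v < var s vThr")
        case skip: False
        \<comment> \<open>Dropping the top entry is safe: \<open>v\<close> is dead or not below the
          threshold, so it need not be on the stack.\<close>
        have "stack_ok ?s U"
        proof -
          have "\<exists>i<k. arr s' aStack i = x"
            if x: "x \<in> U" "arr s' aDead x = 0" "arr s' aCnt x < var s' vThr" for x
          proof -
            obtain i where i: "i < Suc k" "arr s' aStack i = x"
              using stk' x k unfolding stack_ok_def by auto
            have "x \<noteq> v" using skip x s' by auto
            then have "i \<noteq> k" using i by (auto simp: v_def)
            then show ?thesis using i by (intro exI[of _ i]) simp
          qed
          then show ?thesis using stk' k by (simp add: stack_ok_def)
        qed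
        then have "I (6 + r') ?s" "I (7 + r') ?s"
          using I r' k unfolding I_def live_eq by simp_all
        then show ?thesis
          using skip r' k w_pos by (auto simp: pop_vertex_def v_def[symmetric] s')
      next
        case kill: True
        define s2 where "s2 = set_var vCur (arr s aHead v) (set_arr aDead v (Suc 0) ?s)"
        have s2: "arr s2 aWho = arr s aWho" "arr s2 aTgt = arr s aTgt" "arr s2 aNext = arr s aNext"
          "arr s2 aHead = arr s aHead" "arr s2 aCnt = arr s' aCnt" "arr s2 aDead = (arr s' aDead)(v := 1)"
          "arr s2 aStack = arr s' aStack" "var s2 vTop = k" "var s2 vNode = var s vNode"
          "var s2 vThr = var s vThr" "var s2 vCur = arr s aHead v"
          by (simp_all add: s2_def s')
        define M where "M q = live s2 lo \<union> {j. lo \<le> j \<and> j < var s2 vNode \<and> arr s2 aTgt j = v \<and> j \<le> q}" for q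
        have lat: "is_latest (arr s aTgt) lo (var s vNode) v (arr s aHead v)"
          using lk vn by (simp add: linked_def)
        have Mq: "M (arr s aHead v) = live s' lo"
          unfolding M_def using lat kill s' s2 by (auto simp: live_def is_latest_def)
        have lsub: "live s2 lo \<subseteq> live s' lo" using Mq unfolding M_def by blast
        have stk2: "stack_ok s2 U"
        proof -
          have "\<exists>i<k. arr s' aStack i = x"
            if x: "x \<in> U" "arr s' aDead x = 0" "arr s' aCnt x < var s' vThr" "x \<noteq> v" for x
          proof -
            obtain i where i: "i < Suc k" "arr s' aStack i = x"
              using stk' x k unfolding stack_ok_def by auto
            then have "i \<noteq> k" using x by (auto simp: v_def)
            then show ?thesis using i by (intro exI[of _ i]) simp
          qed
          then show ?thesis using stk' k s2 s' by (simp add: stack_ok_def)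
        qed
        have len: "k + card (live s' lo) < 2 ^ w" using top w k by linarith
        have fuel: "11 * card (live s' lo) + 1 \<le> r' + 2" using r r' k by linarith
        have visit: "sure (3 + r') (While (Var vCur) visit_node) s2 (\<lambda>r'' s''.
            3 + r' + 13 * var s'' vTop + 24 * card (live s2 lo) \<le> r'' + 1 + 13 * k + 24 * card (live s' lo) \<and>
            var s'' vTop + card (live s2 lo) \<le> k + card (live s' lo) \<and>
            (\<forall>x\<in>U. arr s'' aCnt x = card {j \<in> live s2 lo. arr s aWho j = x}) \<and> stack_ok s'' U)"
        proof -
          note V = sure_visit_nodes[where s = s2 and v = v and lo = lo and U = U and t = "3 + r'", folded M_def]
          show ?thesis
            using V lat lk who cnt' stk2 len fuel Mq lo by (simp add: s2 linked_def)
        qed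
        have "sure (3 + r') (While (Var vCur) visit_node) s2 (\<lambda>r s''. 0 < r \<and> I (r - 1) s'')"
          using visit
        proof (rule sure_mono)
          fix r'' s'' assume ag2: "agree (While (Var vCur) visit_node) s2 s''"
            and Q: "3 + r' + 13 * var s'' vTop + 24 * card (live s2 lo) \<le> r'' + 1 + 13 * k + 24 * card (live s' lo) \<and>
            var s'' vTop + card (live s2 lo) \<le> k + card (live s' lo) \<and>
            (\<forall>x\<in>U. arr s'' aCnt x = card {j \<in> live s2 lo. arr s aWho j = x}) \<and> stack_ok s'' U"
          have s'': "arr s'' aDead = (arr s' aDead)(v := 1)" "arr s'' aTgt = arr s' aTgt" "var s'' vNode = var s' vNode"
            using agree_var[OF ag2] agree_arr[OF ag2] by (simp_all add: visit_node_def s2 s')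
          have live2: "live s'' lo = live s2 lo" by (simp add: live_def s'' s2 s')
          have "card (live s2 lo) \<le> card (live s' lo)" using lsub by (intro card_mono) auto
          then have "0 < r''" using Q fuel r r' k by linarith
          moreover have "I (r'' - 1) s''"
            unfolding I_def live2
          proof (intro conjI allI impI ballI)
            show "t + 13 * var s'' vTop + 24 * card (live s2 lo) \<le> r'' - 1 + 13 * var s vTop + 24 * card (live s lo)"
              using Q pot r' k \<open>0 < r''\<close> by linarith
            show "var s'' vTop + card (live s2 lo) \<le> var s vTop + card (live s lo)"
              using Q top k by linarith
            show "arr s'' aDead x = arr s aDead x \<or> x \<in> U \<and> arr s aDead x = 0 \<and> arr s'' aDead x = 1" for x
              using dead[of x] dead[of v] kill vU by (auto simp: s'')
            fix Y x assume Y: "\<forall>x\<in>Y. arr s aDead x = 0" "\<forall>x\<in>Y \<inter> U. var s vThr \<le> hits s lo x Y" and x: "x \<in> Y"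
            have alive: "arr s' aDead y = 0" if "y \<in> Y" for y using surv[of Y y] Y that by blast
            \<comment> \<open>So far all of \<open>Y\<close> is alive, hence the counter of a member
              is at least its number of hits in \<open>Y\<close>. No member can be the first to fall
              below the threshold.\<close>
            have "v \<notin> Y"
            proof
              assume "v \<in> Y"
              then have "var s vThr \<le> hits s lo v Y" using Y vU by blast
              also have "\<dots> \<le> card {j \<in> live s' lo. arr s aWho j = v}"
                unfolding hits_def using alive by (intro card_mono) (auto simp: live_def s')
              also have "\<dots> = arr s' aCnt v" using cnt' vU by simp
              finally show False using kill by simp
            qed
            then show "arr s'' aDead x = 0" using alive[OF x] x by (auto simp: s'')
          qed (use Q in auto)
          ultimately show "0 < r'' \<and> I (r'' - 1) s''" by blast
        qed
        then show ?thesis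
          using kill r' k w_pos by (simp add: pop_vertex_def kill_vertex_def v_def[symmetric] s' s2_def[symmetric])
      qed
    qed
  qed
qed

end

text \<open>\<open>keep\<close> is the value of \<open>aDead\<close> that sends a vertex to the next
  round. The exact algorithm continues with the survivors (0); the sampling algorithm continues with
  the peeled vertices (1), which are revived, while its survivors keep the estimate just
  written.\<close>

definition scan_vertex :: "nat \<Rightarrow> nat \<Rightarrow> com" where
  "scan_vertex keep den =
     Assign vV (Read aList (Var vI)) ;;
     If (Equal (Read aDead (Var vV)) (Const 0))
       (Write aNum (Var vV) (Var vLevel) ;; Write aDen (Var vV) (Const den)) Skip ;;
     If (Equal (Read aDead (Var vV)) (Const keep))
       (Write aDead (Var vV) (Const 0) ;; Write aList (Var vNew) (Var vV) ;; incr vNew) Skip ;;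
     incr vI"

definition scan :: "nat \<Rightarrow> nat \<Rightarrow> com" where
  "scan keep den =
     Assign vI (Const 0) ;;
     Assign vNew (Const 0) ;;
     While (Less (Var vI) (Var vLen)) (scan_vertex keep den) ;;
     Assign vLen (Var vNew)"

context incident_ram
begin

text \<open>18 units per listed vertex: 5 to copy it to the stack and 13 for its first pop.\<close>

lemma sure_peel:
  assumes lk: "linked n s lo" and lo: "1 \<le> lo"
    and who: "\<And>j. lo \<le> j \<Longrightarrow> j < var s vNode \<Longrightarrow> arr s aWho j \<in> U" and U: "U \<subseteq> {..<n}"
    and cnt: "\<And>x. x \<in> U \<Longrightarrow> arr s aCnt x = card {j \<in> live s lo. arr s aWho j = x}"
    and m: "var s vLen = m"
    and lst: "\<And>i. i < m \<Longrightarrow> arr s aList i \<in> U"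
      "\<And>x. x \<in> U \<Longrightarrow> arr s aDead x = 0 \<Longrightarrow> x \<in> arr s aList ` {..<m}"
    and w: "m + card (live s lo) < 2 ^ w"
    and t: "18 * m + 24 * card (live s lo) + 8 \<le> t"
  shows "sure t peel s (\<lambda>r s'.
    t + 24 * card (live s' lo) \<le> r + 18 * m + 24 * card (live s lo) + 8 \<and>
    (\<forall>x\<in>U. arr s' aDead x = 0 \<longrightarrow> var s vThr \<le> card {j \<in> live s' lo. arr s aWho j = x}) \<and>
    (\<forall>x. arr s' aDead x = arr s aDead x \<or> x \<in> U \<and> arr s aDead x = 0 \<and> arr s' aDead x = 1) \<and>
    (\<forall>x\<in>U. arr s' aCnt x = card {j \<in> live s' lo. arr s aWho j = x}) \<and>
    (\<forall>Y. (\<forall>x\<in>Y. arr s aDead x = 0) \<longrightarrow> (\<forall>x\<in>Y \<inter> U. var s vThr \<le> hits s lo x Y) \<longrightarrow>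
      (\<forall>x\<in>Y. arr s' aDead x = 0)))"
proof -
  let ?copy = "Write aStack (Var vI) (Read aList (Var vI)) ;; incr vI"
  define f where "f = arr s aList"
  define s0 where "s0 = set_var vI 0 s"
  have copy: "sure (t - 2) (While (Less (Var vI) (Var vLen)) ?copy) s0
      (\<lambda>r s'. t \<le> r + 5 * m + 3 \<and> (\<forall>i<m. arr s' aStack i = f i))"
  proof (rule sure_While[where I = "\<lambda>r s'. var s' vI \<le> m \<and> t \<le> r + 5 * var s' vI + 2 \<and>
      (\<forall>i<var s' vI. arr s' aStack i = f i)"])
    fix r s' assume I: "var s' vI \<le> m \<and> t \<le> r + 5 * var s' vI + 2 \<and> (\<forall>i<var s' vI. arr s' aStack i = f i)"
      and ag: "agree ?copy s0 s'"
    have s': "var s' vLen = m" "arr s' aList = f"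
      using agree_var[OF ag] agree_arr[OF ag] m by (simp_all add: s0_def f_def)
    have "5 \<le> r" using I t by linarith
    then obtain r' where r': "r = r' + 5" by (metis add.commute le_Suc_ex)
    show "0 < r \<and> (if eval_exp w (Less (Var vI) (Var vLen)) s' \<noteq> 0
          then sure (r - 1) ?copy s'
              (\<lambda>r s''. 0 < r \<and> var s'' vI \<le> m \<and> t \<le> r - 1 + 5 * var s'' vI + 2 \<and> (\<forall>i<var s'' vI. arr s'' aStack i = f i))
          else t \<le> r - 1 + 5 * m + 3 \<and> (\<forall>i<m. arr s' aStack i = f i))"
    proof (cases "var s' vI < m")
      case True
      then have "Suc (var s' vI) mod 2 ^ w = Suc (var s' vI)" using w by (intro mod_less) linarith
      then show ?thesis using I s' True r' w_pos by (auto simp: less_Suc_eq)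
    next
      case False
      then show ?thesis using I s' r' by simp
    qed
  qed (use t in \<open>simp add: s0_def\<close>)
  let ?post = "\<lambda>r s'.
    t + 24 * card (live s' lo) \<le> r + 18 * m + 24 * card (live s lo) + 8 \<and>
    (\<forall>x\<in>U. arr s' aDead x = 0 \<longrightarrow> var s vThr \<le> card {j \<in> live s' lo. arr s aWho j = x}) \<and>
    (\<forall>x. arr s' aDead x = arr s aDead x \<or> x \<in> U \<and> arr s aDead x = 0 \<and> arr s' aDead x = 1) \<and>
    (\<forall>x\<in>U. arr s' aCnt x = card {j \<in> live s' lo. arr s aWho j = x}) \<and>
    (\<forall>Y. (\<forall>x\<in>Y. arr s aDead x = 0) \<longrightarrow> (\<forall>x\<in>Y \<inter> U. var s vThr \<le> hits s lo x Y) \<longrightarrow>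
      (\<forall>x\<in>Y. arr s' aDead x = 0))"
  have "sure (t - 2) (While (Less (Var vI) (Var vLen)) ?copy) s0
      (\<lambda>r s'. 0 < r \<and> 0 < r - 1 \<and> 0 < r - 1 - 1 \<and>
        sure (r - 1 - 1 - 1) (While (Var vTop) pop_vertex) (set_var vTop (var s' vLen) s') ?post)"
    using copy
  proof (rule sure_mono)
    fix r s' assume ag: "agree (While (Less (Var vI) (Var vLen)) ?copy) s0 s'"
      and Q: "t \<le> r + 5 * m + 3 \<and> (\<forall>i<m. arr s' aStack i = f i)"
    have s': "var s' vLen = m" "arr s' aWho = arr s aWho" "arr s' aTgt = arr s aTgt" "arr s' aNext = arr s aNext"
      "arr s' aHead = arr s aHead" "arr s' aCnt = arr s aCnt" "arr s' aDead = arr s aDead"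
      "var s' vNode = var s vNode" "var s' vThr = var s vThr"
      using agree_var[OF ag] agree_arr[OF ag] m by (simp_all add: s0_def)
    define s2 where "s2 = set_var vTop (var s' vLen) s'"
    have s2: "arr s2 aWho = arr s aWho" "arr s2 aTgt = arr s aTgt" "arr s2 aNext = arr s aNext"
      "arr s2 aHead = arr s aHead" "arr s2 aCnt = arr s aCnt" "arr s2 aDead = arr s aDead"
      "var s2 vNode = var s vNode" "var s2 vThr = var s vThr" "var s2 vTop = m" "arr s2 aStack = arr s' aStack"
      by (simp_all add: s2_def s')
    have live2: "live s2 lo = live s lo" by (simp add: live_def s2)
    have hits2: "hits s2 lo x Y = hits s lo x Y" for x Y by (simp add: hits_def s2)
    have stk: "stack_ok s2 U"
      unfolding stack_ok_def s2
    proof (intro conjI allI ballI impI)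
      fix i assume "i < m"
      then show "arr s' aStack i \<in> U" using Q lst(1) by (simp add: f_def)
    next
      fix x assume "x \<in> U" "arr s aDead x = 0"
      then obtain i where "i < m" "f i = x" using lst(2) by (auto simp: f_def)
      then show "\<exists>i<m. arr s' aStack i = x" using Q by auto
    qed
    have r: "13 * m + 24 * card (live s lo) + 1 \<le> r - 3" "4 \<le> r" using Q t by linarith+
    have "sure (r - 3) (While (Var vTop) pop_vertex) s2 (\<lambda>r1 s'.
    r - 3 + 24 * card (live s' lo) \<le> r1 + 1 + 13 * m + 24 * card (live s lo) \<and>
    (\<forall>x\<in>U. arr s' aDead x = 0 \<longrightarrow> var s vThr \<le> card {j \<in> live s' lo. arr s aWho j = x}) \<and>
    (\<forall>x. arr s' aDead x = arr s aDead x \<or> x \<in> U \<and> arr s aDead x = 0 \<and> arr s' aDead x = 1) \<and>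
    (\<forall>x\<in>U. arr s' aCnt x = card {j \<in> live s' lo. arr s aWho j = x}) \<and>
    (\<forall>Y. (\<forall>x\<in>Y. arr s aDead x = 0) \<longrightarrow> (\<forall>x\<in>Y \<inter> U. var s vThr \<le> hits s lo x Y) \<longrightarrow>
      (\<forall>x\<in>Y. arr s' aDead x = 0)))"
      using sure_pop_vertices[where s = s2 and lo = lo and U = U and t = "r - 3"] lk lo who U cnt stk w r
      by (simp add: s2 live2 hits2 linked_def)
    then have "sure (r - 3) (While (Var vTop) pop_vertex) s2 ?post"
    proof (rule sure_conseq)
      fix r1 s3 assume P: "r - 3 + 24 * card (live s3 lo) \<le> r1 + 1 + 13 * m + 24 * card (live s lo) \<and>
    (\<forall>x\<in>U. arr s3 aDead x = 0 \<longrightarrow> var s vThr \<le> card {j \<in> live s3 lo. arr s aWho j = x}) \<and>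
    (\<forall>x. arr s3 aDead x = arr s aDead x \<or> x \<in> U \<and> arr s aDead x = 0 \<and> arr s3 aDead x = 1) \<and>
    (\<forall>x\<in>U. arr s3 aCnt x = card {j \<in> live s3 lo. arr s aWho j = x}) \<and>
    (\<forall>Y. (\<forall>x\<in>Y. arr s aDead x = 0) \<longrightarrow> (\<forall>x\<in>Y \<inter> U. var s vThr \<le> hits s lo x Y) \<longrightarrow>
      (\<forall>x\<in>Y. arr s3 aDead x = 0))"
      have "t + 24 * card (live s3 lo) \<le> r1 + 18 * m + 24 * card (live s lo) + 8"
        using conjunct1[OF P] conjunct1[OF Q] r by linarith
      then show "?post r1 s3" using P by blast
    qed
    then show "0 < r \<and> 0 < r - 1 \<and> 0 < r - 1 - 1 \<and>
        sure (r - 1 - 1 - 1) (While (Var vTop) pop_vertex) (set_var vTop (var s' vLen) s') ?post"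
      using r unfolding s2_def by (simp add: numeral_3_eq_3)
  qed
  then show ?thesis
    using t unfolding peel_def sure_Seq sure_Assign s0_def by (simp add: numeral_2_eq_2)
qed

lemma sure_scan:
  assumes m: "var s vLen = m" "m \<le> n" and f: "inj_on f {..<m}" "arr s aList = f"
    and keep: "keep \<le> 1" and den: "den < 2 ^ w"
    and t: "20 * m + 9 \<le> t"
  shows "sure t (scan keep den) s (\<lambda>r s'. t \<le> r + 20 * m + 9 \<and> var s' vLen \<le> m \<and>
    inj_on (arr s' aList) {..<var s' vLen} \<and>
    arr s' aList ` {..<var s' vLen} = {x \<in> f ` {..<m}. arr s aDead x = keep} \<and>
    (\<forall>x. arr s' aDead x = (if x \<in> f ` {..<m} \<and> arr s aDead x = keep then 0 else arr s aDead x)) \<and>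
    (\<forall>x. arr s' aNum x = (if x \<in> f ` {..<m} \<and> arr s aDead x = 0 then var s vLevel else arr s aNum x)) \<and>
    (\<forall>x. arr s' aDen x = (if x \<in> f ` {..<m} \<and> arr s aDead x = 0 then den else arr s aDen x)))"
proof -
  \<comment> \<open>The list is compacted in place. The write position never passes the read
    position, so the entries from \<open>i\<close> on are still the original ones.\<close>
  define I where "I r s' \<longleftrightarrow> (let i = var s' vI; k = var s' vNew in
    i \<le> m \<and> k \<le> i \<and> t \<le> r + 20 * i + 4 \<and> inj_on (arr s' aList) {..<k} \<and>
    arr s' aList ` {..<k} = {x \<in> f ` {..<i}. arr s aDead x = keep} \<and>
    (\<forall>j. i \<le> j \<longrightarrow> arr s' aList j = f j) \<and>
    (\<forall>x. arr s' aDead x = (if x \<in> f ` {..<i} \<and> arr s aDead x = keep then 0 else arr s aDead x)) \<and>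
    (\<forall>x. arr s' aNum x = (if x \<in> f ` {..<i} \<and> arr s aDead x = 0 then var s vLevel else arr s aNum x)) \<and>
    (\<forall>x. arr s' aDen x = (if x \<in> f ` {..<i} \<and> arr s aDead x = 0 then den else arr s aDen x)))" for r and s' :: store
  define s0 where "s0 = set_var vNew 0 (set_var vI 0 s)"
  have keep_mod: "keep mod 2 ^ w = keep" using keep w_pos by (intro mod_less) (use one_less_power[of "2::nat" w] in linarith)
  have loop: "sure (t - 4) (While (Less (Var vI) (Var vLen)) (scan_vertex keep den)) s0
      (\<lambda>r s'. var s' vI = m \<and> I (Suc r) s')"
  proof (rule sure_While[where I = I])
    show "I (t - 4) s0" using t f by (simp add: I_def s0_def Let_def)
    fix r s' assume I: "I r s'" and ag: "agree (scan_vertex keep den) s0 s'"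
    have s': "var s' vLen = m" "var s' vLevel = var s vLevel"
      using agree_var[OF ag] m by (simp_all add: s0_def scan_vertex_def)
    define i where "i = var s' vI"
    define k where "k = var s' vNew"
    have ik: "i \<le> m" "k \<le> i" and r: "t \<le> r + 20 * i + 4" and inj: "inj_on (arr s' aList) {..<k}"
      and img: "arr s' aList ` {..<k} = {x \<in> f ` {..<i}. arr s aDead x = keep}"
      and rest: "\<And>j. i \<le> j \<Longrightarrow> arr s' aList j = f j"
      and dead: "\<And>x. arr s' aDead x = (if x \<in> f ` {..<i} \<and> arr s aDead x = keep then 0 else arr s aDead x)"
      and num: "\<And>x. arr s' aNum x = (if x \<in> f ` {..<i} \<and> arr s aDead x = 0 then var s vLevel else arr s aNum x)"
      and dn: "\<And>x. arr s' aDen x = (if x \<in> f ` {..<i} \<and> arr s aDead x = 0 then den else arr s aDen x)"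
      using I unfolding I_def i_def k_def Let_def by blast+
    show "0 < r \<and> (if eval_exp w (Less (Var vI) (Var vLen)) s' \<noteq> 0
        then sure (r - 1) (scan_vertex keep den) s' (\<lambda>r s''. 0 < r \<and> I (r - 1) s'')
        else var s' vI = m \<and> I (Suc (r - 1)) s')"
    proof (cases "i < m")
      case False
      then show ?thesis using I ik s' r t by (auto simp: i_def)
    next
      case True
      define v where "v = f i"
      have new: "v \<notin> f ` {..<i}"
      proof
        assume "v \<in> f ` {..<i}"
        then obtain j where "j < i" "f j = f i" by (auto simp: v_def)
        then show False using inj_onD[OF f(1), of j i] True by simp
      qed
      have vdead: "arr s' aDead v = arr s aDead v" using dead new by simp
      have lv: "arr s' aList (var s' vI) = v" using rest[of i] by (simp add: i_def v_def)
      have "20 \<le> r" using r t True by linarith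
      then obtain r' where r': "r = r' + 20" by (metis add.commute le_Suc_ex)
      have wi: "Suc i mod 2 ^ w = Suc i" "Suc k mod 2 ^ w = Suc k"
        using n_word True ik m by (intro mod_less; linarith)+
      have fi: "f ` {..<Suc i} = insert v (f ` {..<i})" by (simp add: lessThan_Suc v_def)
      have step: "I r1 s''" if r1: "r' \<le> r1" and vI: "var s'' vI = Suc i"
        and d: "arr s'' aDead = (if arr s aDead v = keep then (arr s' aDead)(v := 0) else arr s' aDead)"
        and nm: "arr s'' aNum = (if arr s aDead v = 0 then (arr s' aNum)(v := var s vLevel) else arr s' aNum)"
        and dd: "arr s'' aDen = (if arr s aDead v = 0 then (arr s' aDen)(v := den) else arr s' aDen)"
        and l: "arr s'' aList = (if arr s aDead v = keep then (arr s' aList)(k := v) else arr s' aList)"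
        and vN: "var s'' vNew = (if arr s aDead v = keep then Suc k else k)" for r1 and s'' :: store
        unfolding I_def Let_def vI
      proof (intro conjI allI impI)
        show "Suc i \<le> m" using True by simp
        show "var s'' vNew \<le> Suc i" using vN ik by simp
        show "t \<le> r1 + 20 * Suc i + 4" using r1 r r' by simp
        have nin: "v \<notin> arr s' aList ` {..<k}" using img new by auto
        show "inj_on (arr s'' aList) {..<var s'' vNew}"
        proof (cases "arr s aDead v = keep")
          case True
          have "inj_on ((arr s' aList)(k := v)) {..<k}"
            using inj by (auto simp: inj_on_def)
          then show ?thesis using True l vN nin by (auto simp: lessThan_Suc)
        next
          case False
          then show ?thesis using l vN inj by simp
        qed
        show "arr s'' aList ` {..<var s'' vNew} = {x \<in> f ` {..<Suc i}. arr s aDead x = keep}"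
        proof (cases "arr s aDead v = keep")
          case True
          have "(arr s' aList)(k := v) ` {..<Suc k} = insert v (arr s' aList ` {..<k})"
            by (auto simp: lessThan_Suc)
          then show ?thesis using True l vN img fi by auto
        next
          case False
          then show ?thesis using l vN img fi by auto
        qed
        show "arr s'' aList j = f j" if "Suc i \<le> j" for j
          using that l rest[of j] ik by auto
        show "arr s'' aDead x = (if x \<in> f ` {..<Suc i} \<and> arr s aDead x = keep then 0 else arr s aDead x)" for x
          using d dead[of x] new unfolding fi by auto
        show "arr s'' aNum x = (if x \<in> f ` {..<Suc i} \<and> arr s aDead x = 0 then var s vLevel else arr s aNum x)" for x
          using nm num[of x] new unfolding fi by auto
        show "arr s'' aDen x = (if x \<in> f ` {..<Suc i} \<and> arr s aDead x = 0 then den else arr s aDen x)" for x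
          using dd dn[of x] new unfolding fi by auto
      qed
      have vI: "var s' vI = i" and vN: "var s' vNew = k" by (simp_all add: i_def k_def)
      have cond: "eval_exp w (Less (Var vI) (Var vLen)) s' \<noteq> 0" using True s' w_pos by (simp add: vI)
      have "sure (r - 1) (scan_vertex keep den) s' (\<lambda>r s''. 0 < r \<and> I (r - 1) s'')"
      proof (cases "arr s aDead v = 0")
        case True
        then show ?thesis
          using r' wi w_pos den lv vdead
          by (cases "arr s aDead v = keep") (auto simp: scan_vertex_def keep_mod vI vN s' intro!: step)
      next
        case False
        then show ?thesis
          using r' wi w_pos den lv vdead
          by (cases "arr s aDead v = keep") (auto simp: scan_vertex_def keep_mod vI vN s' intro!: step)
      qed
      then show ?thesis using cond r' by simp
    qed
  qed
  have "sure (t - 4) (While (Less (Var vI) (Var vLen)) (scan_vertex keep den)) s0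
      (\<lambda>r s'. 0 < r \<and> 0 < r - 1 \<and> t \<le> r - 1 - 1 + 20 * m + 9 \<and> var s' vNew \<le> m \<and>
    inj_on (arr s' aList) {..<var s' vNew} \<and>
    arr s' aList ` {..<var s' vNew} = {x \<in> f ` {..<m}. arr s aDead x = keep} \<and>
    (\<forall>x. arr s' aDead x = (if x \<in> f ` {..<m} \<and> arr s aDead x = keep then 0 else arr s aDead x)) \<and>
    (\<forall>x. arr s' aNum x = (if x \<in> f ` {..<m} \<and> arr s aDead x = 0 then var s vLevel else arr s aNum x)) \<and>
    (\<forall>x. arr s' aDen x = (if x \<in> f ` {..<m} \<and> arr s aDead x = 0 then den else arr s aDen x)))"
    using loop by (rule sure_conseq) (use t in \<open>auto simp: I_def Let_def\<close>)
  then show ?thesis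
    using t unfolding scan_def sure_Seq sure_Assign s0_def by (simp add: eval_nat_numeral)
qed

end

section \<open>Exact core numbers\<close>

definition exact_round :: com where
  "exact_round = Assign vThr (Var vLevel) ;; peel ;; scan 0 1 ;; incr vLevel"

text \<open>Nodes are numbered from 1, so a budget of one more than the degree sum never cancels a
  vertex.\<close>

definition exact :: com where
  "exact =
     Assign vBudget (Add (Var vSum) (Const 1)) ;;
     Assign vThr (Const 1) ;;
     Assign vLevel (Const 1) ;;
     build (Var vDeg) (Assign vPos (Var vDone)) ;;
     While (Var vLen) exact_round"

context incident_ram
begin

text \<open>Draw \<open>i\<close> reads position \<open>i\<close>. With potential 0 on true prefixes
  of the incident list, \<top> on all other prefixes, and \<open>p\<close> = 0, the Markov argument
  becomes a statement about every run.\<close>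

lemma sampler_exact:
  assumes "B + n < 2 ^ w"
  shows "sampler w n adj E (Assign vPos (Var vDone)) (Var vDeg) (\<lambda>i d. return_pmf i) (\<lambda>d. d)
    (\<lambda>v f. \<forall>X. f X = card (neighbors E v \<inter> X))
    (\<lambda>v i g. if \<forall>i'<i. g i' = adj v ! i' then 0 else \<top>) 0 K S B"
proof unfold_locales
  fix t :: nat and s and f :: "nat \<Rightarrow> store \<Rightarrow> ennreal" assume "0 < t"
  then show "mean t (Assign vPos (Var vDone)) s f =
      (\<integral>\<^sup>+k. f (t - 1) (set_var vPos k s) \<partial>measure_pmf (return_pmf (var s vDone)))"
    by (subst mean_Assign) auto
next
  fix v i :: nat and g :: "nat \<Rightarrow> nat" assume "v < n" "i < deg v"
  show "(\<integral>\<^sup>+k. (if \<forall>i'<Suc i. (g(i := adj v ! k)) i' = adj v ! i' then 0 else \<top>) \<partial>measure_pmf (return_pmf i))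
      \<le> (if \<forall>i'<i. g i' = adj v ! i' then 0 else \<top>)"
    by (auto simp: less_Suc_eq)
next
  fix v and g :: "nat \<Rightarrow> nat"
  assume v: "v < n" and bad: "\<not> (\<forall>X. card {i. i < deg v \<and> g i \<in> X} = card (neighbors E v \<inter> X))"
  have no: "\<not> (\<forall>i<deg v. g i = adj v ! i)"
  proof
    assume g: "\<forall>i<deg v. g i = adj v ! i"
    have "card {i. i < deg v \<and> g i \<in> X} = card (neighbors E v \<inter> X)" for X
    proof -
      have "{i. i < deg v \<and> g i \<in> X} = {i. i < deg v \<and> adj v ! i \<in> X}" using g by auto
      then show ?thesis using card_adj[OF v] by simp
    qed
    then show False using bad by blast
  qed
  show "1 \<le> (if \<forall>i'<deg v. g i' = adj v ! i' then 0 else \<top> :: ennreal)" by (simp add: no)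
next
  show "B + deg v < 2 ^ w" if "v < n" for v using assms deg_less[OF that] by simp
qed auto

text \<open>The survivors have at least \<open>k\<close> neighbors among themselves, so their core
  numbers reach \<open>k\<close>; conversely the vertices of core number at least \<open>k\<close>
  protect each other by \<open>core_number_dense\<close>. The constant overhead of a round is
  charged to its listed vertices, of which there is at least one.\<close>

lemma sure_exact_round:
  assumes lk: "linked n s 1" and node: "var s vNode = Suc M"
    and who: "\<And>j. 1 \<le> j \<Longrightarrow> j < Suc M \<Longrightarrow> arr s aWho j < n"
    and hits: "\<And>x X. x < n \<Longrightarrow> hits s 1 x X = card (neighbors E x \<inter> X)"
    and cnt: "\<And>x. x < n \<Longrightarrow> arr s aCnt x = card {j \<in> live s 1. arr s aWho j = x}"
    and m: "var s vLen = m" "0 < m" and inj: "inj_on (arr s aList) {..<m}"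
    and A: "arr s aList ` {..<m} = {x. x < n \<and> arr s aDead x = 0}" "{x. x < n \<and> arr s aDead x = 0} = {x. x < n \<and> k - 1 \<le> core x}"
    and k: "var s vLevel = k" "1 \<le> k"
    and out: "\<And>x. x < n \<Longrightarrow> arr s aNum x = min (core x) (k - 1) \<and> arr s aDen x = 1"
    and w: "M + n < 2 ^ w"
    and t: "61 * m + 24 * card (live s 1) \<le> t"
  shows "sure t exact_round s (\<lambda>r s'. t + 24 * card (live s' 1) \<le> r + 61 * m + 24 * card (live s 1) \<and>
    (\<forall>x<n. arr s' aCnt x = card {j \<in> live s' 1. arr s aWho j = x}) \<and>
    inj_on (arr s' aList) {..<var s' vLen} \<and>
    arr s' aList ` {..<var s' vLen} = {x. x < n \<and> arr s' aDead x = 0} \<and>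
    {x. x < n \<and> arr s' aDead x = 0} = {x. x < n \<and> k \<le> core x} \<and> var s' vLevel = Suc k \<and>
    (\<forall>x<n. arr s' aNum x = min (core x) k \<and> arr s' aDen x = 1))"
proof -
  define s1 where "s1 = set_var vThr k s"
  have s1: "arr s1 = arr s" "var s1 vNode = Suc M" "var s1 vLen = m" "var s1 vThr = k" "var s1 vLevel = k"
    by (simp_all add: s1_def node m k)
  have lk1: "linked n s1 1" using lk by (simp add: s1_def linked_set_var)
  have live1: "live s1 1 = live s 1" by (simp add: live_def s1 node)
  have hits1: "hits s1 1 x X = card (neighbors E x \<inter> X)" if "x < n" for x X
    using hits[OF that] by (simp add: hits_def s1 node)
  have mn: "m \<le> n"
    using card_image[OF inj] A card_mono[of "{..<n}" "{x. x < n \<and> arr s aDead x = 0}"] by auto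
  have "card (live s 1) \<le> card {1..M}"
    by (intro card_mono) (auto simp: live_def node)
  then have wl: "m + card (live s 1) < 2 ^ w" using w mn by simp
  obtain v where v: "v < n" "k - 1 \<le> core v"
    using A m(2) by (metis (mono_tags, lifting) imageI lessThan_iff mem_Collect_eq)
  have kn: "k \<le> n" using core_number_le_degree[of v] v deg_less[of v] k by (simp add: deg_eq)
  let ?dead = "\<lambda>s'. {x. x < n \<and> arr s' aDead x = 0}"
  define R where "R r s' \<longleftrightarrow> t + 24 * card (live s' 1) \<le> r + 61 * m + 24 * card (live s 1) \<and>
    (\<forall>x<n. arr s' aCnt x = card {j \<in> live s' 1. arr s aWho j = x}) \<and>
    inj_on (arr s' aList) {..<var s' vLen} \<and>
    arr s' aList ` {..<var s' vLen} = ?dead s' \<and>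
    ?dead s' = {x. x < n \<and> k \<le> core x} \<and> var s' vLevel = Suc k \<and>
    (\<forall>x<n. arr s' aNum x = min (core x) k \<and> arr s' aDen x = 1)" for r s'
  have upd: "var (set_var vLevel x s') vLen = var s' vLen" "var (set_var vLevel x s') vLevel = x" for x s' by simp_all
  define P where "P r s' \<longleftrightarrow> t - 2 + 24 * card (live s' 1) \<le> r + 18 * m + 24 * card (live s 1) + 8 \<and>
    (\<forall>x<n. arr s' aCnt x = card {j \<in> live s' 1. arr s aWho j = x}) \<and>
    ?dead s' = {x. x < n \<and> k \<le> core x}" for r s'
  have t2: "18 * m + 24 * card (live s 1) + 8 \<le> t - 2" using t m(2) by linarith
  have p1: "sure (t - 2) peel s1 (\<lambda>r s'.
    t - 2 + 24 * card (live s' 1) \<le> r + 18 * m + 24 * card (live s 1) + 8 \<and>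
    (\<forall>x\<in>{..<n}. arr s' aDead x = 0 \<longrightarrow> k \<le> card {j \<in> live s' 1. arr s aWho j = x}) \<and>
    (\<forall>x. arr s' aDead x = arr s aDead x \<or> x \<in> {..<n} \<and> arr s aDead x = 0 \<and> arr s' aDead x = 1) \<and>
    (\<forall>x\<in>{..<n}. arr s' aCnt x = card {j \<in> live s' 1. arr s aWho j = x}) \<and>
    (\<forall>Y. (\<forall>x\<in>Y. arr s aDead x = 0) \<longrightarrow> (\<forall>x\<in>Y \<inter> {..<n}. k \<le> hits s1 1 x Y) \<longrightarrow>
      (\<forall>x\<in>Y. arr s' aDead x = 0)))"
    (is "sure _ _ _ ?P1")
  proof (rule sure_peel[of s1 1 "{..<n}" m "t - 2", unfolded s1 live1])
    show "arr s aList i \<in> {..<n}" if "i < m" for i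
      using that A(1) by (metis (no_types, lifting) imageI lessThan_iff mem_Collect_eq)
    show "x \<in> arr s aList ` {..<m}" if "x \<in> {..<n}" "arr s aDead x = 0" for x
      using that A(1) by simp
  qed (use lk1 who cnt wl t2 in auto)
  have peel: "sure (t - 2) peel s1 P"
    using p1
  proof (rule sure_mono)
    fix r s' assume ag: "agree peel s1 s'" and R: "?P1 r s'"
    note R2 = conjunct2[OF R]
    note R4 = conjunct2[OF conjunct2[OF R2]]
    have Q: "t - 2 + 24 * card (live s' 1) \<le> r + 18 * m + 24 * card (live s 1) + 8"
      by (rule conjunct1[OF R])
    have Q1: "k \<le> card {j \<in> live s' 1. arr s aWho j = x}" if "x < n" "arr s' aDead x = 0" for x
      using conjunct1[OF R2] that by blast
    have Q2: "arr s' aCnt x = card {j \<in> live s' 1. arr s aWho j = x}" if "x < n" for x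
      using conjunct1[OF R4] that by blast
    have Q3: "arr s' aDead x = 0" if "\<And>x. x \<in> Y \<Longrightarrow> arr s aDead x = 0"
      "\<And>x. x \<in> Y \<Longrightarrow> x < n \<Longrightarrow> k \<le> hits s1 1 x Y" "x \<in> Y" for Y x
    proof -
      have "\<forall>x\<in>Y. arr s' aDead x = 0"
        using conjunct2[OF R4, THEN spec[of _ Y]] that(1,2) by simp
      then show ?thesis using that(3) by blast
    qed
    have s': "arr s' aTgt = arr s aTgt" "var s' vNode = Suc M"
      using agree_var[OF ag] agree_arr[OF ag]
      by (simp_all add: peel_def pop_vertex_def kill_vertex_def visit_node_def s1)
    have lh: "card {j \<in> live s' 1. arr s aWho j = x} = card (neighbors E x \<inter> ?dead s')" if "x < n" for x
    proof -
      have "{j \<in> live s' 1. arr s aWho j = x} = {j. 1 \<le> j \<and> j < var s vNode \<and> arr s aWho j = x \<and> arr s aTgt j \<in> ?dead s'}"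
        using lk by (auto simp: live_def s' node linked_def)
      then show ?thesis using hits[OF that, of "?dead s'"] by (simp add: hits_def)
    qed
    have "k \<le> core x" if "x < n" "arr s' aDead x = 0" for x
    proof (rule core_number_ge[of "?dead s'"])
      show "k \<le> card (neighbors E u \<inter> ?dead s')" if "u \<in> ?dead s'" for u
        using that Q1[of u] lh[of u] by simp
    qed (use that in auto)
    moreover have "arr s' aDead x = 0" if x: "x < n" "k \<le> core x" for x
    proof (rule Q3[of "{x. x < n \<and> k \<le> core x}"])
      fix y assume y: "y \<in> {x. x < n \<and> k \<le> core x}"
      then have "k - 1 \<le> core y" by auto
      then show "arr s aDead y = 0" using y A(2) by blast
      show "k \<le> hits s1 1 y {x. x < n \<and> k \<le> core x}"
        using y core_number_dense[of y k] hits1[of y] by simp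
    qed (use x in auto)
    ultimately show "P r s'" using Q Q2 unfolding P_def by blast
  qed
  have main: "sure (t - 2) peel s1 (\<lambda>r s'. 0 < r \<and> sure (r - 1) (scan 0 1) s' (\<lambda>r s'. 0 < r \<and> 0 < r - 1 \<and>
      var s' vLevel = k \<and> R (r - 1 - 1) (set_var vLevel (Suc k) s')))"
    using peel
  proof (rule sure_mono)
    fix r s' assume ag: "agree peel s1 s'" and P: "P r s'"
    have s': "var s' vNode = Suc M" "var s' vLen = m" "var s' vLevel = k" "arr s' aList = arr s aList"
      "arr s' aNum = arr s aNum" "arr s' aDen = arr s aDen" "arr s' aTgt = arr s aTgt"
      using agree_var[OF ag] agree_arr[OF ag]
      by (simp_all add: peel_def pop_vertex_def kill_vertex_def visit_node_def s1)
    have r: "20 * m + 9 \<le> r - 1" "13 + 20 * m \<le> r"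
    proof -
      have "card (live s' 1) \<ge> 0" by simp
      have "t - 2 \<le> r + 18 * m + 24 * card (live s 1) + 8" using P by (simp add: P_def)
      then show "20 * m + 9 \<le> r - 1" "13 + 20 * m \<le> r" using t m(2) by linarith+
    qed
    have one: "(1::nat) < 2 ^ w" using w_pos one_less_power[of "2::nat" w] by simp
    have sc: "sure (r - 1) (scan 0 1) s' (\<lambda>r1 s''. r - 1 \<le> r1 + 20 * m + 9 \<and> var s'' vLen \<le> m \<and>
        inj_on (arr s'' aList) {..<var s'' vLen} \<and>
        arr s'' aList ` {..<var s'' vLen} = {x \<in> arr s aList ` {..<m}. arr s' aDead x = 0} \<and>
        (\<forall>x. arr s'' aDead x = (if x \<in> arr s aList ` {..<m} \<and> arr s' aDead x = 0 then 0 else arr s' aDead x)) \<and>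
        (\<forall>x. arr s'' aNum x = (if x \<in> arr s aList ` {..<m} \<and> arr s' aDead x = 0 then k else arr s aNum x)) \<and>
        (\<forall>x. arr s'' aDen x = (if x \<in> arr s aList ` {..<m} \<and> arr s' aDead x = 0 then 1 else arr s aDen x)))"
      (is "sure _ _ _ ?S")
      by (rule sure_scan[of s' m "arr s aList" 0 1 "r - 1", unfolded s']) (use mn inj r one in auto)
    then have "sure (r - 1) (scan 0 1) s' (\<lambda>r s'. 0 < r \<and> 0 < r - 1 \<and>
      var s' vLevel = k \<and> R (r - 1 - 1) (set_var vLevel (Suc k) s'))"
    proof (rule sure_mono)
      fix r1 s'' assume ag2: "agree (scan 0 1) s' s''" and S: "?S r1 s''"
      have s'': "var s'' vNode = Suc M" "var s'' vLevel = k" "arr s'' aCnt = arr s' aCnt" "arr s'' aTgt = arr s aTgt"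
        using agree_var[OF ag2] agree_arr[OF ag2] by (simp_all add: scan_def scan_vertex_def s')
      have S0: "r - 1 \<le> r1 + 20 * m + 9" and Sinj: "inj_on (arr s'' aList) {..<var s'' vLen}"
        and Simg: "arr s'' aList ` {..<var s'' vLen} = {x \<in> arr s aList ` {..<m}. arr s' aDead x = 0}"
        and Sdead: "\<forall>x. arr s'' aDead x = (if x \<in> arr s aList ` {..<m} \<and> arr s' aDead x = 0 then 0 else arr s' aDead x)"
        and Snum: "\<forall>x. arr s'' aNum x = (if x \<in> arr s aList ` {..<m} \<and> arr s' aDead x = 0 then k else arr s aNum x)"
        and Sden: "\<forall>x. arr s'' aDen x = (if x \<in> arr s aList ` {..<m} \<and> arr s' aDead x = 0 then 1 else arr s aDen x)"
        using S by - (elim conjE, assumption)+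
      have dead: "arr s'' aDead = arr s' aDead"
      proof
        show "arr s'' aDead x = arr s' aDead x" for x using Sdead[rule_format, of x] by (simp split: if_splits)
      qed
      have live: "live (set_var vLevel (Suc k) s'') 1 = live s' 1"
        by (simp add: live_def s'' s' dead)
      have dd: "?dead s' = {x. x < n \<and> k \<le> core x}" using P by (simp add: P_def)
      have dx: "x < n \<and> arr s' aDead x = 0 \<longleftrightarrow> x < n \<and> k \<le> core x" for x
        using eqset_imp_iff[OF dd, of x] by simp
      have Ad': "x \<in> arr s aList ` {..<m} \<and> arr s' aDead x = 0 \<longleftrightarrow> x < n \<and> k \<le> core x" for x
      proof -
        have "x \<in> arr s aList ` {..<m} \<longleftrightarrow> x < n \<and> k - 1 \<le> core x" unfolding A(1) A(2) by simp
        then show ?thesis using dx[of x] by (meson diff_le_self order_trans)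
      qed
      have Ad: "{x \<in> arr s aList ` {..<m}. arr s' aDead x = 0} = ?dead s'"
        unfolding Ad' dx ..
      have pot: "t - 2 + 24 * card (live s' 1) \<le> r + 18 * m + 24 * card (live s 1) + 8" using P by (simp add: P_def)
      have r1: "3 \<le> r1" using S0 r by linarith
      show "0 < r1 \<and> 0 < r1 - 1 \<and>
      var s'' vLevel = k \<and> R (r1 - 1 - 1) (set_var vLevel (Suc k) s'')"
        unfolding R_def upd arr_set_var
      proof (intro conjI allI impI)
        show "0 < r1" "0 < r1 - 1" using r1 by simp_all
        show "t + 24 * card (live (set_var vLevel (Suc k) s'') 1) \<le> r1 - 1 - 1 + 61 * m + 24 * card (live s 1)"
          unfolding live using pot S0 r r1 m(2) t by linarith
        show "arr s'' aCnt x = card {j \<in> live (set_var vLevel (Suc k) s'') 1. arr s aWho j = x}" if "x < n" for x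
          unfolding live s'' using P that by (simp add: P_def)
        show "arr s'' aList ` {..<var s'' vLen} = ?dead s''" unfolding Simg Ad dead ..
        show "?dead s'' = {x. x < n \<and> k \<le> core x}" using dd dead by simp
        show "arr s'' aNum x = min (core x) k" "arr s'' aDen x = 1" if "x < n" for x
          using Snum[rule_format, of x] Sden[rule_format, of x] out[OF that] that unfolding Ad' by (auto split: if_splits)
        show "inj_on (arr s'' aList) {..<var s'' vLen}" by (rule Sinj)
        show "var s'' vLevel = k" by (rule s''(2))
      qed (rule refl)
    qed
    then show "0 < r \<and> sure (r - 1) (scan 0 1) s' (\<lambda>r s'. 0 < r \<and> 0 < r - 1 \<and>
      var s' vLevel = k \<and> R (r - 1 - 1) (set_var vLevel (Suc k) s'))"
      using r by simp
  qed
  have ev: "eval_exp w (Add (Var vLevel) (Const 1)) s' = Suc k" if "var s' vLevel = k" for s'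
  proof -
    have "Suc k mod 2 ^ w = Suc k" using kn v n_word by (intro mod_less) linarith
    then show ?thesis using that w_pos by simp
  qed
  have e: "set_var vThr (eval_exp w (Var vLevel) s) s = s1" by (simp add: s1_def k)
  have t2: "0 < t" "0 < t - 1" "t - 1 - 1 = t - 2" using t m by linarith+
  have "sure t exact_round s R"
    unfolding exact_round_def sure_Seq sure_Assign e t2(3)
  proof (intro conjI t2(1,2) sure_conseq[OF main], goal_cases)
    case (1 r s')
    then show ?case by blast
  next
    case (2 r s')
    show ?case
    proof (rule sure_conseq[OF conjunct2[OF 2]])
      fix r s' assume X: "0 < r \<and> 0 < r - 1 \<and> var s' vLevel = k \<and> R (r - 1 - 1) (set_var vLevel (Suc k) s')"
      show "0 < r \<and> 0 < r - 1 \<and> R (r - 1 - 1) (set_var vLevel (eval_exp w (Add (Var vLevel) (Const 1)) s') s')"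
        using X ev[of s'] by (elim conjE) (simp only: simp_thms)
    qed
  qed
  then show ?thesis unfolding R_def .
qed

lemma sure_exact:
  assumes s: "var s vN = n" "var s vLen = n" "var s vNode = 1" "var s vSum = (\<Sum>v<n. deg v)"
    "\<And>i. i < n \<Longrightarrow> arr s aList i = i" "\<And>x. arr s aDead x = 0"
    "\<And>x. x < n \<Longrightarrow> arr s aNum x = 0 \<and> arr s aDen x = 1"
    and M: "M = (\<Sum>v<n. deg v)" and w: "M + n + 1 < 2 ^ w" and t: "88 * n + 106 * M + 20 \<le> t"
  shows "sure t exact s (\<lambda>r s'. \<forall>x<n. arr s' aNum x = core x \<and> arr s' aDen x = 1)"
proof -
  interpret sampler w n adj E "Assign vPos (Var vDone)" "Var vDeg" "\<lambda>i d. return_pmf i" "\<lambda>d. d"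
    "\<lambda>v f. \<forall>X. f X = card (neighbors E v \<inter> X)" "\<lambda>v i g. if \<forall>i'<i. g i' = adj v ! i' then 0 else \<top>"
    0 1 1 "Suc M"
    by (rule sampler_exact) (use w in simp)
  let ?build = "build (Var vDeg) (Assign vPos (Var vDone))"
  define s1 where "s1 = set_var vLevel 1 (set_var vThr 1 (set_var vBudget (Suc M) s))"
  have s1: "var s1 vN = n" "var s1 vLen = n" "var s1 vNode = 1" "var s1 vLevel = 1" "var s1 vThr = 1"
    "var s1 vBudget = Suc M" "arr s1 = arr s"
    by (simp_all add: s1_def s)
  have t1: "23 * n + 17 * (Suc M - 1) + 9 \<le> t - 6" using t by simp
  have lst: "arr s aList ` {..<n} = {..<n}" using s(5) by (auto simp: image_iff)
  have injl: "inj_on (arr s aList) {..<n}" using s(5) by (auto simp: inj_on_def)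
  have sum_lst: "(\<Sum>i<n. deg (arr s aList i)) = M" unfolding M by (rule sum.cong) (simp_all add: s)
  \<comment> \<open>Here \<open>nc\<close> is true and \<open>p\<close> is 0, so the expectation
    vanishes and the conclusion holds in all runs. The 6 units are the three assignments with their
    sequencing.\<close>
  have "mean (t - 6) ?build s1 (\<lambda>r s'.
      if t - 6 + 17 * 1 \<le> r + 23 * n + 9 + 17 * var s' vNode \<and> linked n s' 1 \<and>
        1 \<le> var s' vNode \<and> var s' vNode \<le> Suc M \<and>
        (\<forall>j. 1 \<le> j \<longrightarrow> j < var s' vNode \<longrightarrow> arr s' aWho j \<in> arr s aList ` {..<n}) \<and>
        (\<forall>i<n. arr s' aCnt (arr s aList i) = hits s' 1 (arr s aList i) UNIV) \<and>
        (True \<longrightarrow> var s' vNode = 1 + (\<Sum>i<n. deg (arr s aList i)))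
      then of_bool (True \<and> \<not> (\<forall>i<n. \<forall>X. hits s' 1 (arr s aList i) X = card (neighbors E (arr s aList i) \<inter> X)))
      else \<top>) \<le> of_nat n * 0"
    by (rule mean_build) (use t1 s1 injl sum_lst s(5) in auto)
  then have "mean (t - 6) ?build s1 (\<lambda>r s'.
      if t - 6 + 17 * 1 \<le> r + 23 * n + 9 + 17 * var s' vNode \<and> linked n s' 1 \<and>
        1 \<le> var s' vNode \<and> var s' vNode \<le> Suc M \<and>
        (\<forall>j. 1 \<le> j \<longrightarrow> j < var s' vNode \<longrightarrow> arr s' aWho j \<in> arr s aList ` {..<n}) \<and>
        (\<forall>i<n. arr s' aCnt (arr s aList i) = hits s' 1 (arr s aList i) UNIV) \<and>
        (True \<longrightarrow> var s' vNode = 1 + (\<Sum>i<n. deg (arr s aList i)))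
      then of_bool (True \<and> \<not> (\<forall>i<n. \<forall>X. hits s' 1 (arr s aList i) X = card (neighbors E (arr s aList i) \<inter> X)))
      else \<top>) = 0" by simp
  from sure_if_mean_zero[OF this]
  have build: "sure (t - 6) ?build s1 (\<lambda>r s'. t \<le> r + 23 * n + 17 * M + 15 \<and> linked n s' 1 \<and> var s' vNode = Suc M \<and>
    (\<forall>j. 1 \<le> j \<longrightarrow> j < Suc M \<longrightarrow> arr s' aWho j < n) \<and>
    (\<forall>x<n. arr s' aCnt x = hits s' 1 x UNIV) \<and>
    (\<forall>x<n. \<forall>X. hits s' 1 x X = card (neighbors E x \<inter> X)))"
    by (rule sure_conseq) (use s(5) lst sum_lst in \<open>auto split: if_splits\<close>)
  let ?post = "\<lambda>r s'. \<forall>x<n. arr s' aNum x = core x \<and> arr s' aDen x = 1"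
  have main: "sure (t - 6) ?build s1 (\<lambda>r s'. 0 < r \<and> sure (r - 1) (While (Var vLen) exact_round) s' ?post)"
    using build
  proof (rule sure_mono)
    fix r s2 assume ag: "agree ?build s1 s2"
      and Q: "t \<le> r + 23 * n + 17 * M + 15 \<and> linked n s2 1 \<and> var s2 vNode = Suc M \<and>
    (\<forall>j. 1 \<le> j \<longrightarrow> j < Suc M \<longrightarrow> arr s2 aWho j < n) \<and>
    (\<forall>x<n. arr s2 aCnt x = hits s2 1 x UNIV) \<and>
    (\<forall>x<n. \<forall>X. hits s2 1 x X = card (neighbors E x \<inter> X))"
    have s2: "var s2 vLen = n" "var s2 vLevel = 1" "arr s2 aList = arr s aList" "arr s2 aDead = arr s aDead"
      "arr s2 aNum = arr s aNum" "arr s2 aDen = arr s aDen"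
      using agree_var[OF ag] agree_arr[OF ag] s1
      by (simp_all add: build_def clear_heads_def build_vertex_def load_vertex_def sample_vertex_def insert_node_def)
    have node2: "var s2 vNode = Suc M" using Q by blast
    have live2: "live s2 1 = {j. 1 \<le> j \<and> j < Suc M}" using s(6) Q by (simp add: live_def s2)
    have r: "65 * n + 89 * M + 5 \<le> r" using Q t by linarith
    define A where "A s' = arr s' aList ` {..<var s' vLen}" for s' :: store
    \<comment> \<open>\<open>deg v + 2 - var s' vLevel\<close> bounds the rounds that
      \<open>v\<close> still takes part in. It is positive for listed vertices, since these satisfy
      \<open>var s' vLevel - 1 \<le> core x\<close> and core numbers do not exceed degrees.\<close>
    define I where "I r s' \<longleftrightarrow>
      65 * (\<Sum>v\<in>A s'. deg v + 2 - var s' vLevel) + 24 * card (live s' 1) + 1 \<le> r \<and>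
      inj_on (arr s' aList) {..<var s' vLen} \<and> A s' = {x. x < n \<and> arr s' aDead x = 0} \<and>
      {x. x < n \<and> arr s' aDead x = 0} = {x. x < n \<and> var s' vLevel - 1 \<le> core x} \<and> 1 \<le> var s' vLevel \<and>
      (\<forall>x<n. arr s' aCnt x = card {j \<in> live s' 1. arr s2 aWho j = x}) \<and>
      (\<forall>x<n. arr s' aNum x = min (core x) (var s' vLevel - 1) \<and> arr s' aDen x = 1)" for r and s' :: store
    have "sure (r - 1) (While (Var vLen) exact_round) s2 ?post"
    proof (rule sure_While[where I = I])
      have "(\<Sum>v<n. deg v + 2 - 1) = (\<Sum>v<n. deg v + 1)" by simp
      also have "\<dots> = M + n" unfolding M sum.distrib by simp
      finally have "(\<Sum>v<n. deg v + 2 - 1) = M + n" .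
      moreover have "card (live s2 1) = M"
      proof -
        have "{j. 1 \<le> j \<and> j < Suc M} = {1..M}" by auto
        then show ?thesis unfolding live2 by simp
      qed
      moreover have "A s2 = {..<n}" using lst by (simp add: A_def s2)
      moreover have "arr s2 aCnt x = card {j \<in> live s2 1. arr s2 aWho j = x}" if "x < n" for x
        unfolding live2 using Q that by (simp add: hits_def)
      ultimately show "I (r - 1) s2" using r s injl by (auto simp: I_def s2 s2(6)[simplified])
    next
      fix r s' assume I: "I r s'" and ag': "agree exact_round s2 s'"
      define k where "k = var s' vLevel"
      define m where "m = var s' vLen"
      have s': "var s' vNode = Suc M" "arr s' aWho = arr s2 aWho" "arr s' aTgt = arr s2 aTgt"
        "arr s' aNext = arr s2 aNext" "arr s' aHead = arr s2 aHead"
        using agree_var[OF ag'] agree_arr[OF ag'] Q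
        by (simp_all add: exact_round_def scan_def scan_vertex_def peel_def pop_vertex_def kill_vertex_def visit_node_def)
      have pot: "65 * (\<Sum>v\<in>A s'. deg v + 2 - k) + 24 * card (live s' 1) + 1 \<le> r"
        and inj: "inj_on (arr s' aList) {..<m}" and A: "A s' = {x. x < n \<and> arr s' aDead x = 0}"
        and D: "{x. x < n \<and> arr s' aDead x = 0} = {x. x < n \<and> k - 1 \<le> core x}" and k: "1 \<le> k"
        and cnt: "\<forall>x<n. arr s' aCnt x = card {j \<in> live s' 1. arr s2 aWho j = x}"
        and out: "\<forall>x<n. arr s' aNum x = min (core x) (k - 1) \<and> arr s' aDen x = 1"
        using I unfolding I_def k_def m_def by - (elim conjE, assumption)+
      have cA: "card (A s') = m" unfolding A_def m_def[symmetric] using inj by (simp add: card_image)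
      have finA: "finite (A s')" by (simp add: A_def)
      have degA: "k - 1 \<le> deg v" if "v \<in> A s'" for v
        using that core_number_le_degree[of v] unfolding A D by (auto simp: deg_eq)
      show "0 < r \<and> (if eval_exp w (Var vLen) s' \<noteq> 0
          then sure (r - 1) exact_round s' (\<lambda>r s''. 0 < r \<and> I (r - 1) s'') else ?post (r - 1) s')"
      proof (cases "m = 0")
        case True
        then have "A s' = {}" by (simp add: A_def m_def)
        then have "core x < k - 1" if "x < n" for x using that unfolding A D by (auto simp: not_le)
        then have "min (core x) (k - 1) = core x" if "x < n" for x using that by (simp add: min_absorb1 less_imp_le)
        then have "?post (r - 1) s'" using out by simp
        then show ?thesis using pot True by (simp add: m_def)
      next
        case False
        have sum: "(\<Sum>v\<in>A s'. deg v + 2 - k) = (\<Sum>v\<in>A s'. deg v + 1 - k) + m"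
        proof -
          have "(\<Sum>v\<in>A s'. deg v + 2 - k) = (\<Sum>v\<in>A s'. (deg v + 1 - k) + 1)"
          proof (rule sum.cong)
            fix v assume "v \<in> A s'"
            then show "deg v + 2 - k = (deg v + 1 - k) + 1" using degA[of v] k by simp
          qed simp
          also have "\<dots> = (\<Sum>v\<in>A s'. deg v + 1 - k) + m" unfolding sum.distrib using cA by simp
          finally show ?thesis .
        qed
        have "linked n s' 1 = linked n s2 1" unfolding linked_def s' node2 ..
        then have lk: "linked n s' 1" using Q by blast
        have round: "sure (r - 1) exact_round s' (\<lambda>r1 s''. r - 1 + 24 * card (live s'' 1) \<le> r1 + 61 * m + 24 * card (live s' 1) \<and>
          (\<forall>x<n. arr s'' aCnt x = card {j \<in> live s'' 1. arr s' aWho j = x}) \<and>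
          inj_on (arr s'' aList) {..<var s'' vLen} \<and>
          arr s'' aList ` {..<var s'' vLen} = {x. x < n \<and> arr s'' aDead x = 0} \<and>
          {x. x < n \<and> arr s'' aDead x = 0} = {x. x < n \<and> k \<le> core x} \<and> var s'' vLevel = Suc k \<and>
          (\<forall>x<n. arr s'' aNum x = min (core x) k \<and> arr s'' aDen x = 1))"
        proof (rule sure_exact_round)
          show "arr s' aWho j < n" if "1 \<le> j" "j < Suc M" for j using Q that by (simp add: s')
          show "hits s' 1 x X = card (neighbors E x \<inter> X)" if "x < n" for x X
          proof -
            have "hits s' 1 x X = hits s2 1 x X" unfolding hits_def s' node2 ..
            then show ?thesis using Q that by simp
          qed
          show "arr s' aCnt x = card {j \<in> live s' 1. arr s' aWho j = x}" if "x < n" for x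
            unfolding s' using cnt that by blast
          show "arr s' aNum x = min (core x) (k - 1) \<and> arr s' aDen x = 1" if "x < n" for x
            using out that by blast
          show "61 * m + 24 * card (live s' 1) \<le> r - 1" using pot sum by linarith
          show "arr s' aList ` {..<m} = {x. x < n \<and> arr s' aDead x = 0}" using A by (simp add: A_def m_def)
        qed (use lk s' False inj D k w in \<open>auto simp: m_def k_def\<close>)
        have "sure (r - 1) exact_round s' (\<lambda>r s''. 0 < r \<and> I (r - 1) s'')"
          using round
        proof (rule sure_conseq)
          fix r1 s''
          assume R: "r - 1 + 24 * card (live s'' 1) \<le> r1 + 61 * m + 24 * card (live s' 1) \<and>
          (\<forall>x<n. arr s'' aCnt x = card {j \<in> live s'' 1. arr s' aWho j = x}) \<and>
          inj_on (arr s'' aList) {..<var s'' vLen} \<and>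
          arr s'' aList ` {..<var s'' vLen} = {x. x < n \<and> arr s'' aDead x = 0} \<and>
          {x. x < n \<and> arr s'' aDead x = 0} = {x. x < n \<and> k \<le> core x} \<and> var s'' vLevel = Suc k \<and>
          (\<forall>x<n. arr s'' aNum x = min (core x) k \<and> arr s'' aDen x = 1)"
          have sub: "A s'' \<subseteq> A s'"
          proof
            fix x assume "x \<in> A s''"
            then have "x < n" "k \<le> core x" using R by (auto simp: A_def)
            then show "x \<in> A s'" unfolding A D by auto
          qed
          have lev: "deg v + 2 - Suc k = deg v + 1 - k" for v by simp
          have "(\<Sum>v\<in>A s''. deg v + 1 - k) \<le> (\<Sum>v\<in>A s'. deg v + 1 - k)"
            by (rule sum_mono2[OF finA sub]) simp
          then have "65 * (\<Sum>v\<in>A s''. deg v + 1 - k) + 24 * card (live s'' 1) + 2 \<le> r1"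
            using conjunct1[OF R] pot sum False by linarith
          then show "0 < r1 \<and> I (r1 - 1) s''"
            using R unfolding I_def by (simp add: lev A_def s')
        qed
        then show ?thesis using False pot by (simp add: m_def)
      qed
    qed
    then show "0 < r \<and> sure (r - 1) (While (Var vLen) exact_round) s2 ?post" using r by simp
  qed
  have one: "(1::nat) mod 2 ^ w = 1" using w_pos by simp
  have "Suc M mod 2 ^ w = Suc M" using w by (intro mod_less) linarith
  then have e: "set_var vLevel (eval_exp w (Const 1) (set_var vThr (eval_exp w (Const 1) (set_var vBudget
      (eval_exp w (Add (Var vSum) (Const 1)) s) s)) (set_var vBudget (eval_exp w (Add (Var vSum) (Const 1)) s) s)))
      (set_var vThr (eval_exp w (Const 1) (set_var vBudget (eval_exp w (Add (Var vSum) (Const 1)) s) s))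
      (set_var vBudget (eval_exp w (Add (Var vSum) (Const 1)) s) s)) = s1"
    unfolding s1_def eval_exp.simps one by (simp add: s(4) M[symmetric])
  have t6: "t - 1 - 1 - 1 - 1 - 1 - 1 = t - 6" by simp
  show ?thesis
    unfolding exact_def sure_Seq sure_Assign e t6 using main t by simp
qed

end

section \<open>Concentration and level costs\<close>

text \<open>The formula is the conditional expectation of \<open>\<theta> * exp (a * hits)\<close>
  after \<open>i\<close> of \<open>T\<close> independent draws: each draw still missing contributes
  the factor \<open>1 + q * (exp a - 1)\<close>. Hence equality, a martingale.\<close>

lemma exp_moment_step:
  fixes a \<theta> q :: real and d T i :: nat
  assumes d: "0 < d" and q: "q = card {k. k < d \<and> xs k \<in> X} / d" and i: "i < T" and th: "0 \<le> \<theta>"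
  shows "(\<integral>\<^sup>+k. ennreal (exp (a * card {i'. i' < Suc i \<and> (g(i := xs k)) i' \<in> X}) * (1 + q * (exp a - 1)) ^ (T - Suc i) * \<theta>)
      \<partial>measure_pmf (pmf_of_set {..<d}))
    = ennreal (exp (a * card {i'. i' < i \<and> g i' \<in> X}) * (1 + q * (exp a - 1)) ^ (T - i) * \<theta>)"
    (is "(\<integral>\<^sup>+k. ennreal (?f k) \<partial>_) = _")
proof -
  let ?c = "card {i'. i' < i \<and> g i' \<in> X}"
  have q01: "0 \<le> q" "q \<le> 1"
  proof -
    show "0 \<le> q" using q by simp
    have "card {k. k < d \<and> xs k \<in> X} \<le> card {..<d}" by (intro card_mono) auto
    then show "q \<le> 1" using q d by (simp add: divide_le_eq)
  qed
  have base: "0 \<le> 1 + q * (exp a - 1)"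
  proof -
    have "1 + q * (exp a - 1) = (1 - q) + q * exp a" by (simp add: algebra_simps)
    moreover have "0 \<le> (1 - q) + q * exp a" using q01 by (intro add_nonneg_nonneg mult_nonneg_nonneg) auto
    ultimately show ?thesis by simp
  qed
  have cnt: "card {i'. i' < Suc i \<and> (g(i := xs k)) i' \<in> X} = ?c + (if xs k \<in> X then 1 else 0)" for k
  proof -
    have "{i'. i' < Suc i \<and> (g(i := xs k)) i' \<in> X} = {i'. i' < i \<and> g i' \<in> X} \<union> (if xs k \<in> X then {i} else {})"
      by (auto simp: less_Suc_eq)
    then show ?thesis by (auto simp: card_insert_if)
  qed
  have f: "?f k = exp (a * ?c) * (1 + q * (exp a - 1)) ^ (T - Suc i) * \<theta> * (if xs k \<in> X then exp a else 1)" for k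
    unfolding cnt by (simp add: exp_add distrib_left)
  have nonneg: "0 \<le> ?f k" for k using base th by simp
  have "(\<integral>\<^sup>+k. ennreal (?f k) \<partial>measure_pmf (pmf_of_set {..<d})) = (\<Sum>k<d. ennreal (?f k)) / ennreal (card {..<d})"
    using d by (subst nn_integral_pmf_of_set) (auto simp: ennreal_of_nat_eq_real_of_nat lessThan_empty_iff)
  also have "\<dots> = ennreal ((\<Sum>k<d. ?f k) / d)"
    using d nonneg by (subst sum_ennreal) (auto simp: divide_ennreal sum_nonneg)
  also have "(\<Sum>k<d. ?f k) = exp (a * ?c) * (1 + q * (exp a - 1)) ^ (T - Suc i) * \<theta> * (\<Sum>k<d. if xs k \<in> X then exp a else 1)"
    unfolding f sum_distrib_left ..
  also have "(\<Sum>k<d. if xs k \<in> X then exp a else 1) = d * (1 + q * (exp a - 1))"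
  proof -
    have "(\<Sum>k<d. if xs k \<in> X then exp a else 1) = (\<Sum>k<d. 1 + (if xs k \<in> X then exp a - 1 else 0))"
      by (intro sum.cong) auto
    also have "\<dots> = d + card {k. k < d \<and> xs k \<in> X} * (exp a - 1)"
      unfolding sum.distrib by (subst sum.inter_filter[symmetric]) (auto simp: lessThan_def)
    also have "\<dots> = d * (1 + q * (exp a - 1))" using d q by (simp add: field_simps)
    finally show ?thesis .
  qed
  also have "exp (a * ?c) * (1 + q * (exp a - 1)) ^ (T - Suc i) * \<theta> * (d * (1 + q * (exp a - 1))) / d
      = exp (a * ?c) * (1 + q * (exp a - 1)) ^ (T - i) * \<theta>"
  proof -
    have "T - i = Suc (T - Suc i)" using i by simp
    then show ?thesis using d by simp
  qed
  finally show ?thesis .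
qed

section \<open>Chernoff exponents\<close>

lemma power_one_plus_le_exp:
  fixes y :: real
  assumes "-1 \<le> y"
  shows "(1 + y) ^ T \<le> exp (T * y)"
proof -
  have "(1 + y) ^ T \<le> exp y ^ T" using assms by (intro power_mono exp_ge_add_one_self) auto
  then show ?thesis by (simp add: exp_of_nat_mult)
qed

lemma exp_bound_quadratic:
  fixes x :: real
  assumes "0 \<le> x" "x \<le> 1"
  shows "exp (- x) - 1 \<le> - x + x\<^sup>2 / 2" and "exp x - 1 \<le> x + x\<^sup>2"
proof -
  show "exp x - 1 \<le> x + x\<^sup>2" using exp_bound[OF assms] by simp
  have "1 + (-x) + (-x)\<^sup>2 / 2 - exp (-x) \<ge> 0"
  proof -
    \<comment> \<open>The difference vanishes at 0 and its derivative
      \<open>- 1 + y + exp (-y)\<close> is nonnegative.\<close>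
    have "(\<lambda>x. 1 - x + x\<^sup>2 / 2 - exp (-x)) 0 \<le> (\<lambda>x. 1 - x + x\<^sup>2 / 2 - exp (-x)) x"
    proof (rule DERIV_nonneg_imp_nondecreasing[OF assms(1)])
      fix y :: real assume "0 \<le> y" "y \<le> x"
      have "((\<lambda>x. 1 - x + x\<^sup>2 / 2 - exp (-x)) has_real_derivative (- 1 + y + exp (-y))) (at y)"
        by (auto intro!: derivative_eq_intros)
      moreover have "0 \<le> - 1 + y + exp (-y)" using exp_ge_add_one_self[of "-y"] by simp
      ultimately show "\<exists>z. ((\<lambda>x. 1 - x + x\<^sup>2 / 2 - exp (-x)) has_real_derivative z) (at y) \<and> 0 \<le> z" by blast
    qed
    then show ?thesis by simp
  qed
  then show "exp (- x) - 1 \<le> - x + x\<^sup>2 / 2" by simp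
qed

text \<open>The tilt \<open>\<delta> / 2\<close> is half of the relative gap. The coefficient 1/16
  is dictated by the upper tail; here there is slack.\<close>

lemma chernoff_lower_exponent:
  fixes \<mu> s \<delta> :: real
  assumes \<delta>: "0 < \<delta>" "\<delta> \<le> 1" and \<mu>: "s * (1 + \<delta>) \<le> \<mu>" and s: "0 \<le> s"
  shows "\<mu> * (exp (- (\<delta> / 2)) - 1) + \<delta> / 2 * s \<le> - s * \<delta>\<^sup>2 / 16"
proof -
  define b where "b = - (\<delta> / 2) + (\<delta> / 2)\<^sup>2 / 2"
  have e: "exp (- (\<delta> / 2)) - 1 \<le> b"
    unfolding b_def
    using \<delta> by (intro exp_bound_quadratic) auto
  have neg: "b \<le> 0"
    unfolding b_def using \<delta> by (simp add: power2_eq_square field_simps)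
  have "\<mu> * (exp (- (\<delta> / 2)) - 1) \<le> \<mu> * b"
    using e \<mu> s \<delta> by (intro mult_left_mono) (auto intro: order_trans[of _ "s * (1 + \<delta>)"])
  also have "\<dots> \<le> s * (1 + \<delta>) * b"
    using \<mu> neg by (rule mult_right_mono_neg)
  finally have "\<mu> * (exp (- (\<delta> / 2)) - 1) + \<delta> / 2 * s \<le> s * ((1 + \<delta>) * b + \<delta> / 2)"
    by (simp add: algebra_simps)
  also have "(1 + \<delta>) * b + \<delta> / 2 = - (\<delta>\<^sup>2 / 2) + (1 + \<delta>) * \<delta>\<^sup>2 / 8"
    unfolding b_def by (simp add: power2_eq_square field_simps)
  also have "s * (- (\<delta>\<^sup>2 / 2) + (1 + \<delta>) * \<delta>\<^sup>2 / 8) \<le> s * (- (\<delta>\<^sup>2 / 16))"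
  proof (intro mult_left_mono s)
    have "(1 + \<delta>) * \<delta>\<^sup>2 \<le> 2 * \<delta>\<^sup>2" using \<delta> by (intro mult_right_mono) auto
    moreover have "0 \<le> \<delta>\<^sup>2" by simp
    ultimately show "- (\<delta>\<^sup>2 / 2) + (1 + \<delta>) * \<delta>\<^sup>2 / 8 \<le> - (\<delta>\<^sup>2 / 16)" by linarith
  qed
  finally show ?thesis by simp
qed

text \<open>Only the gap \<open>\<delta> / 2\<close> is available, because rounding up the number of
  draws may add up to one expected hit; the tilt \<open>\<delta> / 4\<close> is again half of the
  gap.\<close>

lemma chernoff_upper_exponent:
  fixes \<mu> s \<delta> :: real
  assumes \<delta>: "0 < \<delta>" "\<delta> \<le> 1" and \<mu>: "\<mu> \<le> s * (1 - \<delta> / 2)" and s: "0 \<le> s"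
  shows "\<mu> * (exp (\<delta> / 4) - 1) - \<delta> / 4 * s \<le> - s * \<delta>\<^sup>2 / 16"
proof -
  define b where "b = \<delta> / 4 + (\<delta> / 4)\<^sup>2"
  have e: "exp (\<delta> / 4) - 1 \<le> b"
    unfolding b_def
    using \<delta> by (intro exp_bound_quadratic) auto
  have pos: "0 \<le> exp (\<delta> / 4) - 1" using \<delta> by simp
  have "\<mu> * (exp (\<delta> / 4) - 1) \<le> s * (1 - \<delta> / 2) * (exp (\<delta> / 4) - 1)"
    using \<mu> pos by (rule mult_right_mono)
  also have "\<dots> \<le> s * (1 - \<delta> / 2) * b"
    using e s \<delta> by (intro mult_left_mono) auto
  finally have "\<mu> * (exp (\<delta> / 4) - 1) - \<delta> / 4 * s \<le> s * ((1 - \<delta> / 2) * b - \<delta> / 4)"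
    by (simp add: algebra_simps)
  also have "(1 - \<delta> / 2) * b - \<delta> / 4 = - (\<delta>\<^sup>2 / 16) - \<delta> ^ 3 / 32"
    unfolding b_def by (simp add: power2_eq_square power3_eq_cube field_simps)
  also have "s * (- (\<delta>\<^sup>2 / 16) - \<delta> ^ 3 / 32) \<le> s * (- (\<delta>\<^sup>2 / 16))"
    using s \<delta> by (intro mult_left_mono) auto
  finally show ?thesis by simp
qed

text \<open>The amount spent on the samples of a vertex with core number \<open>c\<close> at the levels
  \<open>K, K - K div D, \<dots>\<close> telescopes.\<close>

definition vertex_potential :: "nat \<Rightarrow> nat \<Rightarrow> nat \<Rightarrow> real" where
  "vertex_potential D c K =
     (if (D - 1) * c < K then 2 * real D * (real D / (real D - 1)\<^sup>2 - real c / real K) else 0)"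

text \<open>Since \<open>K \<ge> D\<close>, the quotient \<open>K div D\<close> is at least 1 and
  rounding it down loses at most a factor 2. So the logarithm of the level drops by
  \<open>1 / (2 * D)\<close> each time, which bounds the number of levels.\<close>

lemma level_decrease:
  assumes D: "2 \<le> (D::nat)" and K: "D \<le> K"
  shows "real K / (2 * real D) \<le> real (K div D)" "(real D - 1) * K \<le> D * real (K - K div D)"
    "0 < K - K div D" "K - K div D < K" "ln (real (K - K div D)) \<le> ln (real K) - 1 / (2 * real D)"
proof -
  let ?q = "K div D"
  have q1: "1 \<le> ?q" using D K by (simp add: Suc_le_eq div_greater_zero_iff)
  have "K < D * ?q + D" using D by (metis add.commute dividend_less_times_div less_le_trans zero_less_numeral)
  also have "\<dots> \<le> 2 * D * ?q" using q1 by (cases ?q) auto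
  finally have "real K < real (2 * D * ?q)" by (simp only: of_nat_less_iff)
  then show q2: "real K / (2 * real D) \<le> real ?q" using D by (simp add: divide_le_eq mult.commute mult.left_commute)
  have "?q < K" using D K by (intro div_less_dividend) auto
  then show pos: "0 < K - K div D" and "K - K div D < K" using q1 by simp_all
  have r: "real (K - ?q) = real K - ?q" using \<open>?q < K\<close> by (simp add: of_nat_diff)
  have "real (D * ?q) \<le> real K" by (simp only: of_nat_le_iff) (simp add: times_div_less_eq_dividend)
  then show "(real D - 1) * K \<le> D * real (K - ?q)" unfolding r by (simp add: algebra_simps)
  have "real (K - ?q) \<le> real K * (1 - 1 / (2 * real D))" using q2 unfolding r by (simp add: algebra_simps)
  also have "\<dots> \<le> real K * exp (- (1 / (2 * real D)))"
    using exp_ge_add_one_self[of "- (1 / (2 * real D))"] by (intro mult_left_mono) auto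
  finally have "ln (real (K - ?q)) \<le> ln (real K * exp (- (1 / (2 * real D))))"
    using pos by (intro ln_mono) auto
  also have "\<dots> = ln (real K) - 1 / (2 * real D)" using K D by (subst ln_mult) auto
  finally show "ln (real (K - ?q)) \<le> ln (real K) - 1 / (2 * real D)" .
qed

lemma vertex_potential_nonneg: "2 \<le> D \<Longrightarrow> 0 \<le> vertex_potential D c K"
proof (cases "(D - 1) * c < K")
  case True
  assume D: "2 \<le> D"
  have "real ((D - 1) * c) \<le> real K" using True by (simp only: of_nat_le_iff)
  then have "(real D - 1) * c \<le> K" using D by (simp add: of_nat_diff)
  then have "real c / real K \<le> 1 / (real D - 1)" using D True by (simp add: field_simps)
  also have "\<dots> = (real D - 1) / (real D - 1)\<^sup>2" using D by (simp add: power2_eq_square)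
  also have "\<dots> \<le> real D / (real D - 1)\<^sup>2" by (intro divide_right_mono) auto
  finally show ?thesis using D by (simp add: vertex_potential_def)
qed (simp add: vertex_potential_def)

text \<open>As \<open>K div D\<close> is at least \<open>K / (2 * D)\<close>, the share
  \<open>c / K\<close> is at most \<open>2 * D\<close> times its own increase to
  \<open>c / K'\<close>. The offset \<open>D / (D - 1)\<close> squared times \<open>D\<close> to the
  power -1 is an upper bound for \<open>c / K'\<close> after all factors are collected, so the
  estimate also covers the level after which the potential jumps to 0.\<close>

lemma vertex_potential_step:
  assumes D: "2 \<le> (D::nat)" and K: "D \<le> K" and c: "(D - 1) * c < K"
  shows "real c / real K \<le> vertex_potential D c K - vertex_potential D c (K - K div D)"
proof -
  define K' where "K' = K - K div D"
  note lev = level_decrease[OF D K, folded K'_def]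
  have Kp: "0 < real K" "0 < real K'" "real K' \<le> real K" using lev(3,4) K D by simp_all
  have r: "real K' = real K - K div D" unfolding K'_def by (simp add: of_nat_diff)
  have "real ((D - 1) * c) \<le> real K" using c by (simp only: of_nat_le_iff)
  then have c': "(real D - 1) * c \<le> K" using D by (simp add: of_nat_diff)
  have "1 / real K \<le> 1 / real K'" using Kp by (simp add: frac_le)
  also have "\<dots> = 2 * D * (real K / (2 * real D) / (K * K'))" using Kp D by (simp add: field_simps)
  also have "\<dots> \<le> 2 * D * (real (K div D) / (K * K'))"
    using lev(1) Kp by (intro mult_left_mono divide_right_mono) auto
  also have "real (K div D) / (K * K') = 1 / K' - 1 / K" using Kp r by (simp add: field_simps)
  finally have "c * (1 / K) \<le> c * (2 * real D * (1 / K' - 1 / K))" by (intro mult_left_mono) auto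
  then have main: "real c / real K \<le> 2 * real D * (real c / K' - real c / real K)" by (simp add: algebra_simps)
  have "c / K' \<le> real D / (real D - 1)\<^sup>2"
  proof -
    have "(real D - 1) * ((real D - 1) * c) \<le> (real D - 1) * K" using c' D by (intro mult_left_mono) auto
    also have "\<dots> \<le> D * real K'" using lev(2) .
    finally have "c * (real D - 1)\<^sup>2 \<le> D * real K'" by (simp only: power2_eq_square mult_ac)
    moreover have "0 < (real D - 1)\<^sup>2" using D by simp
    ultimately show ?thesis using Kp by (simp only: pos_divide_le_eq pos_le_divide_eq times_divide_eq_left)
  qed
  then have "2 * real D * (real c / K' - real c / real K) \<le> 2 * real D * (real D / (real D - 1)\<^sup>2 - real c / real K)" by (intro mult_left_mono) auto
  then show ?thesis
    using main c unfolding K'_def[symmetric] vertex_potential_def by (auto simp: algebra_simps)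
qed

section \<open>Sampling cost over all vertices\<close>

context graph
begin

text \<open>Bounds the draws at level \<open>K\<close> and all later ones. The first summand pays
  for rounding up, one draw per vertex and level; the second pays for the draws proportional to the
  degrees, with the factor 2 of \<open>sum_degree_le_sum_core\<close>.\<close>

definition potential :: "nat \<Rightarrow> nat \<Rightarrow> nat \<Rightarrow> real" where
  "potential D S K = real (card V) * (2 * real D * ln (real K) + 1) + 2 * real S * (real D + 1) * (\<Sum>v\<in>V. vertex_potential D (core v) K)"

lemma potential_nonneg: "2 \<le> D \<Longrightarrow> 1 \<le> K \<Longrightarrow> 0 \<le> potential D S K"
  unfolding potential_def by (intro add_nonneg_nonneg mult_nonneg_nonneg sum_nonneg vertex_potential_nonneg) auto

lemma potential_step:
  assumes D: "2 \<le> D" and K: "D \<le> K" and U: "U \<subseteq> {v \<in> V. (D - 1) * core v < K}"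
  shows "(\<Sum>v\<in>U. real (card (neighbors E v)) * (real S * (real D + 1) / real K) + 1) \<le> potential D S K - potential D S (K - K div D)"
proof -
  let ?K' = "K - K div D"
  let ?U = "{v \<in> V. (D - 1) * core v < K}"
  have fin: "finite ?U" "finite U" using finite_V finite_subset[OF U] by simp_all
  have "(\<Sum>v\<in>U. real (card (neighbors E v)) * (real S * (real D + 1) / real K) + 1) \<le> (\<Sum>v\<in>?U. real (card (neighbors E v)) * (real S * (real D + 1) / real K) + 1)"
    using U fin by (intro sum_mono2) auto
  also have "\<dots> = real (\<Sum>v\<in>?U. card (neighbors E v)) * (real S * (real D + 1) / real K) + card ?U"
    unfolding sum.distrib of_nat_sum sum_distrib_right by simp
  also have "\<dots> \<le> real (2 * (\<Sum>v\<in>?U. core v)) * (real S * (real D + 1) / real K) + card V"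
  proof (intro add_mono mult_right_mono)
    \<comment> \<open>The condition is rewritten as a strict upper bound on \<open>core v\<close>
      alone, the form that \<open>sum_degree_le_sum_core\<close> expects.\<close>
    have "?U = {v. v \<in> V \<and> core v < (K - 1) div (D - 1) + 1}"
      using D K by (auto simp: less_Suc_eq_le less_eq_div_iff_mult_less_eq mult.commute)
    then have "(\<Sum>v\<in>?U. card (neighbors E v)) \<le> 2 * (\<Sum>v\<in>?U. core v)"
      using sum_degree_le_sum_core[of "(K - 1) div (D - 1) + 1"] by simp
    then show "real (\<Sum>v\<in>?U. card (neighbors E v)) \<le> real (2 * (\<Sum>v\<in>?U. core v))" by (simp only: of_nat_le_iff)
    show "real (card ?U) \<le> real (card V)" using finite_V by (simp add: card_mono)
  qed auto
  also have "real (2 * (\<Sum>v\<in>?U. core v)) * (real S * (real D + 1) / real K) = 2 * real S * (real D + 1) * (\<Sum>v\<in>?U. real (core v) / real K)"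
    by (simp add: sum_divide_distrib[symmetric] mult_ac)
  also have "\<dots> \<le> 2 * real S * (real D + 1) * ((\<Sum>v\<in>V. vertex_potential D (core v) K) - (\<Sum>v\<in>V. vertex_potential D (core v) ?K'))"
  proof (intro mult_left_mono)
    have "(\<Sum>v\<in>?U. real (core v) / real K) \<le> (\<Sum>v\<in>?U. vertex_potential D (core v) K - vertex_potential D (core v) ?K')"
      using vertex_potential_step[OF D K] by (intro sum_mono) auto
    also have "\<dots> = (\<Sum>v\<in>V. vertex_potential D (core v) K - vertex_potential D (core v) ?K')"
      using finite_V by (intro sum.mono_neutral_left) (auto simp: vertex_potential_def)
    finally show "(\<Sum>v\<in>?U. real (core v) / real K) \<le> (\<Sum>v\<in>V. vertex_potential D (core v) K) - (\<Sum>v\<in>V. vertex_potential D (core v) ?K')"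
      by (simp add: sum_subtractf)
  qed auto
  also have "real (card V) \<le> real (card V) * (2 * real D * (ln (real K) - ln (real ?K')))"
  proof -
    have "1 = 2 * real D * (1 / (2 * real D))" using D by simp
    also have "\<dots> \<le> 2 * real D * (ln (real K) - ln (real ?K'))"
      using level_decrease(5)[OF D K] by (intro mult_left_mono) auto
    finally show ?thesis using mult_left_mono[of 1 "2 * real D * (ln (real K) - ln (real ?K'))" "real (card V)"] by simp
  qed
  finally show ?thesis unfolding potential_def by (simp add: algebra_simps)
qed

lemma potential_le:
  assumes D: "2 \<le> D"
  shows "potential D S K \<le> real (card V) * (2 * real D * ln (real K) + 1 + 16 * real S * (real D + 1))"
proof -
  \<comment> \<open>The offset contributes \<open>2 * D * D\<close> over the square of
    \<open>D - 1\<close>, which is largest at \<open>D = 2\<close>, where it is 8.\<close>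
  have "vertex_potential D c K \<le> 8" for c
  proof -
    have "real D \<le> 2 * (real D - 1)" using D by simp
    then have "real D * D \<le> (2 * (real D - 1)) * (2 * (real D - 1))" using D by (intro mult_mono) auto
    then have "2 * real D * (real D / (real D - 1)\<^sup>2) \<le> 8" using D by (simp add: field_simps power2_eq_square)
    moreover have "2 * real D * (real D / (real D - 1)\<^sup>2 - real c / real K) \<le> 2 * real D * (real D / (real D - 1)\<^sup>2)"
      by (intro mult_left_mono) auto
    ultimately show ?thesis by (auto simp: vertex_potential_def)
  qed
  then have "(\<Sum>v\<in>V. vertex_potential D (core v) K) \<le> real (card V) * 8"
    using sum_bounded_above[of V "\<lambda>v. vertex_potential D (core v) K" 8] by simp
  then have "2 * real S * (real D + 1) * (\<Sum>v\<in>V. vertex_potential D (core v) K) \<le> 2 * real S * (real D + 1) * (real (card V) * 8)"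
    by (intro mult_left_mono) auto
  then show ?thesis unfolding potential_def by (simp add: algebra_simps)
qed

end

section \<open>Core numbers from samples\<close>

definition sample_quota :: "nat \<Rightarrow> exp" where
  "sample_quota D = Div (Add (Mul (Mul (Var vDeg) (Var vThr)) (Const (D + 1))) (Sub (Var vLevel) (Const 1))) (Var vLevel)"

text \<open>Adding \<open>K - 1\<close> rounds the division up, so that rounding never lowers the
  expected number of hits.\<close>

definition quota :: "nat \<Rightarrow> nat \<Rightarrow> nat \<Rightarrow> nat \<Rightarrow> nat" where
  "quota D S K d = (d * S * (D + 1) + (K - 1)) div K"

text \<open>The common value of both tail bounds for \<delta> = 1 / \<open>D\<close>.\<close>

definition fail_prob :: "nat \<Rightarrow> nat \<Rightarrow> real" where
  "fail_prob D S = exp (- (real S / (16 * (real D)\<^sup>2)))"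

lemma quota_bounds:
  assumes "1 \<le> K"
  shows "real d * S * (real D + 1) \<le> real (quota D S K d) * K"
    and "real (quota D S K d) \<le> real d * (real S * (real D + 1) / real K) + 1"
    and "quota D S K d \<le> d * S * (D + 1) + K" and "quota D S K 0 = 0"
proof -
  let ?x = "d * S * (D + 1)"
  have "?x \<le> quota D S K d * K"
  proof -
    have "?x + (K - 1) < (quota D S K d + 1) * K"
      using assms dividend_less_div_times[of K "?x + (K - 1)"] unfolding quota_def by (simp add: algebra_simps)
    then show ?thesis using assms by simp
  qed
  then have "real ?x \<le> real (quota D S K d * K)" by (simp only: of_nat_le_iff)
  then show "real d * S * (real D + 1) \<le> real (quota D S K d) * K" by (simp add: algebra_simps)
  have "quota D S K d * K \<le> ?x + (K - 1)"
    unfolding quota_def by (rule div_times_less_eq_dividend)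
  then have "quota D S K d * K \<le> ?x + K" by simp
  then have "real (quota D S K d * K) \<le> real (?x + K)" by (simp only: of_nat_le_iff)
  then show "real (quota D S K d) \<le> real d * (real S * (real D + 1) / real K) + 1"
    using assms by (simp add: field_simps)
  show "quota D S K d \<le> ?x + K"
    unfolding quota_def by (rule order_trans[OF div_le_dividend]) simp
  show "quota D S K 0 = 0" using assms by (simp add: quota_def)
qed

context incident_ram
begin

definition core_set :: "nat \<Rightarrow> nat \<Rightarrow> nat set" where
  "core_set D K = {x. x < n \<and> K \<le> D * core x}"

text \<open>\<open>v\<close> itself is included so that all survivors lie in the set when
  \<open>v\<close> is the first bad one. The hits of \<open>v\<close> do not change, since
  \<open>v\<close> is not its own neighbor.\<close>

definition late_set :: "nat \<Rightarrow> nat set" where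
  "late_set v = {x. x = v \<or> rank v < rank x}"

text \<open>Vertices between the two bounds carry no obligation: at this level
  \<open>K / (D + 1)\<close> is an acceptable estimate for them, and so is leaving them
  unassigned.\<close>

definition good_sample :: "nat \<Rightarrow> nat \<Rightarrow> nat \<Rightarrow> nat \<Rightarrow> (nat set \<Rightarrow> nat) \<Rightarrow> bool" where
  "good_sample D S K v f \<longleftrightarrow> (K \<le> D * core v \<longrightarrow> S \<le> f (core_set D K)) \<and>
     (D * (D + 1) * core v < (D - 1) * K \<longrightarrow> f (late_set v) < S)"

definition moment :: "real \<Rightarrow> nat set \<Rightarrow> real \<Rightarrow> nat \<Rightarrow> nat \<Rightarrow> nat \<Rightarrow> (nat \<Rightarrow> nat) \<Rightarrow> ennreal" where
  "moment a X \<theta> T v i g = ennreal (exp (a * real (card {i'. i' < i \<and> g i' \<in> X})) *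
     (1 + real (card {k. k < deg v \<and> adj v ! k \<in> X}) / real (deg v) * (exp a - 1)) ^ (T - i) * \<theta>)"

text \<open>The two obligations of \<open>good_sample\<close> exclude each other, because
  \<open>K \<le> D * core v\<close> implies \<open>(D + 1) * K \<le> D * (D + 1) * core v\<close>.
  So one moment per vertex suffices, and 0 where nothing is required.\<close>

definition sample_moment :: "nat \<Rightarrow> nat \<Rightarrow> nat \<Rightarrow> nat \<Rightarrow> nat \<Rightarrow> (nat \<Rightarrow> nat) \<Rightarrow> ennreal" where
  "sample_moment D S K v i g =
     (if K \<le> D * core v
      then moment (- (1 / real D / 2)) (core_set D K) (exp (1 / real D / 2 * S)) (quota D S K (deg v)) v i g
      else if D * (D + 1) * core v < (D - 1) * K
      then moment (1 / real D / 4) (late_set v) (exp (- (1 / real D / 4 * S))) (quota D S K (deg v)) v i g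
      else 0)"

text \<open>The power is replaced by an exponential, so that the starting value takes the form to
  which the Chernoff exponents apply.\<close>

lemma moment_start:
  assumes v: "v < n" and \<theta>: "0 \<le> \<theta>"
    and b: "T * (card (neighbors E v \<inter> X) / deg v) * (exp a - 1) + ln \<theta>' \<le> b" and \<theta>': "\<theta> = \<theta>'" "0 < \<theta>'"
  shows "moment a X \<theta> T v 0 g \<le> ennreal (exp b)"
proof -
  define q where "q = card (neighbors E v \<inter> X) / real (deg v)"
  have q: "0 \<le> q" "q \<le> 1"
  proof -
    have "card (neighbors E v \<inter> X) \<le> deg v" unfolding deg_eq[OF v] by (intro card_mono) auto
    then show "q \<le> 1" by (simp add: q_def divide_le_eq)
  qed (simp add: q_def)
  have "-1 \<le> q * (exp a - 1)"
  proof -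
    have "-1 \<le> - q" using q by simp
    also have "- q = q * (0 - 1)" by simp
    also have "\<dots> \<le> q * (exp a - 1)" using q by (intro mult_left_mono) auto
    finally show ?thesis .
  qed
  then have "(1 + q * (exp a - 1)) ^ T \<le> exp (T * (q * (exp a - 1)))" by (rule power_one_plus_le_exp)
  then have "(1 + q * (exp a - 1)) ^ T * \<theta> \<le> exp (T * (q * (exp a - 1))) * \<theta>" using \<theta> by (rule mult_right_mono)
  also have "\<dots> = exp (T * q * (exp a - 1) + ln \<theta>')" using \<theta>' by (simp add: exp_add mult.assoc)
  also have "\<dots> \<le> exp b" using b by (simp add: q_def)
  finally show ?thesis unfolding moment_def card_adj[OF v] q_def[symmetric] by (simp add: ennreal_leI)
qed

lemma sample_moment_start:
  assumes D: "2 \<le> D" and S: "2 * D \<le> S" and K: "1 \<le> K" and v: "v < n"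
  shows "sample_moment D S K v 0 g \<le> ennreal (fail_prob D S)"
proof -
  define \<delta> where "\<delta> = 1 / real D"
  have \<delta>: "0 < \<delta>" "\<delta> \<le> 1" using D by (simp_all add: \<delta>_def)
  have fp: "fail_prob D S = exp (- real S * \<delta>\<^sup>2 / 16)" by (simp add: fail_prob_def \<delta>_def power_divide)
  define T where "T = quota D S K (deg v)"
  note qb = quota_bounds[OF K, where D = D and S = S]
  show ?thesis
  proof (cases "K \<le> D * core v")
    case True
    define x where "x = card (neighbors E v \<inter> core_set D K)"
    have "K \<le> D * x"
    proof -
      \<comment> \<open>\<open>c\<close> is \<open>K / D\<close> rounded up; it turns
        \<open>core_set\<close> into the set of core numbers at least \<open>c\<close>, where
        \<open>core_number_dense\<close> applies.\<close>
      define c where "c = (K + D - 1) div D"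
      have c: "K \<le> D * y \<longleftrightarrow> c \<le> y" for y
      proof -
        have "c \<le> y \<longleftrightarrow> (K + D - 1) div D < y + 1" by (simp add: c_def less_Suc_eq_le)
        also have "\<dots> \<longleftrightarrow> K + D - 1 < (y + 1) * D" using D by (simp add: div_less_iff_less_mult)
        also have "\<dots> \<longleftrightarrow> K \<le> D * y" using D K by (auto simp: algebra_simps)
        finally show ?thesis by simp
      qed
      have "core_set D K = {u \<in> {..<n}. c \<le> core u}" using c by (auto simp: core_set_def)
      then show ?thesis using core_number_dense[of v c] c True v by (simp add: x_def)
    qed
    then have Kx: "real K \<le> D * x" using of_nat_mono[of K "D * x", where 'a = real] by simp
    then have "x > 0" using K by (cases "x = 0") auto
    moreover have "x \<le> deg v" unfolding x_def deg_eq[OF v] by (intro card_mono) auto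
    ultimately have d: "0 < deg v" by simp
    \<comment> \<open>At least \<open>K / D\<close> neighbors lie in the set, and each expects at
      least \<open>S * (D + 1) / K\<close> hits.\<close>
    have "S * (1 + \<delta>) \<le> T * (x / deg v)"
    proof -
      have "S * (1 + \<delta>) = real S * (real D + 1) * (1 / real D)" using D by (simp add: \<delta>_def field_simps)
      also have "\<dots> \<le> real S * (real D + 1) * (x / K)"
        using Kx K D by (intro mult_left_mono) (auto simp: field_simps)
      also have "\<dots> = (real (deg v) * S * (real D + 1)) * (x / (deg v * K))" using d K by (simp add: field_simps)
      also have "\<dots> \<le> (real T * real K) * (x / (deg v * K))" unfolding T_def by (rule mult_right_mono[OF qb(1)]) simp
      also have "\<dots> = T * (x / deg v)" using K by simp
      finally show ?thesis .
    qed
    then have "T * (x / deg v) * (exp (- (\<delta> / 2)) - 1) + \<delta> / 2 * S \<le> - real S * \<delta>\<^sup>2 / 16"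
      using \<delta> by (intro chernoff_lower_exponent) auto
    then have "moment (- (\<delta> / 2)) (core_set D K) (exp (\<delta> / 2 * S)) T v 0 g \<le> ennreal (fail_prob D S)"
      unfolding fp by (intro moment_start[OF v, where \<theta>' = "exp (\<delta> / 2 * S)"]) (auto simp: x_def)
    then show ?thesis using True by (simp add: sample_moment_def \<delta>_def T_def)
  next
    case False
    show ?thesis
    proof (cases "D * (D + 1) * core v < (D - 1) * K")
      case True
      define x where "x = card (neighbors E v \<inter> late_set v)"
      have "neighbors E v \<inter> late_set v = neighbors E v \<inter> {w. rank v < rank w}"
        using neighbors_irrefl[of v] by (auto simp: late_set_def)
      then have xc: "x \<le> core v" using card_later[of v] v by (simp add: x_def)
      have "D * (D + 1) * x \<le> D * (D + 1) * core v" using xc by (rule mult_le_mono2)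
      then have "D * (D + 1) * x \<le> (D - 1) * K" using True by linarith
      then have "real (D * (D + 1) * x) \<le> real ((D - 1) * K)" by (simp only: of_nat_le_iff)
      then have xK: "real D * (real D + 1) * x \<le> (real D - 1) * K" using D by (simp add: of_nat_diff algebra_simps)
      have q1: "x / real (deg v) \<le> 1"
      proof -
        have "x \<le> deg v" unfolding x_def deg_eq[OF v] by (intro card_mono) auto
        then show ?thesis by (simp add: divide_le_eq)
      qed
      \<comment> \<open>At most \<open>core v\<close> neighbors come later, which gives
        \<open>S * (1 - \<delta>)\<close> expected hits. Rounding up adds at most one more, and
        \<open>S \<ge> 2 * D\<close> lets half of the gap absorb it.\<close>
      have "T * (x / real (deg v)) \<le> S * (1 - \<delta> / 2)"
      proof -
        have "T * (x / real (deg v)) \<le> (real (deg v) * (real S * (real D + 1) / real K) + 1) * (x / real (deg v))"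
          unfolding T_def by (intro mult_right_mono qb) auto
        also have "\<dots> = real (deg v) * (x / real (deg v)) * (real S * (real D + 1) / real K) + x / real (deg v)"
          by (simp add: algebra_simps)
        also have "\<dots> \<le> x * (real S * (real D + 1) / real K) + 1"
        proof (intro add_mono q1 mult_right_mono)
          show "real (deg v) * (x / real (deg v)) \<le> x" by (cases "deg v = 0") auto
        qed auto
        also have "x * (real S * (real D + 1) / real K) \<le> S * (1 - \<delta>)"
        proof -
          have "x * (real D + 1) / K \<le> 1 - \<delta>" using xK K D by (simp add: \<delta>_def field_simps)
          then have "S * (x * (real D + 1) / K) \<le> S * (1 - \<delta>)" by (intro mult_left_mono) auto
          then show ?thesis by (simp add: mult_ac)
        qed
        also have "S * (1 - \<delta>) + 1 \<le> S * (1 - \<delta> / 2)"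
        proof -
          have "real (2 * D) \<le> real S" using S by (simp only: of_nat_le_iff)
          then have "1 \<le> S * (\<delta> / 2)" using D by (simp add: \<delta>_def field_simps)
          then show ?thesis by (simp add: algebra_simps)
        qed
        finally show ?thesis by simp
      qed
      then have "T * (x / deg v) * (exp (\<delta> / 4) - 1) - \<delta> / 4 * S \<le> - real S * \<delta>\<^sup>2 / 16"
        using \<delta> by (intro chernoff_upper_exponent) auto
      then have "moment (\<delta> / 4) (late_set v) (exp (- (\<delta> / 4 * S))) T v 0 g \<le> ennreal (fail_prob D S)"
        unfolding fp by (intro moment_start[OF v, where \<theta>' = "exp (- (\<delta> / 4 * S))"]) (auto simp: x_def)
      then show ?thesis using True False by (simp add: sample_moment_def \<delta>_def T_def)
    qed (use False in \<open>simp add: sample_moment_def\<close>)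
  qed
qed

text \<open>After \<open>T\<close> draws the power is 1, and a bad outcome makes the remaining
  exponent nonnegative, by the sign of the tilt.\<close>

lemma sample_moment_end:
  assumes D: "2 \<le> D" and bad: "\<not> good_sample D S K v (\<lambda>X. card {i. i < T \<and> g i \<in> X})" and T: "T = quota D S K (deg v)"
  shows "1 \<le> sample_moment D S K v T g"
proof (cases "K \<le> D * core v")
  case True
  have "(D - 1) * K \<le> (D + 1) * (D * core v)" using True by (intro mult_le_mono) auto
  moreover have "(D + 1) * (D * core v) = D * (D + 1) * core v" by (simp only: mult_ac)
  ultimately have "\<not> D * (D + 1) * core v < (D - 1) * K" by linarith
  then have "card {i. i < T \<and> g i \<in> core_set D K} < S" using bad True by (auto simp: good_sample_def)
  then have "0 \<le> (1 / real D / 2) * (real S - card {i. i < T \<and> g i \<in> core_set D K})" by (intro mult_nonneg_nonneg) auto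
  then have "1 \<le> exp (- (1 / real D / 2) * card {i. i < T \<and> g i \<in> core_set D K}) * exp (1 / real D / 2 * S)"
    unfolding exp_add[symmetric] one_le_exp_iff by (simp add: algebra_simps)
  then have "ennreal 1 \<le> ennreal (exp (- (1 / real D / 2) * card {i. i < T \<and> g i \<in> core_set D K}) * exp (1 / real D / 2 * S))"
    by (rule ennreal_leI)
  then show ?thesis using True T by (simp add: sample_moment_def moment_def)
next
  case False
  then have lt: "D * (D + 1) * core v < (D - 1) * K" and "S \<le> card {i. i < T \<and> g i \<in> late_set v}"
    using bad by (auto simp: good_sample_def)
  then have "0 \<le> (1 / real D / 4) * (card {i. i < T \<and> g i \<in> late_set v} - real S)" by (intro mult_nonneg_nonneg) auto
  then have "1 \<le> exp (1 / real D / 4 * card {i. i < T \<and> g i \<in> late_set v}) * exp (- (1 / real D / 4 * S))"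
    unfolding exp_add[symmetric] one_le_exp_iff by (simp add: algebra_simps)
  then have "ennreal 1 \<le> ennreal (exp (1 / real D / 4 * card {i. i < T \<and> g i \<in> late_set v}) * exp (- (1 / real D / 4 * S)))"
    by (rule ennreal_leI)
  then show ?thesis using False T lt by (simp add: sample_moment_def moment_def)
qed

lemma sample_moment_step:
  assumes v: "v < n" and i: "i < quota D S K (deg v)" and K: "1 \<le> K"
  shows "(\<integral>\<^sup>+k. sample_moment D S K v (Suc i) (g(i := adj v ! k)) \<partial>measure_pmf (pmf_of_set {..<max 1 (deg v)}))
    \<le> sample_moment D S K v i g"
proof -
  have d: "0 < deg v"
  proof (rule ccontr)
    assume "\<not> 0 < deg v"
    then show False using i quota_bounds(4)[OF K, of D S] by simp
  qed
  then have max: "max 1 (deg v) = deg v" by simp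
  have "(\<integral>\<^sup>+k. moment a X \<theta> (quota D S K (deg v)) v (Suc i) (g(i := adj v ! k)) \<partial>measure_pmf (pmf_of_set {..<deg v}))
      = moment a X \<theta> (quota D S K (deg v)) v i g" if "0 \<le> \<theta>" for a X \<theta>
    unfolding moment_def by (rule exp_moment_step[OF d refl i that])
  then show ?thesis unfolding max by (simp add: sample_moment_def)
qed

text \<open>\<open>max 1 d\<close> is the range of \<open>Random\<close> in the semantics. It
  differs from the degree only for isolated vertices, whose quota is 0. The hypotheses on
  \<open>w\<close> exclude wrap-around while the quota is evaluated.\<close>

lemma sampler_random:
  assumes D: "2 \<le> D" and S: "2 * D \<le> S" and K: "1 \<le> K" and w: "B + n * S * (D + 1) + K < 2 ^ w" and Dw: "D + 1 < 2 ^ w"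
  shows "sampler w n adj E (Random vPos (Var vDeg)) (sample_quota D) (\<lambda>i d. pmf_of_set {..<max 1 d}) (quota D S K)
    (good_sample D S K) (sample_moment D S K) (ennreal (fail_prob D S)) K S B"
proof unfold_locales
  fix t :: nat and s and f :: "nat \<Rightarrow> store \<Rightarrow> ennreal" assume "0 < t"
  then show "mean t (Random vPos (Var vDeg)) s f =
      (\<integral>\<^sup>+k. f (t - 1) (set_var vPos k s) \<partial>measure_pmf (pmf_of_set {..<max 1 (var s vDeg)}))"
    by (subst mean_Random) auto
next
  fix v i assume "v < n" "i < quota D S K (deg v)"
  then have "deg v \<noteq> 0" using quota_bounds(4)[OF K, of D S] by (metis not_less_zero)
  then have "max 1 (deg v) = deg v" by simp
  then show "set_pmf (pmf_of_set {..<max 1 (deg v)}) \<subseteq> {..<deg v}"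
    using \<open>deg v \<noteq> 0\<close> by (subst set_pmf_of_set) auto
next
  fix s :: store assume s: "var s vLevel = K" "var s vThr = S" "var s vDeg < n"
  let ?d = "var s vDeg"
  have le: "?d * S * (D + 1) \<le> n * S * (D + 1)" using s by (intro mult_le_mono1) auto
  have m1: "?d * S mod 2 ^ w = ?d * S"
  proof (intro mod_less)
    have "?d * S \<le> ?d * S * (D + 1)" by simp
    then show "?d * S < 2 ^ w" using w le by linarith
  qed
  have m2: "(?d * S) * (D + 1) mod 2 ^ w = ?d * S * (D + 1)"
    using w le by (intro mod_less) linarith
  have m3: "(?d * S * (D + 1) + (K - 1)) mod 2 ^ w = ?d * S * (D + 1) + (K - 1)"
    using w le by (intro mod_less) linarith
  have m4: "(D + 1) mod 2 ^ w = D + 1" using Dw by (intro mod_less)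
  have m5: "(1::nat) mod 2 ^ w = 1" using w_pos by simp
  show "eval_exp w (sample_quota D) s = quota D S K ?d"
    unfolding sample_quota_def eval_exp.simps s m4 m5 m1 m2 m3 quota_def ..
next
  fix v i :: nat and g :: "nat \<Rightarrow> nat" assume "v < n" "i < quota D S K (deg v)"
  then show "(\<integral>\<^sup>+k. sample_moment D S K v (Suc i) (g(i := adj v ! k)) \<partial>measure_pmf (pmf_of_set {..<max 1 (deg v)}))
    \<le> sample_moment D S K v i g" by (rule sample_moment_step) (rule K)
next
  fix v and g :: "nat \<Rightarrow> nat" assume "v < n"
  then show "sample_moment D S K v 0 g \<le> ennreal (fail_prob D S)" by (intro sample_moment_start D S K)
next
  fix v and g :: "nat \<Rightarrow> nat"
  assume "\<not> good_sample D S K v (\<lambda>X. card {i. i < quota D S K (deg v) \<and> g i \<in> X})"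
  then show "1 \<le> sample_moment D S K v (quota D S K (deg v)) g" by (rule sample_moment_end[OF D]) (rule refl)
next
  fix v assume v: "v < n"
  have "deg v * S * (D + 1) \<le> n * S * (D + 1)" using deg_less[OF v] by (intro mult_le_mono1) auto
  then show "B + quota D S K (deg v) < 2 ^ w" using quota_bounds(3)[OF K, of D S "deg v"] w by linarith
qed auto

end

section \<open>One level of the sampling algorithm\<close>

definition sampled_round :: "nat \<Rightarrow> com" where
  "sampled_round D =
     build (sample_quota D) (Random vPos (Var vDeg)) ;;
     peel ;;
     scan 1 (D + 1) ;;
     Assign vLevel (Sub (Var vLevel) (Div (Var vLevel) (Const D)))"

text \<open>The first level exceeds \<open>(D - 1) * core v\<close> for every vertex. When the loop
  ends, \<open>K < D\<close>, and an unassigned vertex with \<open>(D - 1) * core v < K\<close> has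
  core number 0; the initial fraction 0/1 is then the right output.\<close>

definition sampled :: "nat \<Rightarrow> nat \<Rightarrow> nat \<Rightarrow> com" where
  "sampled D a b =
     Assign vThr (Mul (Const a) (Add (Var vLog) (Const 1))) ;;
     Assign vLevel (Mul (Const (D + 1)) (Var vN)) ;;
     Assign vBudget (Mul (Const b) (Mul (Var vN) (Add (Var vLog) (Const 1)))) ;;
     While (Less (Const (D - 1)) (Var vLevel)) (sampled_round D)"

context incident_ram
begin

text \<open>Both conclusions compare the surviving set with a fixed set: the vertices of large core
  number keep enough samples among themselves, and a surviving vertex of small core number
  that comes first in the degeneracy order has all its surviving samples after itself.\<close>

lemma peel_good:
  assumes D: "2 \<le> D" and A: "A \<subseteq> {..<n}" and good: "\<And>v. v \<in> A \<Longrightarrow> good_sample D S K v (h v)"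
    and h: "\<And>v X Y. X \<subseteq> Y \<Longrightarrow> h v X \<le> h v Y"
    and closed: "\<And>v. v \<in> A \<Longrightarrow> v \<in> alive \<Longrightarrow> S \<le> h v alive"
    and greatest: "\<And>Y. Y \<subseteq> {..<n} \<Longrightarrow> (\<And>v. v \<in> Y \<inter> A \<Longrightarrow> S \<le> h v Y) \<Longrightarrow> Y \<subseteq> alive"
    and alive: "alive \<subseteq> {..<n}"
    and prev: "\<And>x. x < n \<Longrightarrow> x \<notin> A \<Longrightarrow> (D - 1) * K \<le> D * (D + 1) * core x"
  shows "core_set D K \<subseteq> alive" and "\<And>x. x \<in> alive \<Longrightarrow> (D - 1) * K \<le> D * (D + 1) * core x"
proof -
  show "core_set D K \<subseteq> alive"
    by (rule greatest) (use good in \<open>auto simp: core_set_def good_sample_def\<close>)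
  show "(D - 1) * K \<le> D * (D + 1) * core x" if "x \<in> alive" for x
  proof (rule ccontr)
    define Bad where "Bad = {x \<in> alive. D * (D + 1) * core x < (D - 1) * K}"
    assume "\<not> ?thesis"
    then have ne: "Bad \<noteq> {}" using that by (auto simp: Bad_def)
    have fin: "finite Bad" using alive finite_subset by (fastforce simp: Bad_def)
    define v where "v = arg_min_on rank Bad"
    have v: "v \<in> Bad" "\<And>y. y \<in> Bad \<Longrightarrow> rank v \<le> rank y"
      using arg_min_if_finite[OF fin ne, of rank] by (auto simp: v_def not_less)
    have vn: "v < n" using v(1) alive by (auto simp: Bad_def)
    have vA: "v \<in> A" using prev[OF vn] v(1) by (fastforce simp: Bad_def)
    have "alive \<subseteq> late_set v"
    proof
      fix y assume y: "y \<in> alive"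
      then have yn: "y < n" using alive by auto
      show "y \<in> late_set v"
      proof (cases "y \<in> Bad")
        case True
        then show ?thesis using v(2)[of y] inj_rank yn vn by (auto simp: late_set_def inj_on_def le_less)
      next
        case False
        then have "(D - 1) * K \<le> D * (D + 1) * core y" using y by (auto simp: Bad_def)
        moreover have "D * (D + 1) * core v < (D - 1) * K" using v(1) unfolding Bad_def by blast
        ultimately have "D * (D + 1) * core v < D * (D + 1) * core y" by linarith
        then have "core v < core y" by (rule mult_less_cancel1[THEN iffD1, THEN conjunct2])
        then show ?thesis using rank_mono[of v y] yn vn by (simp add: late_set_def)
      qed
    qed
    then have "h v alive \<le> h v (late_set v)" by (rule h)
    moreover have "S \<le> h v alive" using closed[OF vA] v(1) by (simp add: Bad_def)
    moreover have "h v (late_set v) < S" using good[OF vA] v(1) by (simp add: good_sample_def Bad_def)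
    ultimately show False by linarith
  qed
qed

lemma hits_mono: "X \<subseteq> Y \<Longrightarrow> hits s lo v X \<le> hits s lo v Y"
  unfolding hits_def by (rule card_mono) (auto intro: finite_subset[of _ "{..<var s vNode}"])

text \<open>The witness \<open>alive\<close> also contains all vertices outside \<open>A\<close>,
  those assigned at previous levels. The last two clauses state that it is closed and greatest, as
  \<open>peel_good\<close> requires.\<close>

lemma sure_peel_scan:
  assumes D: "2 \<le> D" and DW: "D + 1 < 2 ^ w" and K: "D \<le> K"
    and lk: "linked n s lo" and lo: "1 \<le> lo" "lo \<le> var s vNode"
    and m: "var s vLen = m" "m \<le> n" and f: "inj_on f {..<m}" "arr s aList = f" "f ` {..<m} = A" "A \<subseteq> {..<n}"
    and who: "\<And>j. lo \<le> j \<Longrightarrow> j < var s vNode \<Longrightarrow> arr s aWho j \<in> A"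
    and dead: "\<And>x. arr s aDead x = 0"
    and cnt: "\<And>x. x \<in> A \<Longrightarrow> arr s aCnt x = hits s lo x UNIV"
    and lev: "var s vLevel = K" "var s vThr = S"
    and w: "n + var s vNode < 2 ^ w"
    and t: "38 * n + 24 * (var s vNode - lo) + 22 \<le> t"
  shows "sure t (peel ;; scan 1 (D + 1) ;; Assign vLevel (Sub (Var vLevel) (Div (Var vLevel) (Const D)))) s
    (\<lambda>r s'. t \<le> r + 38 * n + 24 * (var s vNode - lo) + 22 \<and> var s' vLen \<le> m \<and> inj_on (arr s' aList) {..<var s' vLen} \<and>
      (\<forall>x. arr s' aDead x = 0) \<and> var s' vLevel = K - K div D \<and>
      (\<exists>alive. alive \<subseteq> {..<n} \<and> arr s' aList ` {..<var s' vLen} = A - alive \<and>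
        (\<forall>x. arr s' aNum x = (if x \<in> A \<inter> alive then K else arr s aNum x)) \<and>
        (\<forall>x. arr s' aDen x = (if x \<in> A \<inter> alive then D + 1 else arr s aDen x)) \<and>
        (\<forall>x\<in>A \<inter> alive. S \<le> hits s lo x alive) \<and>
        (\<forall>Y. Y \<subseteq> {..<n} \<longrightarrow> (\<forall>x\<in>Y \<inter> A. S \<le> hits s lo x Y) \<longrightarrow> Y \<subseteq> alive)))"
    (is "sure t _ s ?post")
proof -
  define N where "N = var s vNode - lo"
  have live: "live s lo = {lo..<var s vNode}" by (auto simp: live_def dead)
  have cl: "card (live s lo) = N" by (simp add: live N_def)
  have t1: "18 * m + 24 * card (live s lo) + 8 \<le> t" using t m cl by (simp add: N_def)
  have "sure t peel s (\<lambda>r s'.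
    t + 24 * card (live s' lo) \<le> r + 18 * m + 24 * card (live s lo) + 8 \<and>
    (\<forall>x\<in>A. arr s' aDead x = 0 \<longrightarrow> var s vThr \<le> card {j \<in> live s' lo. arr s aWho j = x}) \<and>
    (\<forall>x. arr s' aDead x = arr s aDead x \<or> x \<in> A \<and> arr s aDead x = 0 \<and> arr s' aDead x = 1) \<and>
    (\<forall>x\<in>A. arr s' aCnt x = card {j \<in> live s' lo. arr s aWho j = x}) \<and>
    (\<forall>Y. (\<forall>x\<in>Y. arr s aDead x = 0) \<longrightarrow> (\<forall>x\<in>Y \<inter> A. var s vThr \<le> hits s lo x Y) \<longrightarrow>
      (\<forall>x\<in>Y. arr s' aDead x = 0)))"
  proof (rule sure_peel)
    show "arr s aCnt x = card {j \<in> live s lo. arr s aWho j = x}" if "x \<in> A" for x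
    proof -
      have "{j \<in> live s lo. arr s aWho j = x} = {j. lo \<le> j \<and> j < var s vNode \<and> arr s aWho j = x \<and> arr s aTgt j \<in> UNIV}"
        by (auto simp: live)
      then show ?thesis using cnt[OF that] by (simp add: hits_def)
    qed
    show "m + card (live s lo) < 2 ^ w" using w m by (simp add: cl N_def)
    show "arr s aList i \<in> A" if "i < m" for i using f that by auto
    show "x \<in> arr s aList ` {..<m}" if "x \<in> A" for x using f that by auto
  qed (use lk lo who f m t1 in auto)
  then have "sure t peel s (\<lambda>r s'. 0 < r \<and> sure (r - 1) (scan 1 (D + 1)) s' (\<lambda>r s'. 0 < r \<and> 0 < r - 1 \<and>
      ?post (r - 1 - 1) (set_var vLevel (eval_exp w (Sub (Var vLevel) (Div (Var vLevel) (Const D))) s') s')))"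
  proof (rule sure_mono)
    fix r s1 assume ag: "agree peel s s1" and P: "t + 24 * card (live s1 lo) \<le> r + 18 * m + 24 * card (live s lo) + 8 \<and>
    (\<forall>x\<in>A. arr s1 aDead x = 0 \<longrightarrow> var s vThr \<le> card {j \<in> live s1 lo. arr s aWho j = x}) \<and>
    (\<forall>x. arr s1 aDead x = arr s aDead x \<or> x \<in> A \<and> arr s aDead x = 0 \<and> arr s1 aDead x = 1) \<and>
    (\<forall>x\<in>A. arr s1 aCnt x = card {j \<in> live s1 lo. arr s aWho j = x}) \<and>
    (\<forall>Y. (\<forall>x\<in>Y. arr s aDead x = 0) \<longrightarrow> (\<forall>x\<in>Y \<inter> A. var s vThr \<le> hits s lo x Y) \<longrightarrow>
      (\<forall>x\<in>Y. arr s1 aDead x = 0))"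
    have s1: "var s1 vNode = var s vNode" "var s1 vLen = m" "var s1 vLevel = K" "arr s1 aList = f"
      "arr s1 aNum = arr s aNum" "arr s1 aDen = arr s aDen" "arr s1 aTgt = arr s aTgt"
      using agree_var[OF ag] agree_arr[OF ag] m lev f
      by (simp_all add: peel_def pop_vertex_def kill_vertex_def visit_node_def)
    have P1: "t \<le> r + 18 * m + 24 * N + 8" using conjunct1[OF P] cl by linarith
    note P' = conjunct2[OF P]
    have Pclosed: "S \<le> card {j \<in> live s1 lo. arr s aWho j = x}" if "x \<in> A" "arr s1 aDead x = 0" for x
      using conjunct1[OF P'] that lev by blast
    have Pdead: "arr s1 aDead x = 0 \<or> x \<in> A \<and> arr s1 aDead x = 1" for x
      using conjunct1[OF conjunct2[OF P']] dead by metis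
    have Pmax: "arr s1 aDead x = 0" if "\<And>x. x \<in> Y \<inter> A \<Longrightarrow> S \<le> hits s lo x Y" "x \<in> Y" for x Y
    proof -
      have "\<forall>x\<in>Y. arr s1 aDead x = 0"
        using conjunct2[OF conjunct2[OF conjunct2[OF P']], THEN spec[of _ Y]] that(1) dead lev by simp
      then show ?thesis using that(2) by blast
    qed
    define alive where "alive = {x. x < n \<and> arr s1 aDead x = 0}"
    have closed: "S \<le> hits s lo x alive" if "x \<in> A \<inter> alive" for x
    proof -
      have "{j \<in> live s1 lo. arr s aWho j = x} =
          {j. lo \<le> j \<and> j < var s vNode \<and> arr s aWho j = x \<and> arr s aTgt j \<in> alive}"
        using lk by (auto simp: live_def s1 alive_def linked_def)
      then show ?thesis using Pclosed[of x] that by (simp add: hits_def alive_def)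
    qed
    have max: "Y \<subseteq> alive" if "Y \<subseteq> {..<n}" "\<forall>x\<in>Y \<inter> A. S \<le> hits s lo x Y" for Y
      using that Pmax[of Y] by (auto simp: alive_def)
    have r: "20 * m + 9 \<le> r - 1" "20 * m + 14 \<le> r" using P1 t m unfolding N_def by linarith+
    have "sure (r - 1) (scan 1 (D + 1)) s1 (\<lambda>r1 s'. r - 1 \<le> r1 + 20 * m + 9 \<and> var s' vLen \<le> m \<and>
      inj_on (arr s' aList) {..<var s' vLen} \<and>
      arr s' aList ` {..<var s' vLen} = {x \<in> f ` {..<m}. arr s1 aDead x = 1} \<and>
      (\<forall>x. arr s' aDead x = (if x \<in> f ` {..<m} \<and> arr s1 aDead x = 1 then 0 else arr s1 aDead x)) \<and>
      (\<forall>x. arr s' aNum x = (if x \<in> f ` {..<m} \<and> arr s1 aDead x = 0 then K else arr s aNum x)) \<and>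
      (\<forall>x. arr s' aDen x = (if x \<in> f ` {..<m} \<and> arr s1 aDead x = 0 then D + 1 else arr s aDen x)))"
      by (rule sure_scan[of s1 m f 1 "D + 1" "r - 1", unfolded s1]) (use m f DW r in auto)
    then have "sure (r - 1) (scan 1 (D + 1)) s1 (\<lambda>r s'. 0 < r \<and> 0 < r - 1 \<and>
      ?post (r - 1 - 1) (set_var vLevel (eval_exp w (Sub (Var vLevel) (Div (Var vLevel) (Const D))) s') s'))"
    proof (rule sure_mono)
      fix r1 s' assume ag2: "agree (scan 1 (D + 1)) s1 s'" and Q: "r - 1 \<le> r1 + 20 * m + 9 \<and> var s' vLen \<le> m \<and>
      inj_on (arr s' aList) {..<var s' vLen} \<and>
      arr s' aList ` {..<var s' vLen} = {x \<in> f ` {..<m}. arr s1 aDead x = 1} \<and>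
      (\<forall>x. arr s' aDead x = (if x \<in> f ` {..<m} \<and> arr s1 aDead x = 1 then 0 else arr s1 aDead x)) \<and>
      (\<forall>x. arr s' aNum x = (if x \<in> f ` {..<m} \<and> arr s1 aDead x = 0 then K else arr s aNum x)) \<and>
      (\<forall>x. arr s' aDen x = (if x \<in> f ` {..<m} \<and> arr s1 aDead x = 0 then D + 1 else arr s aDen x))"
      have Q0: "r - 1 \<le> r1 + 20 * m + 9" and Qm: "var s' vLen \<le> m" and Qinj: "inj_on (arr s' aList) {..<var s' vLen}"
        and Qimg: "arr s' aList ` {..<var s' vLen} = {x \<in> f ` {..<m}. arr s1 aDead x = 1}"
        and Qdead: "\<forall>x. arr s' aDead x = (if x \<in> f ` {..<m} \<and> arr s1 aDead x = 1 then 0 else arr s1 aDead x)"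
        and Qnum: "\<forall>x. arr s' aNum x = (if x \<in> f ` {..<m} \<and> arr s1 aDead x = 0 then K else arr s aNum x)"
        and Qden: "\<forall>x. arr s' aDen x = (if x \<in> f ` {..<m} \<and> arr s1 aDead x = 0 then D + 1 else arr s aDen x)"
        using Q by - (elim conjE, assumption)+
      have lev': "var s' vLevel = K" using agree_var[OF ag2] s1 by (simp add: scan_def scan_vertex_def)
      have ev: "eval_exp w (Sub (Var vLevel) (Div (Var vLevel) (Const D))) s' = K - K div D"
        using DW lev' by simp
      define s2 where "s2 = set_var vLevel (K - K div D) s'"
      have s2: "arr s2 = arr s'" "var s2 vLen = var s' vLen" "var s2 vLevel = K - K div D" by (simp_all add: s2_def)
      have r1: "3 \<le> r1" using Q0 r by linarith
      have aliveA: "x \<in> A \<inter> alive \<longleftrightarrow> x \<in> A \<and> arr s1 aDead x = 0" for x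
        using f(4) by (auto simp: alive_def)
      have "?post (r1 - 1 - 1) s2"
        unfolding s2
      proof (intro conjI exI[of _ alive])
        show "t \<le> r1 - 1 - 1 + 38 * n + 24 * (var s vNode - lo) + 22"
          using P1 Q0 r1 m r unfolding N_def by linarith
        show "arr s' aList ` {..<var s' vLen} = A - alive"
          unfolding Qimg f(3)
        proof (intro set_eqI)
          fix x
          show "x \<in> {x \<in> A. arr s1 aDead x = 1} \<longleftrightarrow> x \<in> A - alive"
            using aliveA[of x] Pdead[of x] by auto
        qed
        show "\<forall>x. arr s' aDead x = 0"
        proof
          fix x show "arr s' aDead x = 0"
            using Qdead[rule_format, of x] Pdead[of x] unfolding f(3) by auto
        qed
        show "\<forall>x. arr s' aNum x = (if x \<in> A \<inter> alive then K else arr s aNum x)"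
          using Qnum unfolding f(3) aliveA .
        show "\<forall>x. arr s' aDen x = (if x \<in> A \<inter> alive then D + 1 else arr s aDen x)"
          using Qden unfolding f(3) aliveA .
        show "\<forall>x\<in>A \<inter> alive. S \<le> hits s lo x alive" using closed by blast
        show "\<forall>Y. Y \<subseteq> {..<n} \<longrightarrow> (\<forall>x\<in>Y \<inter> A. S \<le> hits s lo x Y) \<longrightarrow> Y \<subseteq> alive" using max by blast
        show "alive \<subseteq> {..<n}" by (auto simp: alive_def)
      qed (rule Qm Qinj refl)+
      moreover have "0 < r1" "0 < r1 - 1" using r1 by simp_all
      ultimately show "0 < r1 \<and> 0 < r1 - 1 \<and>
        ?post (r1 - 1 - 1) (set_var vLevel (eval_exp w (Sub (Var vLevel) (Div (Var vLevel) (Const D))) s') s')"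
        unfolding ev s2_def[symmetric] by blast
    qed
    moreover have "0 < r" using r by simp
    ultimately show "0 < r \<and> sure (r - 1) (scan 1 (D + 1)) s1 (\<lambda>r s'. 0 < r \<and> 0 < r - 1 \<and>
      ?post (r - 1 - 1) (set_var vLevel (eval_exp w (Sub (Var vLevel) (Div (Var vLevel) (Const D))) s') s'))" by blast
  qed
  then show ?thesis unfolding sure_Seq sure_Assign .
qed

end

section \<open>Rounds and the loop over the levels\<close>

definition level_bound :: "nat \<Rightarrow> nat \<Rightarrow> nat" where
  "level_bound D K = nat \<lfloor>2 * real D * ln (real K)\<rfloor> + 1"

lemma level_bound_step:
  assumes "2 \<le> D" "D \<le> K"
  shows "level_bound D (K - K div D) + 1 \<le> level_bound D K"
proof -
  note lev = level_decrease[OF assms]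
  have "2 * real D * ln (real (K - K div D)) \<le> 2 * real D * (ln (real K) - 1 / (2 * real D))"
    using lev(5) assms by (intro mult_left_mono) auto
  also have "\<dots> = 2 * real D * ln (real K) - 1" using assms by (simp add: right_diff_distrib)
  finally have "\<lfloor>2 * real D * ln (real (K - K div D))\<rfloor> \<le> \<lfloor>2 * real D * ln (real K) - 1\<rfloor>" by (rule floor_mono)
  then have "\<lfloor>2 * real D * ln (real (K - K div D))\<rfloor> + 1 \<le> \<lfloor>2 * real D * ln (real K)\<rfloor>" by simp
  moreover have "0 \<le> 2 * real D * ln (real (K - K div D))"
    using lev(3) by (intro mult_nonneg_nonneg ln_ge_zero) linarith+
  then have "0 \<le> \<lfloor>2 * real D * ln (real (K - K div D))\<rfloor>" by simp
  ultimately show ?thesis unfolding level_bound_def by linarith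
qed

context incident_ram
begin

text \<open>What stands in the condition holds in every run; what stands in \<open>of_bool\<close>
  holds unless a sample is bad, and only if \<open>nc\<close>. The costs add up from building and
  from peeling with scanning: 61 = 23 + 38 per vertex and 41 = 17 + 24 per sample.\<close>

lemma mean_sampled_round:
  fixes nc :: bool
  assumes D: "2 \<le> D" and S: "2 * D \<le> S" and K: "D \<le> K"
    and w: "B + n * S * (D + 1) + K < 2 ^ w" "D + 1 < 2 ^ w" "B + n < 2 ^ w"
    and s: "var s vN = n" "var s vLen = m" "m \<le> n" "var s vLevel = K" "var s vThr = S" "var s vBudget = B"
      "var s vNode = lo" "lo \<le> B" "1 \<le> lo" "arr s aList = f" "\<And>x. arr s aDead x = 0"
    and f: "inj_on f {..<m}" "f ` {..<m} = A" "A \<subseteq> {..<n}"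
    and nc: "nc \<Longrightarrow> lo + (\<Sum>x\<in>A. quota D S K (deg x)) \<le> B"
      "\<And>x. nc \<Longrightarrow> x < n \<Longrightarrow> x \<notin> A \<Longrightarrow> (D - 1) * K \<le> D * (D + 1) * core x"
    and t: "61 * n + 41 * (B - lo) + 40 \<le> t"
  shows "mean t (sampled_round D) s (\<lambda>r s'.
    if t + 41 * lo \<le> r + 61 * n + 40 + 41 * var s' vNode \<and> lo \<le> var s' vNode \<and> var s' vNode \<le> B \<and>
      var s' vLen \<le> m \<and> inj_on (arr s' aList) {..<var s' vLen} \<and> arr s' aList ` {..<var s' vLen} \<subseteq> A \<and>
      (\<forall>x. arr s' aDead x = 0) \<and> var s' vLevel = K - K div D
    then of_bool (nc \<and> \<not> (var s' vNode = lo + (\<Sum>x\<in>A. quota D S K (deg x)) \<and>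
      (\<forall>x\<in>arr s' aList ` {..<var s' vLen}. D * core x < K) \<and>
      (\<forall>x. if x \<in> A - arr s' aList ` {..<var s' vLen}
        then (D - 1) * K \<le> D * (D + 1) * core x \<and> arr s' aNum x = K \<and> arr s' aDen x = D + 1
        else arr s' aNum x = arr s aNum x \<and> arr s' aDen x = arr s aDen x)))
    else \<top>) \<le> of_nat m * ennreal (fail_prob D S)"
    (is "mean t _ s ?F \<le> _")
proof -
  have K1: "1 \<le> K" using D K by simp
  interpret sampler w n adj E "Random vPos (Var vDeg)" "sample_quota D" "\<lambda>i d. pmf_of_set {..<max 1 d}" "quota D S K"
    "good_sample D S K" "sample_moment D S K" "ennreal (fail_prob D S)" K S B
    by (rule sampler_random[OF D S K1 w(1,2)])
  let ?build = "build (sample_quota D) (Random vPos (Var vDeg))"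
  let ?rest = "peel ;; scan 1 (D + 1) ;; Assign vLevel (Sub (Var vLevel) (Div (Var vLevel) (Const D)))"
  have sumA: "(\<Sum>x\<in>A. quota D S K (deg x)) = (\<Sum>i<m. quota D S K (deg (f i)))"
    unfolding f(2)[symmetric] by (rule sum.reindex_cong[OF f(1) refl]) simp
  have "mean t ?build s (\<lambda>r s'.
      if t + 17 * lo \<le> r + 23 * n + 9 + 17 * var s' vNode \<and> linked n s' lo \<and>
        lo \<le> var s' vNode \<and> var s' vNode \<le> B \<and>
        (\<forall>j. lo \<le> j \<longrightarrow> j < var s' vNode \<longrightarrow> arr s' aWho j \<in> f ` {..<m}) \<and>
        (\<forall>i<m. arr s' aCnt (f i) = hits s' lo (f i) UNIV) \<and>
        (nc \<longrightarrow> var s' vNode = lo + (\<Sum>i<m. quota D S K (deg (f i))))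
      then of_bool (nc \<and> \<not> (\<forall>i<m. good_sample D S K (f i) (hits s' lo (f i)))) else \<top>) \<le> of_nat m * ennreal (fail_prob D S)"
    (is "mean t _ s ?G \<le> _")
  proof (rule mean_build)
    show "f i < n" if "i < m" for i using f that by auto
    show "lo + (\<Sum>i<m. quota D S K (deg (f i))) \<le> B" if nc using nc(1)[OF that] unfolding sumA .
  qed (use t s f in auto)
  moreover have "mean t (?build ;; ?rest) s ?F \<le> mean t ?build s ?G"
    unfolding mean_Seq[of t ?build]
  proof (rule mean_mono)
    fix r1 s1 assume ag: "agree ?build s s1"
    show "(if r1 = 0 then \<top> else mean (r1 - 1) ?rest s1 ?F) \<le> ?G r1 s1"
    proof (cases "t + 17 * lo \<le> r1 + 23 * n + 9 + 17 * var s1 vNode \<and> linked n s1 lo \<and>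
        lo \<le> var s1 vNode \<and> var s1 vNode \<le> B \<and>
        (\<forall>j. lo \<le> j \<longrightarrow> j < var s1 vNode \<longrightarrow> arr s1 aWho j \<in> f ` {..<m}) \<and>
        (\<forall>i<m. arr s1 aCnt (f i) = hits s1 lo (f i) UNIV) \<and>
        (nc \<longrightarrow> var s1 vNode = lo + (\<Sum>i<m. quota D S K (deg (f i))))")
      case True
      then have G: "?G r1 s1 = of_bool (nc \<and> \<not> (\<forall>i<m. good_sample D S K (f i) (hits s1 lo (f i))))" by (rule if_P)
      have T: "t + 17 * lo \<le> r1 + 23 * n + 9 + 17 * var s1 vNode" "linked n s1 lo"
        "lo \<le> var s1 vNode" "var s1 vNode \<le> B"
        "\<forall>j. lo \<le> j \<longrightarrow> j < var s1 vNode \<longrightarrow> arr s1 aWho j \<in> f ` {..<m}"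
        "\<forall>i<m. arr s1 aCnt (f i) = hits s1 lo (f i) UNIV"
        "nc \<longrightarrow> var s1 vNode = lo + (\<Sum>i<m. quota D S K (deg (f i)))"
        using True by - (elim conjE, assumption)+
      have s1: "var s1 vLen = m" "var s1 vLevel = K" "var s1 vThr = S" "arr s1 aList = f" "arr s1 aDead = arr s aDead"
        "arr s1 aNum = arr s aNum" "arr s1 aDen = arr s aDen"
        using agree_var[OF ag] agree_arr[OF ag] s
        by (simp_all add: build_def clear_heads_def build_vertex_def load_vertex_def sample_vertex_def insert_node_def)
      have r1: "38 * n + 24 * (var s1 vNode - lo) + 22 \<le> r1 - 1" "0 < r1"
        using T(1,3,4) t s(8) by linarith+
      define P where "P r s' \<longleftrightarrow> r1 - 1 \<le> r + 38 * n + 24 * (var s1 vNode - lo) + 22 \<and> var s' vLen \<le> m \<and> inj_on (arr s' aList) {..<var s' vLen} \<and>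
      (\<forall>x. arr s' aDead x = 0) \<and> var s' vLevel = K - K div D \<and>
      (\<exists>alive. alive \<subseteq> {..<n} \<and> arr s' aList ` {..<var s' vLen} = A - alive \<and>
        (\<forall>x. arr s' aNum x = (if x \<in> A \<inter> alive then K else arr s1 aNum x)) \<and>
        (\<forall>x. arr s' aDen x = (if x \<in> A \<inter> alive then D + 1 else arr s1 aDen x)) \<and>
        (\<forall>x\<in>A \<inter> alive. S \<le> hits s1 lo x alive) \<and>
        (\<forall>Y. Y \<subseteq> {..<n} \<longrightarrow> (\<forall>x\<in>Y \<inter> A. S \<le> hits s1 lo x Y) \<longrightarrow> Y \<subseteq> alive))" for r and s' :: store
      have rest: "sure (r1 - 1) ?rest s1 P"
        unfolding P_def
      proof (rule sure_peel_scan[OF D w(2) K T(2) s(9) T(3) s1(1) s(3) f(1) s1(4) f(2,3) _ _ _ s1(2,3) _ r1(1)])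
        show "arr s1 aWho j \<in> A" if "lo \<le> j" "j < var s1 vNode" for j using T(5) that f(2) by blast
        show "arr s1 aDead x = 0" for x using s1 s by simp
        show "arr s1 aCnt x = hits s1 lo x UNIV" if "x \<in> A" for x using T(6) that f(2) by blast
        show "n + var s1 vNode < 2 ^ w" using w(3) T(4) by linarith
      qed
      have "mean (r1 - 1) ?rest s1 ?F \<le> of_bool (nc \<and> \<not> (\<forall>i<m. good_sample D S K (f i) (hits s1 lo (f i))))"
      proof (rule mean_le_sure)
        show "sure (r1 - 1) ?rest s1 (\<lambda>r s'. P r s' \<and> agree ?rest s1 s')"
          using rest by (rule sure_mono) blast
        fix r s' assume PA: "P r s' \<and> agree ?rest s1 s'"
        have nd: "var s' vNode = var s1 vNode"
          using agree_var[OF conjunct2[OF PA]] by (simp add: peel_def pop_vertex_def kill_vertex_def visit_node_def scan_def scan_vertex_def)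
        have "\<exists>alive. alive \<subseteq> {..<n} \<and> arr s' aList ` {..<var s' vLen} = A - alive \<and>
          (\<forall>x. arr s' aNum x = (if x \<in> A \<inter> alive then K else arr s1 aNum x)) \<and>
          (\<forall>x. arr s' aDen x = (if x \<in> A \<inter> alive then D + 1 else arr s1 aDen x)) \<and>
          (\<forall>x\<in>A \<inter> alive. S \<le> hits s1 lo x alive) \<and>
          (\<forall>Y. Y \<subseteq> {..<n} \<longrightarrow> (\<forall>x\<in>Y \<inter> A. S \<le> hits s1 lo x Y) \<longrightarrow> Y \<subseteq> alive)"
          using conjunct1[OF PA] unfolding P_def by (elim conjE)
        then obtain alive where alive: "alive \<subseteq> {..<n} \<and> arr s' aList ` {..<var s' vLen} = A - alive \<and>
          (\<forall>x. arr s' aNum x = (if x \<in> A \<inter> alive then K else arr s1 aNum x)) \<and>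
          (\<forall>x. arr s' aDen x = (if x \<in> A \<inter> alive then D + 1 else arr s1 aDen x)) \<and>
          (\<forall>x\<in>A \<inter> alive. S \<le> hits s1 lo x alive) \<and>
          (\<forall>Y. Y \<subseteq> {..<n} \<longrightarrow> (\<forall>x\<in>Y \<inter> A. S \<le> hits s1 lo x Y) \<longrightarrow> Y \<subseteq> alive)"
          by (rule exE)
        have al: "alive \<subseteq> {..<n}" "arr s' aList ` {..<var s' vLen} = A - alive"
          "\<forall>x. arr s' aNum x = (if x \<in> A \<inter> alive then K else arr s1 aNum x)"
          "\<forall>x. arr s' aDen x = (if x \<in> A \<inter> alive then D + 1 else arr s1 aDen x)"
          "\<forall>x\<in>A \<inter> alive. S \<le> hits s1 lo x alive"
          "\<forall>Y. Y \<subseteq> {..<n} \<longrightarrow> (\<forall>x\<in>Y \<inter> A. S \<le> hits s1 lo x Y) \<longrightarrow> Y \<subseteq> alive"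
          using alive by - (elim conjE, assumption)+
        have PQ: "r1 - 1 \<le> r + 38 * n + 24 * (var s1 vNode - lo) + 22" "var s' vLen \<le> m" "inj_on (arr s' aList) {..<var s' vLen}"
          "\<forall>x. arr s' aDead x = 0" "var s' vLevel = K - K div D"
          using conjunct1[OF PA] unfolding P_def by - (elim conjE, assumption)+
        have Q: "t + 41 * lo \<le> r + 61 * n + 40 + 41 * var s' vNode \<and> lo \<le> var s' vNode \<and> var s' vNode \<le> B \<and>
          var s' vLen \<le> m \<and> inj_on (arr s' aList) {..<var s' vLen} \<and> arr s' aList ` {..<var s' vLen} \<subseteq> A \<and>
          (\<forall>x. arr s' aDead x = 0) \<and> var s' vLevel = K - K div D"
        proof (intro conjI)
          show "t + 41 * lo \<le> r + 61 * n + 40 + 41 * var s' vNode"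
            unfolding nd using PQ(1) T(1,3) r1 by linarith
          show "arr s' aList ` {..<var s' vLen} \<subseteq> A" unfolding al(2) by blast
        qed (use PQ T nd in simp_all)
        let ?L = "var s' vNode = lo + (\<Sum>x\<in>A. quota D S K (deg x)) \<and>
          (\<forall>x\<in>arr s' aList ` {..<var s' vLen}. D * core x < K) \<and>
          (\<forall>x. if x \<in> A - arr s' aList ` {..<var s' vLen}
            then (D - 1) * K \<le> D * (D + 1) * core x \<and> arr s' aNum x = K \<and> arr s' aDen x = D + 1
            else arr s' aNum x = arr s aNum x \<and> arr s' aDen x = arr s aDen x)"
        have L: ?L if ncg: nc "\<forall>i<m. good_sample D S K (f i) (hits s1 lo (f i))"
        proof -
          have good: "good_sample D S K v (hits s1 lo v)" if "v \<in> A" for v using ncg(2) that f(2) by blast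
          note pg = peel_good[where h = "hits s1 lo" and alive = alive, OF D f(3) good hits_mono _ _ al(1) nc(2)[OF ncg(1)]]
          have cs: "core_set D K \<subseteq> alive"
            by (rule pg) (use al(5,6) in blast)+
          have lb: "(D - 1) * K \<le> D * (D + 1) * core x" if "x \<in> alive" for x
            by (rule pg(2)) (use al(5,6) that in blast)+
          show ?L
            unfolding al(2)
          proof (intro conjI ballI allI)
            show "var s' vNode = lo + (\<Sum>x\<in>A. quota D S K (deg x))" using T(7) ncg(1) by (simp add: nd sumA)
            show "D * core x < K" if "x \<in> A - alive" for x
              using that cs f(3) by (force simp: core_set_def not_le)
            fix x
            have "x \<in> A - (A - alive) \<longleftrightarrow> x \<in> A \<inter> alive" by blast
            then show "if x \<in> A - (A - alive)
              then (D - 1) * K \<le> D * (D + 1) * core x \<and> arr s' aNum x = K \<and> arr s' aDen x = D + 1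
              else arr s' aNum x = arr s aNum x \<and> arr s' aDen x = arr s aDen x"
              using lb[of x] al(3)[rule_format, of x] al(4)[rule_format, of x] s1(6,7)
              by (cases "x \<in> A \<inter> alive") (simp_all only: if_True if_False simp_thms IntD2)
          qed
        qed
        have "?F r s' = of_bool (nc \<and> \<not> ?L)" using Q by (rule if_P)
        also have "\<dots> \<le> of_bool (nc \<and> \<not> (\<forall>i<m. good_sample D S K (f i) (hits s1 lo (f i))))"
          using L by (cases nc; cases "\<forall>i<m. good_sample D S K (f i) (hits s1 lo (f i))") (simp_all only: of_bool_def simp_thms if_True if_False order_refl, auto)
        finally show "?F r s' \<le> of_bool (nc \<and> \<not> (\<forall>i<m. good_sample D S K (f i) (hits s1 lo (f i))))" .
      qed
      then show ?thesis unfolding G using r1(2) by simp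
    next
      case False
      then have "?G r1 s1 = \<top>" by (rule if_not_P)
      then show ?thesis by (simp only: top_greatest)
    qed
  qed
  ultimately show ?thesis unfolding sampled_round_def by (rule order_trans[rotated])
qed

text \<open>In the second case the estimate \<open>aNum / (D + 1)\<close> lies between
  \<open>(D - 1) / (D + 1)\<close> and \<open>D / (D - 1)\<close> times the core number.\<close>

definition settled :: "nat \<Rightarrow> store \<Rightarrow> bool" where
  "settled D s \<longleftrightarrow> (\<forall>x<n. arr s aNum x = 0 \<and> arr s aDen x = 1 \<and> core x = 0 \<or>
     (D - 1) * core x < arr s aNum x \<and> (D - 1) * arr s aNum x \<le> D * (D + 1) * core x \<and> arr s aDen x = D + 1)"

text \<open>\<open>K \<le> arr s aNum x\<close> turns the bound for an assigned vertex into the same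
  bound at the present level, which \<open>peel_good\<close> needs. The last clause reserves the
  budget for all levels to come.\<close>

definition round_ok :: "nat \<Rightarrow> nat \<Rightarrow> nat \<Rightarrow> store \<Rightarrow> bool" where
  "round_ok D S B s \<longleftrightarrow> (let A = arr s aList ` {..<var s vLen}; K = var s vLevel in
     (\<forall>x<n. if x \<in> A then (D - 1) * core x < K \<and> arr s aNum x = 0 \<and> arr s aDen x = 1
       else (D - 1) * core x < arr s aNum x \<and> (D - 1) * arr s aNum x \<le> D * (D + 1) * core x \<and>
         K \<le> arr s aNum x \<and> arr s aDen x = D + 1) \<and>
     real (var s vNode) + potential D S K \<le> real B)"

text \<open>The drop of the potential pays for the draws of one level.\<close>

lemma sum_quota_le:
  assumes D: "2 \<le> D" and K: "D \<le> K" and A: "A \<subseteq> {..<n}" "\<And>x. x \<in> A \<Longrightarrow> (D - 1) * core x < K"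
  shows "real (\<Sum>x\<in>A. quota D S K (deg x)) \<le> potential D S K - potential D S (K - K div D)"
proof -
  have "real (\<Sum>x\<in>A. quota D S K (deg x)) \<le>
      (\<Sum>x\<in>A. real (card (neighbors E x)) * (real S * (real D + 1) / real K) + 1)"
    unfolding of_nat_sum
  proof (rule sum_mono)
    fix x assume "x \<in> A"
    then have "deg x = card (neighbors E x)" using A by (auto intro: deg_eq)
    then show "real (quota D S K (deg x)) \<le> real (card (neighbors E x)) * (real S * (real D + 1) / real K) + 1"
      using quota_bounds(2)[of K D S "deg x"] D K by simp
  qed
  also have "\<dots> \<le> potential D S K - potential D S (K - K div D)"
    by (rule potential_step[OF D K]) (use A in auto)
  finally show ?thesis .
qed

lemma round_ok_step:
  assumes D: "2 \<le> D" and K: "D \<le> K" "var s vLevel = K" and ok: "round_ok D S B s"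
    and A: "arr s aList ` {..<var s vLen} = A" "A \<subseteq> {..<n}"
    and A': "arr s' aList ` {..<var s' vLen} = A'" "A' \<subseteq> A"
    and lev: "var s' vLevel = K - K div D"
    and node: "var s' vNode = var s vNode + (\<Sum>x\<in>A. quota D S K (deg x))"
    and low: "\<forall>x\<in>A'. D * core x < K"
    and out: "\<forall>x. if x \<in> A - A'
        then (D - 1) * K \<le> D * (D + 1) * core x \<and> arr s' aNum x = K \<and> arr s' aDen x = D + 1
        else arr s' aNum x = arr s aNum x \<and> arr s' aDen x = arr s aDen x"
  shows "round_ok D S B s'"
  unfolding round_ok_def Let_def A'(1) lev
proof (intro conjI allI impI)
  note ok' = ok[unfolded round_ok_def Let_def A(1) K(2)]
  have ldec: "(D - 1) * K \<le> D * (K - K div D)"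
  proof -
    have "real ((D - 1) * K) \<le> real (D * (K - K div D))"
      using level_decrease(2)[OF D K(1)] D by (simp add: of_nat_diff)
    then show ?thesis by (simp only: of_nat_le_iff)
  qed
  fix x assume x: "x < n"
  note okx = conjunct1[OF ok', rule_format, OF x]
  note outx = out[rule_format, of x]
  show "if x \<in> A' then (D - 1) * core x < K - K div D \<and> arr s' aNum x = 0 \<and> arr s' aDen x = 1
       else (D - 1) * core x < arr s' aNum x \<and> (D - 1) * arr s' aNum x \<le> D * (D + 1) * core x \<and>
         K - K div D \<le> arr s' aNum x \<and> arr s' aDen x = D + 1"
  proof (cases "x \<in> A'")
    case True
    then have "x \<in> A" using A' by blast
    then have 1: "arr s' aNum x = 0" "arr s' aDen x = 1" using okx outx True by simp_all
    \<comment> \<open>Passing to the next level may lose the factor \<open>(D - 1) / D\<close>. This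
      is why a level yields \<open>D\<close> here while the invariant has
      \<open>D - 1\<close>.\<close>
    have "D * core x < K" using low True by blast
    then have "(D - 1) * (D * core x) < (D - 1) * K" using D by simp
    then have "(D - 1) * (D * core x) < D * (K - K div D)" using ldec by linarith
    then have "D * ((D - 1) * core x) < D * (K - K div D)" by (simp only: mult_ac)
    then have "(D - 1) * core x < K - K div D" by (rule mult_less_cancel1[THEN iffD1, THEN conjunct2])
    then show ?thesis using 1 True by simp
  next
    case False
    show ?thesis
    proof (cases "x \<in> A")
      case True
      then show ?thesis using okx outx False by simp
    next
      case notA: False
      have "arr s' aNum x = arr s aNum x" "arr s' aDen x = arr s aDen x" using outx notA by simp_all
      then show ?thesis using okx notA False by (auto intro: order_trans[OF diff_le_self])
    qed
  qed
next
  have "\<And>x. x \<in> A \<Longrightarrow> (D - 1) * core x < K"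
  proof -
    fix x assume "x \<in> A"
    then show "(D - 1) * core x < K"
      using ok[unfolded round_ok_def Let_def A(1) K(2), THEN conjunct1, rule_format, of x] A(2) by auto
  qed
  from sum_quota_le[OF D K(1) A(2) this, of S]
  show "real (var s' vNode) + potential D S (K - K div D) \<le> real B"
    using ok unfolding round_ok_def Let_def K(2) node by simp
qed

lemma mean_sampled_loop:
  assumes D: "2 \<le> D" and S: "2 * D \<le> S"
    and w: "B + n * S * (D + 1) + (D + 1) * n < 2 ^ w" "D + 1 < 2 ^ w" "B + n < 2 ^ w"
    and s: "var s vN = n" "var s vLen = n" "var s vLevel = (D + 1) * n" "var s vThr = S" "var s vBudget = B"
      "var s vNode = 1" "\<And>i. i < n \<Longrightarrow> arr s aList i = i" "\<And>x. arr s aDead x = 0"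
      "\<And>x. x < n \<Longrightarrow> arr s aNum x = 0 \<and> arr s aDen x = 1" and n: "1 \<le> n"
    and B: "1 + potential D S ((D + 1) * n) \<le> real B"
    and t: "level_bound D ((D + 1) * n) * (61 * n + 45) + 41 * B + 1 \<le> t"
  shows "mean t (While (Less (Const (D - 1)) (Var vLevel)) (sampled_round D)) s
    (\<lambda>_ s'. if settled D s' then 0 else 1)
      \<le> of_nat (level_bound D ((D + 1) * n)) * (of_nat n * ennreal (fail_prob D S))"
proof -
  let ?p = "ennreal (fail_prob D S)"
  define I where "I r s' \<longleftrightarrow> var s' vLen \<le> n \<and> inj_on (arr s' aList) {..<var s' vLen} \<and>
    arr s' aList ` {..<var s' vLen} \<subseteq> {..<n} \<and> (\<forall>x. arr s' aDead x = 0) \<and> 1 \<le> var s' vNode \<and> var s' vNode \<le> B \<and>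
    1 \<le> var s' vLevel \<and> var s' vLevel \<le> (D + 1) * n \<and>
    level_bound D (var s' vLevel) * (61 * n + 45) + 41 * (B - var s' vNode) + 1 \<le> r" for r and s' :: store
  \<comment> \<open>A union bound over the remaining levels and \<open>n\<close> vertices. Once
    \<open>round_ok\<close> is lost, the second summand is 1 and no further success is claimed, but
    \<open>I\<close> with its fuel and budget bounds persists.\<close>
  define V where "V r s' = (if I r s' then of_nat (level_bound D (var s' vLevel)) * (of_nat n * ?p) +
      of_bool (\<not> round_ok D S B s') else \<top>)" for r s'
  have B1: "1 \<le> B"
  proof -
    have "0 \<le> potential D S ((D + 1) * n)" using D n by (intro potential_nonneg) auto
    then show ?thesis using B by linarith
  qed
  have "mean t (While (Less (Const (D - 1)) (Var vLevel)) (sampled_round D)) s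
    (\<lambda>_ s'. if settled D s' then 0 else 1) \<le> V t s"
  proof (rule mean_While)
    fix r s' assume V: "V r s' < \<top>" and ag: "agree (sampled_round D) s s'"
    have I: "I r s'" using V by (auto simp: V_def split: if_splits)
    then have Veq: "V r s' = of_nat (level_bound D (var s' vLevel)) * (of_nat n * ?p) + of_bool (\<not> round_ok D S B s')"
      unfolding V_def by (rule if_P)
    have s': "var s' vN = n" "var s' vThr = S" "var s' vBudget = B"
      using agree_var[OF ag] s
      by (simp_all add: sampled_round_def build_def clear_heads_def build_vertex_def load_vertex_def sample_vertex_def
          insert_node_def peel_def pop_vertex_def kill_vertex_def visit_node_def scan_def scan_vertex_def)
    define K where "K = var s' vLevel"
    define m where "m = var s' vLen"
    define lo where "lo = var s' vNode"
    define A where "A = arr s' aList ` {..<m}"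
    have IK: "m \<le> n" "inj_on (arr s' aList) {..<m}" "A \<subseteq> {..<n}" "\<forall>x. arr s' aDead x = 0" "1 \<le> lo" "lo \<le> B"
      "1 \<le> K" "K \<le> (D + 1) * n" "level_bound D K * (61 * n + 45) + 41 * (B - lo) + 1 \<le> r"
      using I unfolding I_def K_def m_def lo_def A_def by - (elim conjE, assumption)+
    have cond: "eval_exp w (Less (Const (D - 1)) (Var vLevel)) s' \<noteq> 0 \<longleftrightarrow> D \<le> K"
      using w(2) w_pos D by (auto simp: K_def)
    show "0 < r \<and> (if eval_exp w (Less (Const (D - 1)) (Var vLevel)) s' \<noteq> 0
        then mean (r - 1) (sampled_round D) s' (\<lambda>r s''. if r = 0 then \<top> else V (r - 1) s'') \<le> V r s'
        else (if settled D s' then 0 else 1) \<le> V r s')"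
    proof (cases "D \<le> K")
      case False
      have "settled D s'" if "round_ok D S B s'"
        unfolding settled_def
      proof (intro allI impI)
        fix x assume x: "x < n"
        note ok = that[unfolded round_ok_def Let_def, THEN conjunct1, rule_format, OF x, folded K_def m_def, folded A_def]
        have "core x = 0" if "(D - 1) * core x < K"
        proof (rule ccontr)
          assume "core x \<noteq> 0"
          then have "D - 1 \<le> (D - 1) * core x" by simp
          then show False using that False by linarith
        qed
        then show "arr s' aNum x = 0 \<and> arr s' aDen x = 1 \<and> core x = 0 \<or>
          (D - 1) * core x < arr s' aNum x \<and> (D - 1) * arr s' aNum x \<le> D * (D + 1) * core x \<and> arr s' aDen x = D + 1"
          using ok by (cases "x \<in> A") simp_all
      qed
      then have "(if settled D s' then 0 else 1) \<le> V r s'"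
        unfolding Veq by (cases "round_ok D S B s'") (auto intro: add_increasing)
      then show ?thesis using False cond IK by simp
    next
      case True
      \<comment> \<open>New failures are counted only as long as the invariant holds; this also
        guarantees that the budget suffices for the present level.\<close>
      define nc where "nc \<longleftrightarrow> round_ok D S B s'"
      let ?K' = "K - K div D"
      note lev = level_decrease[OF D True]
      have lb: "level_bound D ?K' + 1 \<le> level_bound D K" by (rule level_bound_step[OF D True])
      have nc_low: "(D - 1) * core x < K" if nc "x \<in> A" for x
        using that(1)[unfolded nc_def round_ok_def Let_def, THEN conjunct1, rule_format, of x, folded K_def m_def, folded A_def]
          that(2) IK(3) by auto
      have nc1: "lo + (\<Sum>x\<in>A. quota D S K (deg x)) \<le> B" if nc
      proof -
        have "real (\<Sum>x\<in>A. quota D S K (deg x)) \<le> potential D S K - potential D S ?K'"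
          by (rule sum_quota_le[OF D True IK(3) nc_low[OF that]])
        moreover have "0 \<le> potential D S ?K'" using D lev(3) by (intro potential_nonneg) auto
        moreover have "real lo + potential D S K \<le> real B"
          using that unfolding nc_def round_ok_def Let_def K_def lo_def by (elim conjE)
        ultimately have "real (lo + (\<Sum>x\<in>A. quota D S K (deg x))) \<le> real B" by simp
        then show ?thesis by (simp only: of_nat_le_iff)
      qed
      have nc2: "(D - 1) * K \<le> D * (D + 1) * core x" if nc "x < n" "x \<notin> A" for x
      proof -
        have "K \<le> arr s' aNum x" "(D - 1) * arr s' aNum x \<le> D * (D + 1) * core x"
          using that(1)[unfolded nc_def round_ok_def Let_def, THEN conjunct1, rule_format, OF that(2), folded K_def m_def, folded A_def]
            that(3) by simp_all
        then show ?thesis by (meson mult_le_mono2 order_trans)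
      qed
      define Q where "Q r' s'' \<longleftrightarrow> r - 1 + 41 * lo \<le> r' + 61 * n + 40 + 41 * var s'' vNode \<and> lo \<le> var s'' vNode \<and> var s'' vNode \<le> B \<and>
        var s'' vLen \<le> m \<and> inj_on (arr s'' aList) {..<var s'' vLen} \<and> arr s'' aList ` {..<var s'' vLen} \<subseteq> A \<and>
        (\<forall>x. arr s'' aDead x = 0) \<and> var s'' vLevel = ?K'" for r' and s'' :: store
      define G where "G s'' \<longleftrightarrow> var s'' vNode = lo + (\<Sum>x\<in>A. quota D S K (deg x)) \<and>
        (\<forall>x\<in>arr s'' aList ` {..<var s'' vLen}. D * core x < K) \<and>
        (\<forall>x. if x \<in> A - arr s'' aList ` {..<var s'' vLen}
          then (D - 1) * K \<le> D * (D + 1) * core x \<and> arr s'' aNum x = K \<and> arr s'' aDen x = D + 1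
          else arr s'' aNum x = arr s' aNum x \<and> arr s'' aDen x = arr s' aDen x)" for s'' :: store
      have lbm: "(61 * n + 45) + level_bound D ?K' * (61 * n + 45) \<le> level_bound D K * (61 * n + 45)"
        using mult_le_mono1[OF lb, of "61 * n + 45"] by (simp add: algebra_simps)
      have fuel: "61 * n + 41 * (B - lo) + 40 \<le> r - 1" using IK(9) lbm by linarith
      have rd: "mean (r - 1) (sampled_round D) s' (\<lambda>r s''. if Q r s'' then of_bool (nc \<and> \<not> G s'') else \<top>) \<le> of_nat m * ?p"
        unfolding Q_def G_def
      proof (rule mean_sampled_round[OF D S True])
        show "B + n * S * (D + 1) + K < 2 ^ w" using w(1) IK(8) by linarith
      qed (use w s' IK nc1 nc2 fuel in \<open>simp_all add: K_def m_def lo_def A_def\<close>)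
      let ?k = "of_nat (level_bound D K - 1) * (of_nat n * ?p) + of_bool (\<not> nc)"
      have "mean (r - 1) (sampled_round D) s' (\<lambda>r s''. if r = 0 then \<top> else V (r - 1) s'')
        \<le> mean (r - 1) (sampled_round D) s' (\<lambda>r s''. ?k + (if Q r s'' then of_bool (nc \<and> \<not> G s'') else \<top>))"
      proof (rule mean_mono)
        fix r' s'' assume "r' \<le> r - 1"
        show "(if r' = 0 then \<top> else V (r' - 1) s'') \<le> ?k + (if Q r' s'' then of_bool (nc \<and> \<not> G s'') else \<top>)"
        proof (cases "Q r' s''")
          case Qt: True
          have q: "r - 1 + 41 * lo \<le> r' + 61 * n + 40 + 41 * var s'' vNode" "lo \<le> var s'' vNode" "var s'' vNode \<le> B"
            "var s'' vLen \<le> m" "inj_on (arr s'' aList) {..<var s'' vLen}" "arr s'' aList ` {..<var s'' vLen} \<subseteq> A"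
            "\<forall>x. arr s'' aDead x = 0" "var s'' vLevel = ?K'"
            using Qt unfolding Q_def by - (elim conjE, assumption)+
          have r': "level_bound D ?K' * (61 * n + 45) + 41 * (B - var s'' vNode) + 1 \<le> r' - 1" "0 < r'"
            using q(1-3) IK(9) lbm by linarith+
          have I': "I (r' - 1) s''"
            unfolding I_def q(8)
          proof (intro conjI)
            show "var s'' vLen \<le> n" using q(4) IK(1) by linarith
            show "arr s'' aList ` {..<var s'' vLen} \<subseteq> {..<n}" using q(6) IK(3) by blast
            show "1 \<le> var s'' vNode" using q(2) IK(5) by linarith
            show "1 \<le> ?K'" using lev(3) by simp
            show "?K' \<le> (D + 1) * n" using IK(8) by simp
          qed (rule q r'(1))+
          have step: "round_ok D S B s''" if nc "G s''"
          proof -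
            note g = that(2)[unfolded G_def lo_def]
            show ?thesis
              by (rule round_ok_step[OF D True K_def[symmetric] that(1)[unfolded nc_def] A_def[unfolded m_def, symmetric] IK(3)
                refl q(6,8) conjunct1[OF g] conjunct1[OF conjunct2[OF g]] conjunct2[OF conjunct2[OF g]]])
          qed
          have "level_bound D ?K' \<le> level_bound D K - 1" using lb by linarith
          then have "of_nat (level_bound D ?K') * (of_nat n * ?p) \<le> of_nat (level_bound D K - 1) * (of_nat n * ?p)"
            by (intro mult_right_mono) (simp_all add: of_nat_mono)
          moreover have "of_bool (\<not> round_ok D S B s'') \<le> of_bool (\<not> nc) + (of_bool (nc \<and> \<not> G s'') :: ennreal)"
            using step by (cases nc; cases "G s''"; cases "round_ok D S B s''") auto
          ultimately have "of_nat (level_bound D ?K') * (of_nat n * ?p) + of_bool (\<not> round_ok D S B s'') \<le>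
              of_nat (level_bound D K - 1) * (of_nat n * ?p) + (of_bool (\<not> nc) + of_bool (nc \<and> \<not> G s''))"
            by (rule add_mono)
          moreover have "V (r' - 1) s'' = of_nat (level_bound D ?K') * (of_nat n * ?p) + of_bool (\<not> round_ok D S B s'')"
            unfolding V_def q(8)[symmetric] using I' by (rule if_P)
          ultimately have "V (r' - 1) s'' \<le> ?k + of_bool (nc \<and> \<not> G s'')" by (simp only: add.assoc)
          then show ?thesis using r'(2) Qt by (simp only: if_True if_False neq0_conv[symmetric] simp_thms)
        next
          case False
          then have "?k + (if Q r' s'' then of_bool (nc \<and> \<not> G s'') else \<top>) = \<top>" by simp
          then show ?thesis by (simp only: top_greatest)
        qed
      qed
      also have "\<dots> \<le> ?k + of_nat m * ?p" by (rule order_trans[OF mean_add_const add_left_mono[OF rd]])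
      also have "\<dots> \<le> ?k + of_nat n * ?p"
        using IK(1) by (intro add_left_mono mult_right_mono) (simp_all add: of_nat_mono)
      also have "\<dots> = V r s'"
      proof -
        have "level_bound D K = Suc (level_bound D K - 1)" using lb by simp
        then have "of_nat (level_bound D K) * (of_nat n * ?p) = of_nat n * ?p + of_nat (level_bound D K - 1) * (of_nat n * ?p)"
          by (metis of_nat_Suc distrib_right mult_1)
        then show ?thesis unfolding Veq K_def[symmetric] nc_def[symmetric] by (simp only: add_ac)
      qed
      finally show ?thesis using True cond fuel IK(9) by simp
    qed
  qed
  also have "V t s = of_nat (level_bound D ((D + 1) * n)) * (of_nat n * ?p)"
  proof -
    have img: "arr s aList ` {..<n} = {..<n}" using s(7) by (auto simp: image_iff)
    have "inj_on (arr s aList) {..<n}" using s(7) by (auto simp: inj_on_def)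
    then have "I t s" using t B1 img s n D by (auto simp: I_def)
    moreover have "round_ok D S B s"
      unfolding round_ok_def Let_def s(2,3,6) img
    proof (intro conjI allI impI)
      fix x assume x: "x < n"
      have "core x < n" using core_number_le_degree[of x] degree_less[of x] x by simp
      then have "(D + 1) * core x < (D + 1) * n" by (intro mult_strict_left_mono) auto
      moreover have "(D - 1) * core x \<le> (D + 1) * core x" by (intro mult_le_mono1) simp
      ultimately have "(D - 1) * core x < (D + 1) * n" by linarith
      then show "if x \<in> {..<n} then (D - 1) * core x < (D + 1) * n \<and> arr s aNum x = 0 \<and> arr s aDen x = 1
       else (D - 1) * core x < arr s aNum x \<and> (D - 1) * arr s aNum x \<le> D * (D + 1) * core x \<and>
         (D + 1) * n \<le> arr s aNum x \<and> arr s aDen x = D + 1" using x s(9)[OF x] by simp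
    qed (use B in simp)
    ultimately show ?thesis unfolding V_def s(3) by simp
  qed
  finally show ?thesis .
qed

end

section \<open>The algorithm\<close>

definition load_degree :: com where
  "load_degree =
     Degree vDeg (Var vI) ;;
     Assign vSum (Add (Var vSum) (Var vDeg)) ;;
     Write aDen (Var vI) (Const 1) ;;
     Write aList (Var vI) (Var vI) ;;
     incr vI"

definition halve :: com where
  "halve = Assign vX (Div (Var vX) (Const 2)) ;; incr vLog"

text \<open>Repeated halving leaves the logarithm of \<open>n\<close>, rounded down, in
  \<open>vLog\<close>: with \<open>l\<close> halvings done and \<open>x\<close> left,
  \<open>2 ^ l * x \<le> n < 2 ^ l * (x + 1)\<close>.\<close>

definition prepare :: com where
  "prepare =
     While (Less (Var vI) (Var vN)) load_degree ;;
     Assign vX (Var vN) ;;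
     While (Less (Const 1) (Var vX)) halve ;;
     Assign vLen (Var vN) ;;
     Assign vNode (Const 1)"

text \<open>The degree sum is twice the number of edges, so either branch meets both bounds: a small
  sum makes reading the graph O(n log n), and a large sum makes n log n at most O(m).\<close>

definition core_program :: "nat \<Rightarrow> nat \<Rightarrow> nat \<Rightarrow> com" where
  "core_program D a b =
     prepare ;; If (Less (Mul (Var vN) (Var vLog)) (Var vSum)) (sampled D a b) exact"

context ram
begin

lemma mean_If:
  assumes "0 < t"
  shows "mean t (If e c d) s f = (if eval_exp w e s \<noteq> 0 then mean (t - 1) c s f else mean (t - 1) d s f)"
  using assms by (cases t) auto

end

context incident_ram
begin

lemma sum_deg: "(\<Sum>v<n. deg v) = 2 * card E"
proof -
  have "(\<Sum>v<n. deg v) = (\<Sum>v<n. card (neighbors E v))" by (intro sum.cong) (auto simp: deg_eq)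
  then show ?thesis using sum_degree by simp
qed

lemma sum_deg_le: "(\<Sum>v<n. deg v) \<le> n * n"
  using sum_bounded_above[of "{..<n}" deg n] deg_less by (simp add: less_imp_le)

definition prepared :: "store \<Rightarrow> bool" where
  "prepared s \<longleftrightarrow> var s vN = n \<and> var s vLen = n \<and> var s vNode = 1 \<and> var s vSum = (\<Sum>v<n. deg v) \<and>
    (\<forall>i<n. arr s aList i = i) \<and> (\<forall>x. arr s aDead x = 0) \<and> (\<forall>x<n. arr s aNum x = 0 \<and> arr s aDen x = 1) \<and>
    2 ^ var s vLog \<le> n \<and> n < 2 ^ (var s vLog + 1)"

lemma sure_prepare:
  assumes n: "2 \<le> n" and w: "n * n < 2 ^ w" and t: "16 * n + 12 \<le> t"
  shows "sure t prepare (initial_store n) (\<lambda>r s. t \<le> r + 16 * n + 12 \<and>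
    prepared s)"
proof -
  have nw: "n < 2 ^ w" using n_word by simp
  have two: "(2::nat) < 2 ^ w" using n nw by linarith
  let ?s0 = "initial_store n"
  have degs: "sure t (While (Less (Var vI) (Var vN)) load_degree) ?s0
    (\<lambda>r s. t \<le> r + 11 * n + 1 \<and> var s vSum = (\<Sum>v<n. deg v) \<and> (\<forall>i<n. arr s aList i = i) \<and> (\<forall>x<n. arr s aDen x = 1))"
  proof (rule sure_While[where I = "\<lambda>r s. var s vI \<le> n \<and> t \<le> r + 11 * var s vI \<and> var s vSum = (\<Sum>v<var s vI. deg v) \<and>
      (\<forall>i<var s vI. arr s aList i = i) \<and> (\<forall>x<var s vI. arr s aDen x = 1)"])
    fix r and s :: store assume I: "var s vI \<le> n \<and> t \<le> r + 11 * var s vI \<and> var s vSum = (\<Sum>v<var s vI. deg v) \<and>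
      (\<forall>i<var s vI. arr s aList i = i) \<and> (\<forall>x<var s vI. arr s aDen x = 1)"
      and ag: "agree load_degree ?s0 s"
    have N: "var s vN = n" using agree_var[OF ag] by (simp add: load_degree_def initial_store_def)
    have "12 \<le> r" using I t n by linarith
    then obtain r' where r': "r = r' + 12" by (metis add.commute le_Suc_ex)
    show "0 < r \<and> (if eval_exp w (Less (Var vI) (Var vN)) s \<noteq> 0
        then sure (r - 1) load_degree s (\<lambda>r s. 0 < r \<and> var s vI \<le> n \<and> t \<le> r - 1 + 11 * var s vI \<and>
          var s vSum = (\<Sum>v<var s vI. deg v) \<and> (\<forall>i<var s vI. arr s aList i = i) \<and> (\<forall>x<var s vI. arr s aDen x = 1))
        else t \<le> r - 1 + 11 * n + 1 \<and> var s vSum = (\<Sum>v<n. deg v) \<and> (\<forall>i<n. arr s aList i = i) \<and> (\<forall>x<n. arr s aDen x = 1))"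
    proof (cases "var s vI < n")
      case True
      have "(\<Sum>v<Suc (var s vI). deg v) \<le> (\<Sum>v<n. deg v)" using True by (intro sum_mono2) auto
      then have "((\<Sum>v<var s vI. deg v) + deg (var s vI)) mod 2 ^ w = (\<Sum>v<Suc (var s vI). deg v)"
        using sum_deg_le w by simp
      moreover have "Suc (var s vI) mod 2 ^ w = Suc (var s vI)" using True nw by (intro mod_less) linarith
      moreover have "degree_query n adj (var s vI) = deg (var s vI)" using True by (simp add: degree_query_def deg_def)
      ultimately show ?thesis
        using I N True r' w_pos by (auto simp: load_degree_def less_Suc_eq)
    next
      case False
      then show ?thesis using I N r' by simp
    qed
  qed (simp add: initial_store_def)
  have logs: "sure t' (While (Less (Const 1) (Var vX)) halve) s
      (\<lambda>r s'. t' \<le> r + 5 * n + 1 \<and> 2 ^ var s' vLog \<le> n \<and> n < 2 ^ (var s' vLog + 1))"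
    if s: "var s vX = n" "var s vLog = 0" and t': "5 * n + 1 \<le> t'" for t' s
  proof (rule sure_While[where I = "\<lambda>r s'. t' \<le> r + 5 * var s' vLog \<and> 1 \<le> var s' vX \<and>
      2 ^ var s' vLog * var s' vX \<le> n \<and> n < 2 ^ var s' vLog * (var s' vX + 1)"])
    show "t' \<le> t' + 5 * var s vLog \<and> 1 \<le> var s vX \<and> 2 ^ var s vLog * var s vX \<le> n \<and> n < 2 ^ var s vLog * (var s vX + 1)"
      using s n by simp
    fix r and s' :: store assume I: "t' \<le> r + 5 * var s' vLog \<and> 1 \<le> var s' vX \<and>
      2 ^ var s' vLog * var s' vX \<le> n \<and> n < 2 ^ var s' vLog * (var s' vX + 1)"
    define l where "l = var s' vLog"
    define x where "x = var s' vX"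
    have lx: "t' \<le> r + 5 * l" "1 \<le> x" "2 ^ l * x \<le> n" "n < 2 ^ l * (x + 1)" using I by (simp_all add: l_def x_def)
    have ln: "l < n"
    proof -
      have "l < 2 ^ l" by (rule less_exp)
      also have "\<dots> \<le> 2 ^ l * x" using lx(2) by simp
      finally show ?thesis using lx(3) by linarith
    qed
    have "6 \<le> r" using lx(1) ln t' by linarith
    then obtain r' where r': "r = r' + 6" by (metis add.commute le_Suc_ex)
    show "0 < r \<and> (if eval_exp w (Less (Const 1) (Var vX)) s' \<noteq> 0
        then sure (r - 1) halve s' (\<lambda>r s'. 0 < r \<and> t' \<le> r - 1 + 5 * var s' vLog \<and> 1 \<le> var s' vX \<and>
          2 ^ var s' vLog * var s' vX \<le> n \<and> n < 2 ^ var s' vLog * (var s' vX + 1))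
        else t' \<le> r - 1 + 5 * n + 1 \<and> 2 ^ var s' vLog \<le> n \<and> n < 2 ^ (var s' vLog + 1))"
    proof (cases "1 < x")
      case True
      have half: "1 \<le> x div 2" "2 * (x div 2) \<le> x" "x + 1 \<le> 2 * (x div 2 + 1)" using True by auto
      have a: "2 ^ Suc l * (x div 2) \<le> n"
      proof -
        have "2 ^ Suc l * (x div 2) = 2 ^ l * (2 * (x div 2))" by simp
        also have "\<dots> \<le> 2 ^ l * x" using half(2) by (rule mult_le_mono2)
        finally show ?thesis using lx(3) by linarith
      qed
      have b: "n < 2 ^ Suc l * (x div 2 + 1)"
      proof -
        have "2 ^ l * (x + 1) \<le> 2 ^ l * (2 * (x div 2 + 1))" using half(3) by (rule mult_le_mono2)
        then show ?thesis using lx(4) by simp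
      qed
      have m: "Suc l mod 2 ^ w = Suc l" "2 mod 2 ^ w = (2::nat)" using ln nw two by simp_all
      have cond: "eval_exp w (Less (Const 1) (Var vX)) s' \<noteq> 0" using True w_pos by (simp add: x_def)
      have "sure (r - 1) halve s' (\<lambda>r s'. 0 < r \<and> t' \<le> r - 1 + 5 * var s' vLog \<and> 1 \<le> var s' vX \<and>
          2 ^ var s' vLog * var s' vX \<le> n \<and> n < 2 ^ var s' vLog * (var s' vX + 1))"
        using r' lx(1) half a b m w_pos by (simp add: halve_def l_def[symmetric] x_def[symmetric])
      then show ?thesis using cond r' by simp
    next
      case False
      then have "x = 1" using lx(2) by simp
      then show ?thesis using lx r' w_pos ln by (simp add: l_def[symmetric] x_def[symmetric])
    qed
  qed
  let ?post = "\<lambda>r s. t \<le> r + 16 * n + 12 \<and>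
    prepared s"
  show ?thesis
    unfolding prepare_def sure_Seq sure_Assign
  proof (rule sure_mono[OF degs])
    fix r s1 assume ag: "agree (While (Less (Var vI) (Var vN)) load_degree) ?s0 s1"
      and P: "t \<le> r + 11 * n + 1 \<and> var s1 vSum = (\<Sum>v<n. deg v) \<and> (\<forall>i<n. arr s1 aList i = i) \<and> (\<forall>x<n. arr s1 aDen x = 1)"
    have s1: "var s1 vN = n" "var s1 vLog = 0" "arr s1 aDead = (\<lambda>_. 0)" "arr s1 aNum = (\<lambda>_. 0)"
      using agree_var[OF ag] agree_arr[OF ag] by (simp_all add: load_degree_def initial_store_def)
    define s2 where "s2 = set_var vX (eval_exp w (Var vN) s1) s1"
    have s2: "var s2 vX = n" "var s2 vLog = 0" "var s2 vN = n" "var s2 vSum = var s1 vSum" "arr s2 = arr s1"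
      by (simp_all add: s2_def s1)
    have r: "5 * n + 11 \<le> r" using P t by linarith
    have t': "5 * n + 1 \<le> r - 1 - 1 - 1" using r by linarith
    have "sure (r - 1 - 1 - 1) (While (Less (Const 1) (Var vX)) halve) s2
      (\<lambda>r s. 0 < r \<and> 0 < r - 1 \<and> 0 < r - 1 - 1 \<and> 0 < r - 1 - 1 - 1 \<and>
        ?post (r - 1 - 1 - 1 - 1) (set_var vNode (eval_exp w (Const 1) (set_var vLen (eval_exp w (Var vN) s) s))
          (set_var vLen (eval_exp w (Var vN) s) s)))"
    proof (rule sure_mono[OF logs[OF s2(1,2) t']])
      fix r' s3 assume ag3: "agree (While (Less (Const 1) (Var vX)) halve) s2 s3"
        and P3: "r - 1 - 1 - 1 \<le> r' + 5 * n + 1 \<and> 2 ^ var s3 vLog \<le> n \<and> n < 2 ^ (var s3 vLog + 1)"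
      have s3: "var s3 vN = n" "var s3 vSum = (\<Sum>v<n. deg v)" "arr s3 = arr s1"
      proof -
        show "arr s3 = arr s1" using agree_arr[OF ag3] s2(5) by (auto simp: halve_def)
      qed (use agree_var[OF ag3] s2 P in \<open>simp_all add: halve_def\<close>)
      have r': "r \<le> r' + 5 * n + 4" "7 \<le> r'" using P3 r by linarith+
      then have "t \<le> r' - 1 - 1 - 1 - 1 + 16 * n + 12" using conjunct1[OF P] by linarith
      then show "0 < r' \<and> 0 < r' - 1 \<and> 0 < r' - 1 - 1 \<and> 0 < r' - 1 - 1 - 1 \<and>
        ?post (r' - 1 - 1 - 1 - 1) (set_var vNode (eval_exp w (Const 1) (set_var vLen (eval_exp w (Var vN) s3) s3))
          (set_var vLen (eval_exp w (Var vN) s3) s3))"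
        using P P3 r' s1 s3 w_pos by (simp add: prepared_def)
    qed
    moreover have "0 < r" "0 < r - 1" "0 < r - 1 - 1" using r by linarith+
    ultimately show "0 < r \<and> 0 < r - 1 \<and> 0 < r - 1 - 1 \<and> sure (r - 1 - 1 - 1) (While (Less (Const 1) (Var vX)) halve)
        (set_var vX (eval_exp w (Var vN) s1) s1)
      (\<lambda>r s. 0 < r \<and> 0 < r - 1 \<and> 0 < r - 1 - 1 \<and> 0 < r - 1 - 1 - 1 \<and>
        ?post (r - 1 - 1 - 1 - 1) (set_var vNode (eval_exp w (Const 1) (set_var vLen (eval_exp w (Var vN) s) s))
          (set_var vLen (eval_exp w (Var vN) s) s)))"
      unfolding s2_def by blast
  qed
qed

end

context ram
begin

lemma mean_Assign_Seq:
  assumes "2 \<le> t"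
  shows "mean t (Assign x e ;; d) s f = mean (t - 2) d (set_var x (eval_exp w e s) s) f"
proof -
  have "0 < t" "t - 1 \<noteq> 0" "t - 1 - 1 = t - 2" using assms by linarith+
  then show ?thesis by (simp only: mean_Seq mean_Assign if_False)
qed

end

section \<open>Numerical bounds\<close>

lemma log_unique:
  assumes "2 ^ l \<le> (n::nat)" "n < 2 ^ (l + 1)" "2 ^ k \<le> n" "n < 2 ^ (k + 1)"
  shows "l = k"
proof -
  have "(2::nat) ^ l < 2 ^ (k + 1)" "(2::nat) ^ k < 2 ^ (l + 1)" using assms by linarith+
  then have "l < k + 1" "k < l + 1" by (auto intro: power_less_imp_less_exp[of "2 :: nat"])
  then show ?thesis by simp
qed

text \<open>Per unit of \<open>n * (L + 1)\<close>: \<open>2 * D * D + 2 * D + 1\<close> covers the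
  roundings and also the number of levels, \<open>16 * a * (D + 1)\<close> covers the draws
  proportional to the degrees, and the last 1 covers the node number 1 at the start.\<close>

definition budget_factor :: "nat \<Rightarrow> nat \<Rightarrow> nat" where
  "budget_factor D a = 2 * D * D + 2 * D + 2 + 16 * a * (D + 1)"

lemma ln_le_log:
  assumes "n < 2 ^ (L + 1)" "1 \<le> n"
  shows "ln (real n) \<le> real L + 1"
proof -
  have "n \<le> 2 ^ (L + 1)" using assms(1) by simp
  then have "real n \<le> 2 ^ (L + 1)" by (metis of_nat_le_iff of_nat_numeral of_nat_power)
  then have "ln (real n) \<le> ln (2 ^ (L + 1))" using assms(2) by (intro ln_mono) auto
  also have "\<dots> = real (L + 1) * ln 2" by (rule ln_realpow)
  also have "\<dots> \<le> real (L + 1) * 1" using ln_2_less_1 by (intro mult_left_mono) auto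
  finally show ?thesis by simp
qed

lemma ln_level_le:
  assumes "n < 2 ^ (L + 1)" "1 \<le> n"
  shows "ln (real ((D + 1) * n)) \<le> real D + real L + 1"
proof -
  have "real ((D + 1) * n) = (1 + real D) * real n" by (simp add: algebra_simps)
  then have "ln (real ((D + 1) * n)) = ln (1 + real D) + ln (real n)"
    using ln_mult[of "1 + real D" "real n"] assms(2) by simp
  moreover have "ln (1 + real D) \<le> real D" by (rule ln_add_one_self_le_self) simp
  moreover have "ln (real n) \<le> real L + 1" by (rule ln_le_log[OF assms])
  ultimately show ?thesis by linarith
qed

lemma level_bound_le:
  assumes "n < 2 ^ (L + 1)" "1 \<le> n"
  shows "level_bound D ((D + 1) * n) \<le> budget_factor D a * (L + 1)"
proof -
  have "2 * real D * ln (real ((D + 1) * n)) \<le> 2 * real D * (real D + real L + 1)"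
    using ln_level_le[OF assms] by (intro mult_left_mono) auto
  also have "\<dots> = real (2 * D * (D + L + 1))" by (simp add: algebra_simps)
  finally have "\<lfloor>2 * real D * ln (real ((D + 1) * n))\<rfloor> \<le> int (2 * D * (D + L + 1))" by linarith
  then have "level_bound D ((D + 1) * n) \<le> 2 * D * (D + L + 1) + 1" unfolding level_bound_def by linarith
  also have "\<dots> \<le> budget_factor D a * (L + 1)"
  proof -
    have "2 * D * (D + L + 1) + 1 \<le> (2 * D * D + 2 * D + 1) * (L + 1)" by (simp add: algebra_simps)
    also have "\<dots> \<le> budget_factor D a * (L + 1)" unfolding budget_factor_def by (intro mult_le_mono1) linarith
    finally show ?thesis .
  qed
  finally show ?thesis .
qed

context incident_ram
begin

lemma potential_budget:
  assumes D: "2 \<le> D" and L: "n < 2 ^ (L + 1)" and n: "1 \<le> n"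
  shows "1 + potential D (a * (L + 1)) ((D + 1) * n) \<le> real (budget_factor D a * (n * (L + 1)))"
proof -
  let ?K = "(D + 1) * n"
  have "2 * real D * ln (real ?K) \<le> 2 * real D * (real D + real L + 1)"
    using ln_level_le[OF L n] by (intro mult_left_mono) auto
  then have "2 * real D * ln (real ?K) + 1 + 16 * real (a * (L + 1)) * (real D + 1) \<le>
      2 * real D * (real D + real L + 1) + 1 + 16 * real (a * (L + 1)) * (real D + 1)" by simp
  also have "\<dots> = real (2 * D * (D + L + 1) + 1 + 16 * (a * (L + 1)) * (D + 1))" by (simp add: algebra_simps)
  also have "\<dots> \<le> real ((budget_factor D a - 1) * (L + 1))"
    unfolding budget_factor_def of_nat_le_iff by (simp add: algebra_simps)
  finally have "real n * (2 * real D * ln (real ?K) + 1 + 16 * real (a * (L + 1)) * (real D + 1)) \<le>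
      real n * real ((budget_factor D a - 1) * (L + 1))" by (intro mult_left_mono) auto
  then have "potential D (a * (L + 1)) ?K \<le> real (n * ((budget_factor D a - 1) * (L + 1)))"
    using potential_le[OF D, of "a * (L + 1)" ?K] by simp
  then have "1 + potential D (a * (L + 1)) ?K \<le> real (1 + n * ((budget_factor D a - 1) * (L + 1)))" by simp
  also have "1 + n * ((budget_factor D a - 1) * (L + 1)) \<le> budget_factor D a * (n * (L + 1))"
  proof -
    have "budget_factor D a = (budget_factor D a - 1) + 1" by (simp add: budget_factor_def)
    then have "budget_factor D a * (n * (L + 1)) = n * ((budget_factor D a - 1) * (L + 1)) + n * (L + 1)"
      by (metis add_mult_distrib mult.left_commute mult_1)
    moreover have "1 \<le> n * (L + 1)" using n by simp
    ultimately show ?thesis by linarith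
  qed
  finally show ?thesis by (simp only: of_nat_le_iff)
qed

lemma sure_core_program_exact:
  assumes n: "2 \<le> n" and L: "2 ^ L \<le> n" "n < 2 ^ (L + 1)" and M: "(\<Sum>v<n. deg v) \<le> n * L"
    and w: "n * n + n + 1 < 2 ^ w" and t: "104 * n + 106 * (\<Sum>v<n. deg v) + 40 \<le> t"
  shows "sure t (core_program D a b) (initial_store n) (\<lambda>r s. \<forall>x<n. arr s aNum x = core x \<and> arr s aDen x = 1)"
proof -
  have t1: "16 * n + 12 \<le> t" and w1: "n * n < 2 ^ w" using t w by linarith+
  show ?thesis
    unfolding core_program_def sure_Seq
  proof (rule sure_conseq[OF sure_prepare[OF n w1 t1]])
    fix r and s :: store assume "t \<le> r + 16 * n + 12 \<and> prepared s"
    note P = this[unfolded prepared_def]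
    have l: "var s vLog = L" using P L log_unique by blast
    have "L < n" using less_exp[of L] L by linarith
    then have "n * L mod 2 ^ w = n * L" using w1 by (intro mod_less) (meson le_less_trans less_imp_le mult_le_mono2)
    then have "eval_exp w (Less (Mul (Var vN) (Var vLog)) (Var vSum)) s = 0" using P l M by simp
    moreover have "sure (r - 1 - 1) exact s (\<lambda>r s. \<forall>x<n. arr s aNum x = core x \<and> arr s aDen x = 1)"
    proof (rule sure_exact[OF _ _ _ _ _ _ _ refl])
      show "(\<Sum>v<n. deg v) + n + 1 < 2 ^ w" using sum_deg_le w by linarith
      show "88 * n + 106 * (\<Sum>v<n. deg v) + 20 \<le> r - 1 - 1" using P t by linarith
    qed (use P in auto)
    moreover have "0 < r" "0 < r - 1" using P t by linarith+
    ultimately show "0 < r \<and> sure (r - 1) (If (Less (Mul (Var vN) (Var vLog)) (Var vSum)) (sampled D a b) exact) s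
        (\<lambda>r s. \<forall>x<n. arr s aNum x = core x \<and> arr s aDen x = 1)"
      unfolding sure_If by simp
  qed
qed

lemma mean_core_program_sampled:
  assumes D: "2 \<le> D" and a: "2 * D \<le> a" and b: "b = budget_factor D a"
    and n: "2 \<le> n" and L: "2 ^ L \<le> n" "n < 2 ^ (L + 1)" and M: "n * L < (\<Sum>v<n. deg v)"
    and w: "(b + a * (D + 1) + D + 5) * (n * n) < 2 ^ w" and t: "180 * b * (n * (L + 1)) \<le> t"
  shows "mean t (core_program D a b) (initial_store n) (\<lambda>_ s. if settled D s then 0 else 1)
    \<le> of_nat (level_bound D ((D + 1) * n)) * (of_nat n * ennreal (fail_prob D (a * (L + 1))))"
    (is "_ \<le> ?P")
proof -
  let ?S = "a * (L + 1)"
  let ?B = "b * (n * (L + 1))"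
  have Ln: "L + 1 \<le> n" using less_exp[of L] L by linarith
  have nL: "n * (L + 1) \<le> n * n" "n \<le> n * (L + 1)" using Ln by (intro mult_le_mono2) auto
  have nn: "n \<le> n * n" "1 \<le> n * n" "2 * n \<le> n * n" using n by auto
  have ww: "b * (n * n) + a * (D + 1) * (n * n) + (D + 5) * (n * n) < 2 ^ w" using w by (simp add: algebra_simps)
  have b2: "2 \<le> b" by (simp add: b budget_factor_def)
  have B: "?B \<le> b * (n * n)" by (rule mult_le_mono2[OF nL(1)])
  have SD: "n * ?S * (D + 1) \<le> a * (D + 1) * (n * n)"
  proof -
    have "n * ?S * (D + 1) = a * (D + 1) * (n * (L + 1))" by (simp only: mult_ac)
    also have "\<dots> \<le> a * (D + 1) * (n * n)" by (rule mult_le_mono2[OF nL(1)])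
    finally show ?thesis .
  qed
  have Dn: "(D + 1) * n + n \<le> (D + 5) * (n * n)"
  proof -
    have "(D + 1) * n + n \<le> (D + 5) * n" by (simp add: algebra_simps)
    also have "\<dots> \<le> (D + 5) * (n * n)" using nn by (intro mult_le_mono2)
    finally show ?thesis .
  qed
  have D1: "D + 5 \<le> (D + 5) * (n * n)" using nn by simp
  have bn: "b \<le> b * (n * n)" using nn by simp
  have an: "a \<le> a * (D + 1) * (n * n)" "?S \<le> a * (D + 1) * (n * n)"
  proof -
    have "1 * 1 \<le> (D + 1) * (n * n)" using nn(2) by (intro mult_le_mono) auto
    then have "1 \<le> (D + 1) * (n * n)" by simp
    then have "a * 1 \<le> a * ((D + 1) * (n * n))" by (rule mult_le_mono2)
    then show "a \<le> a * (D + 1) * (n * n)" by (simp only: mult.assoc mult_1_right)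
    have "n * n \<le> (D + 1) * (n * n)" by simp
    then have "L + 1 \<le> (D + 1) * (n * n)" using Ln nn(1) by linarith
    then have "a * (L + 1) \<le> a * ((D + 1) * (n * n))" by (intro mult_le_mono2)
    then show "?S \<le> a * (D + 1) * (n * n)" by (simp only: mult.assoc)
  qed
  have t1: "16 * n + 12 \<le> t" and w1: "n * n < 2 ^ w"
  proof -
    have "2 * n \<le> b * (n * (L + 1))" using b2 nL by (intro mult_le_mono) auto
    then show "16 * n + 12 \<le> t" using t n by linarith
    have "1 * (n * n) \<le> (D + 5) * (n * n)" by (intro mult_le_mono1) simp
    then show "n * n < 2 ^ w" using ww by linarith
  qed
  let ?f = "\<lambda>_ s. if settled D s then 0 else (1::ennreal)"
  have "mean t prepare (initial_store n) (\<lambda>r s. if r = 0 then \<top> else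
      mean (r - 1) (If (Less (Mul (Var vN) (Var vLog)) (Var vSum)) (sampled D a b) exact) s ?f) \<le> ?P"
  proof (rule mean_le_sure[OF sure_prepare[OF n w1 t1]])
    fix r and s :: store assume "t \<le> r + 16 * n + 12 \<and> prepared s"
    note P = this[unfolded prepared_def]
    have l: "var s vLog = L" using P L log_unique by blast
    have N: "var s vN = n" using P by blast
    have mods: "n * L mod 2 ^ w = n * L" "(L + 1) mod 2 ^ w = L + 1" "a mod 2 ^ w = a" "b mod 2 ^ w = b"
      "?S mod 2 ^ w = ?S" "(D + 1) mod 2 ^ w = D + 1" "(D + 1) * n mod 2 ^ w = (D + 1) * n"
      "n * (L + 1) mod 2 ^ w = n * (L + 1)" "?B mod 2 ^ w = ?B" "(1::nat) mod 2 ^ w = 1"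
    proof -
      show "n * L mod 2 ^ w = n * L" using nL w1 by (intro mod_less) simp
      show "(L + 1) mod 2 ^ w = L + 1" using Ln nn w1 by (intro mod_less) linarith
      show "a mod 2 ^ w = a" "?S mod 2 ^ w = ?S" using an ww by (intro mod_less; linarith)+
      show "b mod 2 ^ w = b" "?B mod 2 ^ w = ?B" using bn B ww by (intro mod_less; linarith)+
      show "(D + 1) mod 2 ^ w = D + 1" "(D + 1) * n mod 2 ^ w = (D + 1) * n" using D1 Dn ww by (intro mod_less; linarith)+
      show "n * (L + 1) mod 2 ^ w = n * (L + 1)" using nL w1 by (intro mod_less) linarith
      show "(1::nat) mod 2 ^ w = 1" using w_pos by simp
    qed
    define s1 where "s1 = set_var vBudget ?B (set_var vLevel ((D + 1) * n) (set_var vThr ?S s))"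
    have lb: "level_bound D ((D + 1) * n) \<le> b * (L + 1)" unfolding b using L n by (intro level_bound_le) auto
    have fuel: "level_bound D ((D + 1) * n) * (61 * n + 45) + 41 * ?B + 1 + 10 \<le> r"
    proof -
      \<comment> \<open>Since \<open>n \<ge> 2\<close>, the 45 is at most
        \<open>23 * n\<close>.\<close>
      have "level_bound D ((D + 1) * n) * (61 * n + 45) \<le> (b * (L + 1)) * (84 * n)" using lb n by (intro mult_le_mono) auto
      also have "\<dots> = 84 * (b * (n * (L + 1)))" by (simp only: mult_ac)
      finally have "level_bound D ((D + 1) * n) * (61 * n + 45) \<le> 84 * ?B" .
      moreover have "2 * n \<le> ?B" using b2 nL by (intro mult_le_mono) auto
      moreover have "180 * ?B \<le> r + 16 * n + 12" using P t by linarith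
      ultimately show ?thesis using n by linarith
    qed
    have "mean (r - 2 - 2 - 2 - 2) (While (Less (Const (D - 1)) (Var vLevel)) (sampled_round D)) s1 ?f \<le> ?P"
    proof (rule mean_sampled_loop[where B = ?B and S = ?S, OF D])
      show "2 * D \<le> ?S" by (rule order_trans[OF a]) simp
      show "?B + n * ?S * (D + 1) + (D + 1) * n < 2 ^ w" using B SD Dn ww by linarith
      show "D + 1 < 2 ^ w" using D1 ww by linarith
      show "?B + n < 2 ^ w" using B Dn ww by linarith
      show "1 + potential D ?S ((D + 1) * n) \<le> real ?B" unfolding b using D L n by (intro potential_budget) auto
      show "level_bound D ((D + 1) * n) * (61 * n + 45) + 41 * ?B + 1 \<le> r - 2 - 2 - 2 - 2" using fuel by linarith
    qed (use P n in \<open>auto simp: s1_def\<close>)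
    moreover have "mean (r - 2) (sampled D a b) s ?f =
        mean (r - 2 - 2 - 2 - 2) (While (Less (Const (D - 1)) (Var vLevel)) (sampled_round D)) s1 ?f"
    proof -
      have "2 \<le> r - 2" "2 \<le> r - 2 - 2" "2 \<le> r - 2 - 2 - 2" using fuel by linarith+
      moreover have "eval_exp w (Mul (Const a) (Add (Var vLog) (Const 1))) s = ?S"
        by (simp only: eval_exp.simps l mods)
      moreover have "eval_exp w (Mul (Const (D + 1)) (Var vN)) (set_var vThr ?S s) = (D + 1) * n"
        using N by (simp only: eval_exp.simps mods var_set_var) (simp add: mods(7)[simplified])
      moreover have "eval_exp w (Mul (Const b) (Mul (Var vN) (Add (Var vLog) (Const 1))))
          (set_var vLevel ((D + 1) * n) (set_var vThr ?S s)) = ?B"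
      proof -
        have "var (set_var vLevel ((D + 1) * n) (set_var vThr ?S s)) vN = n"
          "var (set_var vLevel ((D + 1) * n) (set_var vThr ?S s)) vLog = L" using N l by simp_all
        then show ?thesis by (simp only: eval_exp.simps mods)
      qed
      ultimately show ?thesis unfolding sampled_def s1_def by (simp only: mean_Assign_Seq)
    qed
    moreover have "eval_exp w (Less (Mul (Var vN) (Var vLog)) (Var vSum)) s \<noteq> 0" using P l M mods w_pos by simp
    moreover have "0 < r - 1" "r - 1 - 1 = r - 2" "r \<noteq> 0" using fuel by linarith+
    ultimately show "(if r = 0 then \<top> else
      mean (r - 1) (If (Less (Mul (Var vN) (Var vLog)) (Var vSum)) (sampled D a b) exact) s ?f) \<le> ?P"
      by (simp only: mean_If if_True if_False simp_thms)
  qed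
  then show ?thesis unfolding core_program_def mean_Seq[of t prepare] .
qed

section \<open>Approximation ratio and failure probability\<close>

lemma approximates_exact:
  assumes "0 < \<epsilon>" "\<forall>x<n. arr s aNum x = core x \<and> arr s aDen x = 1"
  shows "approximates_core_numbers \<epsilon> n E s"
  unfolding approximates_core_numbers_def output_value_def
proof (intro allI impI conjI)
  fix x assume x: "x < n"
  then have o: "arr s 0 x = core x" "arr s 1 x = 1" using assms(2) by auto
  show "arr s 1 x \<noteq> 0" using o by simp
  have "real (core x) * 1 \<le> real (core x) * (1 + \<epsilon>)" using assms(1) by (intro mult_left_mono) auto
  then show "real (core x) / (1 + \<epsilon>) \<le> real (arr s 0 x) / real (arr s 1 x)"
    "real (arr s 0 x) / real (arr s 1 x) \<le> (1 + \<epsilon>) * real (core x)"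
    unfolding o using assms(1) by (simp_all add: divide_le_eq mult.commute)
qed

lemma approximates_settled:
  assumes \<epsilon>: "0 < \<epsilon>" and D: "2 \<le> D" "2 \<le> \<epsilon> * (real D - 1)" and s: "settled D s"
  shows "approximates_core_numbers \<epsilon> n E s"
  unfolding approximates_core_numbers_def output_value_def
proof (intro allI impI)
  fix x assume x: "x < n"
  have "arr s 0 x = 0 \<and> arr s 1 x = 1 \<and> core x = 0 \<or>
    (D - 1) * core x < arr s 0 x \<and> (D - 1) * arr s 0 x \<le> D * (D + 1) * core x \<and> arr s 1 x = D + 1"
    by (rule s[unfolded settled_def, rule_format, OF x])
  then show "arr s 1 x \<noteq> 0 \<and> real (core x) / (1 + \<epsilon>) \<le> real (arr s 0 x) / real (arr s 1 x) \<and>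
    real (arr s 0 x) / real (arr s 1 x) \<le> (1 + \<epsilon>) * real (core x)"
  proof (elim disjE conjE, goal_cases)
    case 2
    define c k d where "c = real (core x)" and "k = real (arr s 0 x)" and "d = real D"
    have d: "1 < d" "2 \<le> \<epsilon> * (d - 1)" using D by (simp_all add: d_def)
    have c0: "0 \<le> c" by (simp add: c_def)
    have "real ((D - 1) * core x) \<le> real (arr s 0 x)" using 2(1) by (simp only: of_nat_le_iff less_imp_le)
    then have low: "(d - 1) * c \<le> k" using D by (simp add: c_def k_def d_def of_nat_diff)
    have "real ((D - 1) * arr s 0 x) \<le> real (D * (D + 1) * core x)" using 2(2) by (simp only: of_nat_le_iff)
    then have high: "(d - 1) * k \<le> d * (d + 1) * c" using D by (simp add: c_def k_def d_def of_nat_diff algebra_simps)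
    \<comment> \<open>The choice of \<open>D\<close> is exactly the first inequality, a bound on
      \<open>(d + 1) / (d - 1)\<close> for the lower estimate; the upper one only needs
      \<open>d / (d - 1)\<close>.\<close>
    have e1: "d + 1 \<le> (1 + \<epsilon>) * (d - 1)" and e2: "d \<le> (1 + \<epsilon>) * (d - 1)" using d by (simp_all add: algebra_simps)
    have "c * (d + 1) \<le> c * ((1 + \<epsilon>) * (d - 1))" using e1 c0 by (rule mult_left_mono)
    also have "\<dots> = (1 + \<epsilon>) * ((d - 1) * c)" by (simp only: mult_ac)
    also have "\<dots> \<le> (1 + \<epsilon>) * k" using low \<epsilon> by (intro mult_left_mono) auto
    finally have A: "c / (1 + \<epsilon>) \<le> k / (d + 1)" using \<epsilon> d by (simp add: field_simps)
    have "(d - 1) * k \<le> (d + 1) * c * d" using high by (simp only: mult_ac)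
    also have "\<dots> \<le> (d + 1) * c * ((1 + \<epsilon>) * (d - 1))" using e2 c0 d by (intro mult_left_mono) auto
    also have "\<dots> = (d - 1) * ((1 + \<epsilon>) * c * (d + 1))" by (simp only: mult_ac)
    finally have "k \<le> (1 + \<epsilon>) * c * (d + 1)" using d by simp
    then have "k / (d + 1) \<le> (1 + \<epsilon>) * c" using d by (simp add: pos_divide_le_eq)
    then show ?thesis using A 2(3) by (simp add: c_def k_def d_def add.commute)
  qed simp_all
qed

text \<open>The exponent leaves room for the union bound: one power of n for the vertices and one
  for the levels, with a third to spare.\<close>

lemma fail_prob_le:
  assumes D: "2 \<le> D" and c: "0 < c" and a: "16 * (real D)\<^sup>2 * (c + 3) \<le> real a"
    and n: "2 \<le> n" and L: "n < 2 ^ (L + 1)"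
  shows "fail_prob D (a * (L + 1)) \<le> real n powr - (c + 3)"
proof -
  have "ln (real n) \<le> real L + 1" using L n by (intro ln_le_log) auto
  then have "(c + 3) * ln (real n) \<le> (c + 3) * (real L + 1)" using c by (intro mult_left_mono) auto
  also have "\<dots> \<le> real a / (16 * (real D)\<^sup>2) * (real L + 1)"
    using a D by (intro mult_right_mono) (auto simp: pos_le_divide_eq mult.commute)
  also have "\<dots> = real (a * (L + 1)) / (16 * (real D)\<^sup>2)" by (simp add: distrib_left add_divide_distrib)
  finally have "- (real (a * (L + 1)) / (16 * (real D)\<^sup>2)) \<le> - (c + 3) * ln (real n)"
    by (simp only: mult_minus_left neg_le_iff_le)
  then show ?thesis using n unfolding fail_prob_def powr_def by simp
qed

text \<open>One \<open>t0\<close> meets all three bounds. The middle one has no term in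
  \<open>n\<close>, which is possible because \<open>n \<le> 2 * card E\<close> lets the edges pay
  for the vertices.\<close>

lemma core_program_correct:
  assumes \<epsilon>: "0 < \<epsilon>" and c: "0 < c" and D: "2 \<le> D" "2 \<le> \<epsilon> * (real D - 1)"
    and a: "2 * D \<le> a" "16 * (real D)\<^sup>2 * (c + 3) \<le> real a" and b: "b = budget_factor D a"
    and n: "2 \<le> n" and w: "(b + a * (D + 1) + D + 5) * (n * n) < 2 ^ w"
  shows "\<exists>t0. real t0 \<le> (500 + 1000 * real b) * real (card E) + 500 * real n \<and>
    (n \<le> 2 * card E \<longrightarrow> real t0 \<le> (1500 + 1000 * real b) * real (card E)) \<and>
    real t0 \<le> (500 + 1000 * real b) * (real n * log 2 (real n)) \<and>
    (\<forall>t\<ge>t0. mean t (core_program D a b) (initial_store n)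
      (\<lambda>_ s. if approximates_core_numbers \<epsilon> n E s then 0 else 1) \<le> ennreal (real b / real n powr c))"
proof -
  obtain L where L: "2 ^ L \<le> n" "n < 2 ^ (L + 1)"
    using ex_power_ivl1[of 2 n] n by auto
  have L1: "1 \<le> L"
  proof (rule ccontr)
    assume "\<not> 1 \<le> L"
    then show False using L(2) n by (cases L) auto
  qed
  have Llog: "real L \<le> log 2 (real n)"
  proof -
    have "(2::real) ^ L \<le> real n" using L(1) by (metis of_nat_le_iff of_nat_numeral of_nat_power)
    then show ?thesis using n by (simp add: le_log_iff powr_realpow)
  qed
  have nlog: "real (n * L) \<le> real n * log 2 (real n)" using Llog by (simp add: mult_left_mono)
  have nlog1: "real n \<le> real n * log 2 (real n)" using Llog L1 mult_left_mono[of 1 "log 2 (real n)" "real n"] by simp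
  let ?M = "\<Sum>v<n. deg v"
  have M: "?M = 2 * card E" by (rule sum_deg)
  let ?f = "\<lambda>_ s. if approximates_core_numbers \<epsilon> n E s then 0 else (1::ennreal)"
  show ?thesis
  proof (cases "?M \<le> n * L")
    case True
    define t0 where "t0 = 104 * n + 106 * ?M + 40"
    have t0: "real t0 \<le> 124 * real n + 212 * real (card E)" using n by (simp add: t0_def M)
    have "real t0 \<le> 124 * real n + 106 * real (n * L)"
    proof -
      have "real ?M \<le> real (n * L)" using True by (simp only: of_nat_le_iff)
      then show ?thesis using n by (simp add: t0_def)
    qed
    also have "\<dots> \<le> 500 * (real n * log 2 (real n))" using nlog nlog1 by simp
    also have "\<dots> \<le> (500 + 1000 * real b) * (real n * log 2 (real n))"
      using nlog1 by (intro mult_right_mono) auto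
    finally have 3: "real t0 \<le> (500 + 1000 * real b) * (real n * log 2 (real n))" .
    have bE: "0 \<le> real b * real (card E)" by simp
    have 1: "real t0 \<le> (500 + 1000 * real b) * real (card E) + 500 * real n"
      using t0 bE unfolding distrib_right mult.assoc by linarith
    have 2: "n \<le> 2 * card E \<longrightarrow> real t0 \<le> (1500 + 1000 * real b) * real (card E)"
    proof
      assume "n \<le> 2 * card E"
      then have "real n \<le> 2 * real (card E)" by (metis of_nat_le_iff of_nat_mult of_nat_numeral)
      then show "real t0 \<le> (1500 + 1000 * real b) * real (card E)" using t0 bE unfolding distrib_right mult.assoc by linarith
    qed
    have "mean t (core_program D a b) (initial_store n) ?f \<le> ennreal (real b / real n powr c)" if "t0 \<le> t" for t
    proof (rule mean_le_sure)
      have "n * 1 \<le> n * n" using n by (intro mult_le_mono2) simp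
      then have "n * n + n + 1 \<le> 3 * (n * n)" using n by linarith
      also have "\<dots> \<le> (b + a * (D + 1) + D + 5) * (n * n)" by (intro mult_le_mono1) simp
      finally have "n * n + n + 1 < 2 ^ w" using w by simp
      then show "sure t (core_program D a b) (initial_store n) (\<lambda>r s. \<forall>x<n. arr s aNum x = core x \<and> arr s aDen x = 1)"
        using that by (intro sure_core_program_exact[OF n L True]) (simp_all add: t0_def)
      fix r and s :: store assume "\<forall>x<n. arr s aNum x = core x \<and> arr s aDen x = 1"
      from approximates_exact[OF \<epsilon> this] show "?f r s \<le> ennreal (real b / real n powr c)" by simp
    qed
    then show ?thesis using 1 2 3 by blast
  next
    case False
    then have F: "n * L < ?M" by simp
    define t0 where "t0 = 180 * b * (n * (L + 1))"
    \<comment> \<open>As \<open>L \<ge> 1\<close>, the cost is a constant times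
      \<open>n * L\<close>, and in this branch \<open>n * L\<close> is below the degree sum; hence
      the bound in terms of the edges.\<close>
    have "n * (L + 1) \<le> 2 * (n * L)" using L1 by (cases L) auto
    then have "180 * b * (n * (L + 1)) \<le> 180 * b * (2 * (n * L))" by (rule mult_le_mono2)
    then have t0: "t0 \<le> 360 * b * (n * L)" by (simp add: t0_def)
    have t0E: "real t0 \<le> 720 * real b * real (card E)"
    proof -
      have "360 * b * (n * L) \<le> 360 * b * (2 * card E)" using F M by (intro mult_le_mono2) simp
      also have "\<dots> = 720 * b * card E" by simp
      finally have "t0 \<le> 720 * b * card E" using t0 by linarith
      then have "real t0 \<le> real (720 * b * card E)" by (simp only: of_nat_le_iff)
      then show ?thesis by simp
    qed
    have bE: "0 \<le> real b * real (card E)" by simp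
    have 1: "real t0 \<le> (500 + 1000 * real b) * real (card E) + 500 * real n"
      using t0E bE unfolding distrib_right mult.assoc by linarith
    have 2: "n \<le> 2 * card E \<longrightarrow> real t0 \<le> (1500 + 1000 * real b) * real (card E)"
      using t0E bE unfolding distrib_right mult.assoc by linarith
    have 3: "real t0 \<le> (500 + 1000 * real b) * (real n * log 2 (real n))"
    proof -
      have "real t0 \<le> real (360 * b * (n * L))" using t0 by (simp only: of_nat_le_iff)
      also have "\<dots> = (360 * real b) * real (n * L)" by simp
      also have "\<dots> \<le> (500 + 1000 * real b) * real (n * L)" by (intro mult_right_mono) auto
      also have "\<dots> \<le> (500 + 1000 * real b) * (real n * log 2 (real n))" using nlog by (intro mult_left_mono) auto
      finally show ?thesis .
    qed
    let ?p = "fail_prob D (a * (L + 1))"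
    have p: "of_nat (level_bound D ((D + 1) * n)) * (of_nat n * ennreal ?p) \<le> ennreal (real b / real n powr c)"
    proof -
      have "L + 1 \<le> n" using less_exp[of L] L by linarith
      then have "b * (L + 1) \<le> b * n" by (rule mult_le_mono2)
      then have lb: "level_bound D ((D + 1) * n) \<le> b * n"
        using level_bound_le[OF L(2), of D a, folded b] n by linarith
      have p0: "0 \<le> ?p" by (simp add: fail_prob_def)
      have "real (level_bound D ((D + 1) * n)) * (real n * ?p) \<le> real (b * n) * (real n * real n powr - (c + 3))"
        using lb p0 fail_prob_le[OF D(1) c a(2) n L(2)] by (intro mult_mono) (simp_all only: of_nat_le_iff, auto)
      also have "\<dots> = real b * (real n powr 2 * real n powr - (c + 3))"
        using n by (simp add: powr_numeral power2_eq_square)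
      also have "real n powr 2 * real n powr - (c + 3) = real n powr (- c - 1)"
        unfolding powr_add[symmetric] by (rule arg_cong[of _ _ "(powr) (real n)"]) simp
      also have "real b * real n powr (- c - 1) \<le> real b * real n powr (- c)"
        using n by (intro mult_left_mono powr_mono) auto
      also have "\<dots> = real b / real n powr c" by (simp add: powr_minus_divide)
      finally have "ennreal (real (level_bound D ((D + 1) * n)) * (real n * ?p)) \<le> ennreal (real b / real n powr c)"
        by (rule ennreal_leI)
      moreover have "of_nat k * (of_nat l * ennreal q) = ennreal (real k * (real l * q))" if "0 \<le> q" for k l q
        using that by (simp add: ennreal_mult ennreal_of_nat_eq_real_of_nat)
      ultimately show ?thesis using p0 by (simp only:)
    qed
    have "mean t (core_program D a b) (initial_store n) ?f \<le> ennreal (real b / real n powr c)" if "t0 \<le> t" for t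
    proof -
      have "mean t (core_program D a b) (initial_store n) ?f \<le>
          mean t (core_program D a b) (initial_store n) (\<lambda>_ s. if settled D s then 0 else 1)"
        using approximates_settled[OF \<epsilon> D] by (intro mean_mono) auto
      also have "\<dots> \<le> of_nat (level_bound D ((D + 1) * n)) * (of_nat n * ennreal ?p)"
        using that by (intro mean_core_program_sampled[OF D(1) a(1) b n L F w]) (simp add: t0_def)
      also note p
      finally show ?thesis .
    qed
    then show ?thesis using 1 2 3 by blast
  qed
qed

end

text \<open>A constant factor is no obstacle: \<open>G < 2 ^ G \<le> (n + 1) ^ G\<close>, so
  multiplying the word length by \<open>G + 2\<close> makes room for
  \<open>G * (n * n)\<close>.\<close>

lemma word_size_large:
  assumes n: "2 \<le> n"
  shows "G * (n * n) < 2 ^ word_size (G + 2) n"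
proof -
  define h where "h = nat \<lceil>log 2 (real n + 1)\<rceil>"
  have "real n + 1 \<le> 2 powr h"
  proof -
    have "log 2 (real n + 1) \<le> real h" unfolding h_def by linarith
    then show ?thesis by (simp add: log_le_iff)
  qed
  then have "real (n + 1) \<le> real (2 ^ h)" by (simp add: powr_realpow)
  then have h: "n + 1 \<le> 2 ^ h" by (simp only: of_nat_le_iff)
  have "G < 2 ^ G" by (rule less_exp)
  also have "\<dots> \<le> (n + 1) ^ G" using n by (intro power_mono) auto
  finally have "G * (n * n) < (n + 1) ^ G * (n * n)" using n by simp
  also have "\<dots> \<le> (n + 1) ^ G * ((n + 1) * (n + 1))" by (intro mult_le_mono) auto
  also have "\<dots> = (n + 1) ^ (G + 2)" by (simp only: power_add power2_eq_square)
  also have "\<dots> \<le> (2 ^ h) ^ (G + 2)" using h by (intro power_mono) auto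
  also have "\<dots> = 2 ^ word_size (G + 2) n" by (simp only: word_size_def h_def[symmetric] power_mult mult.commute flip: power_mult)
  finally show ?thesis .
qed

text \<open>Writing \<open>n\<close> outputs takes \<open>n\<close> steps, so with few edges a bound
  O(m) is impossible; this is the reason for \<open>max m (real n)\<close>. Under
  \<open>n \<le> 2 * m\<close>, in particular in every graph without isolated vertices, the bound
  holds with \<open>m\<close> itself. For \<open>n = 1\<close> the term n log n would vanish, hence
  \<open>n \<ge> 2\<close>.\<close>

theorem theorem1:
  fixes \<epsilon> c :: real
  assumes "0 < \<epsilon>" and "\<epsilon> \<le> 1" and "0 < c"
  shows "\<exists>(P :: com) (\<kappa> :: nat) (C :: real) (A :: real). \<kappa> \<ge> 1 \<and>
    (\<forall>(n :: nat) (E :: nat set set) (adj :: nat \<Rightarrow> nat list).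
       n \<ge> 2 \<and> incident_lists n E adj \<longrightarrow>
       (let m = real (card E);
            L = real n * log 2 (real n);
            T = C * min (max m (real n)) L
        in halts_within \<kappa> P n adj T \<and>
           (real n \<le> 2 * m \<longrightarrow> halts_within \<kappa> P n adj (C * min m L)) \<and>
           measure_pmf.prob (run \<kappa> P n adj T) {(p, s). p = Skip \<and> approximates_core_numbers \<epsilon> n E s}
             \<ge> 1 - A / real n powr c))"
proof -
  \<comment> \<open>Chosen such that \<open>\<epsilon> * (D - 1) \<ge> 2\<close>, the condition of
    \<open>approximates_settled\<close>.\<close>
  define D where "D = nat \<lceil>2 / \<epsilon>\<rceil> + 1"
  have Dr: "2 / \<epsilon> \<le> real D - 1" unfolding D_def by simp linarith
  have "2 \<le> 2 / \<epsilon>" using assms by (simp add: pos_le_divide_eq)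
  then have "3 \<le> real D" using Dr by linarith
  then have D: "2 \<le> D" "2 \<le> \<epsilon> * (real D - 1)"
    using Dr assms(1) by (simp_all add: pos_divide_le_eq mult.commute)
  \<comment> \<open>The first summand absorbs the rounding of the quotas, the second yields the
    failure probability of \<open>fail_prob_le\<close>.\<close>
  define a where "a = 2 * D + nat \<lceil>16 * (real D)\<^sup>2 * (c + 3)\<rceil>"
  have a: "2 * D \<le> a" "16 * (real D)\<^sup>2 * (c + 3) \<le> real a" unfolding a_def by (simp, simp, linarith)
  define b where "b = budget_factor D a"
  \<comment> \<open>\<open>G * (n * n)\<close> dominates the numbers that the program computes, so a
    word that holds it excludes overflow.\<close>
  define G where "G = b + a * (D + 1) + D + 5"
  define C where "C = 1500 + 1000 * real b"
  define P where "P = core_program D a b"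
  have main: "halts_within (G + 2) P n adj (C * min (max (real (card E)) (real n)) (real n * log 2 (real n))) \<and>
      (real n \<le> 2 * real (card E) \<longrightarrow> halts_within (G + 2) P n adj (C * min (real (card E)) (real n * log 2 (real n)))) \<and>
      measure_pmf.prob (run (G + 2) P n adj (C * min (max (real (card E)) (real n)) (real n * log 2 (real n))))
        {(p, s). p = Skip \<and> approximates_core_numbers \<epsilon> n E s} \<ge> 1 - real b / real n powr c"
    if n: "n \<ge> 2" and inc: "incident_lists n E adj" for n E adj
  proof -
    define w where "w = word_size (G + 2) n"
    have w: "G * (n * n) < 2 ^ w" unfolding w_def by (rule word_size_large[OF n])
    have nG: "2 * n \<le> G * (n * n)"
    proof -
      have "2 * n \<le> n * n" using n by simp
      also have "\<dots> \<le> G * (n * n)" by (simp add: G_def)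
      finally show ?thesis .
    qed
    interpret incident_ram w n adj E
    proof unfold_locales
      show "0 < w"
      proof (rule ccontr)
        assume "\<not> 0 < w"
        then show False using w nG n by simp
      qed
      show "2 * n < 2 ^ w" using w nG by linarith
    qed (rule inc)
    define L where "L = real n * log 2 (real n)"
    obtain t0 where t0: "real t0 \<le> (500 + 1000 * real b) * real (card E) + 500 * real n"
      "n \<le> 2 * card E \<longrightarrow> real t0 \<le> (1500 + 1000 * real b) * real (card E)"
      "real t0 \<le> (500 + 1000 * real b) * L"
      "\<forall>t\<ge>t0. mean t P (initial_store n)
        (\<lambda>_ s. if approximates_core_numbers \<epsilon> n E s then 0 else 1) \<le> ennreal (real b / real n powr c)"
      using core_program_correct[OF assms(1,3) D a b_def n w[unfolded G_def]] unfolding L_def P_def by blast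
    have L0: "0 \<le> L" using n by (simp add: L_def)
    have CL: "real t0 \<le> C * L"
      using t0(3) mult_right_mono[OF _ L0, of "500 + 1000 * real b" C] by (simp add: C_def)
    have halt: "halts_within (G + 2) P n adj T" if T: "real t0 \<le> T" for T
    proof -
      have "t0 \<le> nat \<lfloor>T\<rfloor>" using T by (simp add: le_nat_floor)
      then have "mean (nat \<lfloor>T\<rfloor>) P (initial_store n)
          (\<lambda>_ s. if approximates_core_numbers \<epsilon> n E s then 0 else 1) < \<top>"
        using t0(4) by (metis ennreal_less_top le_less_trans)
      from sure_steps[OF sure_if_mean_finite[OF this]] show ?thesis
        unfolding halts_within_def run_def w_def[symmetric] by auto
    qed
    have T1: "real t0 \<le> C * min (max (real (card E)) (real n)) L"
    proof -
      have "(500 + 1000 * real b) * real (card E) \<le> (500 + 1000 * real b) * max (real (card E)) (real n)"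
        by (intro mult_left_mono) auto
      moreover have "500 * real n \<le> 1000 * max (real (card E)) (real n)" by simp
      ultimately have "real t0 \<le> C * max (real (card E)) (real n)"
        using t0(1) by (simp add: C_def distrib_right)
      then show ?thesis using CL by (simp add: min_def)
    qed
    have T2: "real t0 \<le> C * min (real (card E)) L" if "real n \<le> 2 * real (card E)"
    proof -
      have "n \<le> 2 * card E" using that by linarith
      then show ?thesis using t0(2) CL by (simp add: min_def C_def)
    qed
    have "1 - real b / real n powr c \<le>
        measure_pmf.prob (steps w n adj (nat \<lfloor>C * min (max (real (card E)) (real n)) L\<rfloor>) (P, initial_store n))
          {(p, s). p = Skip \<and> approximates_core_numbers \<epsilon> n E s}"
    proof (rule prob_steps_le)
      have "t0 \<le> nat \<lfloor>C * min (max (real (card E)) (real n)) L\<rfloor>" using T1 by (simp add: le_nat_floor)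
      then show "mean (nat \<lfloor>C * min (max (real (card E)) (real n)) L\<rfloor>) P (initial_store n)
          (\<lambda>_ s. if approximates_core_numbers \<epsilon> n E s then 0 else 1) \<le> ennreal (real b / real n powr c)"
        using t0(4) by blast
    qed simp
    then show ?thesis
      using halt[OF T1] halt[OF T2] unfolding run_def w_def[symmetric] L_def by blast
  qed
  have "1 \<le> G + 2" by simp
  then show ?thesis
    using main unfolding Let_def by blast
qed

end
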